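(* Let $\mathcal{U}\subset\mathbb{R}^4$ be an open bounded set and let $G:\mathcal{U}\to\mathbb{R}$, $G=G(x,y)=G(x_1,x_2,y_1,y_2)$, be a $C^2$ function such that $G$ and its first and second derivatives are bounded uniformly on $\mathcal{U}$. Assume further that there is a constant $C_0\ge1$ such that on $\mathcal{U}$ $$|\nabla_y G(x,y)|\ge C_0^{-1}$$ and $$C_0^{-1}\le\left|\det\begin{pmatrix} 0 & G_3 & G_4 \\ {G_1} & G_{31} & G_{41} \\ {G_2} & G_{32} & G_{42} \end{pmatrix}\right|\le C_0,$$ where $G_i$ is the derivative of $G$ in the $i$-th variable and $G_{ij}$ are the corresponding second-order derivatives. For $x\in\mathbb{R}^2$ let $$\Gamma_x=\{y\in\mathbb{R}^2:\ (x,y)\in\mathcal{U},\ G(x,y)=0\}.$$ Let $E\subset\mathbb{R}^2$ be a self-similar $1$-set with $n$-th iterations $E_n$, as defined in the context. Assume that there is a fixed compact set $\mathcal{V}\subset\mathcal{U}$ such that $\{(x,y)\in\mathcal{U}:\ x\in E_n,\ G(x,y)=0\}\subset\mathcal{V}$ for all $n$. Define $\mathcal{G}(E_n)=\bigcup_{x\in E_n}\Gamma_x\subset\mathbb{R}^2$ and $\mathcal{G}(E)=\bigcup_{x\in E}\Gamma_x$. Then there is a constant $C$ independent of $n$ such that for all $n$ $$|\mathcal{G}(E_n)|\le C\,\mathrm{Fav}(E_{\lfloor n/2\rfloor}),$$ and $$|\mathcal{G}(E)|=\mathrm{Fav}(E)=0.$$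
   Context: $|\cdot|$ of a set denotes Lebesgue measure of the appropriate dimension. Self-similar set: let $L\in\mathbb{N}$, $L\ge 3$, let $b_1,\dots,b_L\in\mathbb{R}^2$ be not all collinear, and let $\Lambda_i(x)=L^{-1}x+b_i$. $E\subset\mathbb{R}^2$ is the unique non-empty compact set with $E=\bigcup_{i=1}^L\Lambda_i(E)$. It is assumed that the Strong Separation Condition holds: $\Lambda_i(E)\cap\Lambda_j(E)=\emptyset$ for $i\ne j$. (Such an $E$ has Hausdorff dimension 1 and is purely unrectifiable.) The iterations are $E_0=[0,1]^2$, $E_n=\bigcup_{i=1}^L\Lambda_i(E_{n-1})$ for $n\ge1$. $\mathrm{Fav}(F)=\int_0^\pi|\pi_\theta(F)|\,d\theta$ with $\pi_\theta(x)=x_1\cos\theta+x_2\sin\theta$. *)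

theory Defs
  imports "HOL-Analysis.Analysis"
begin

definition sim :: "nat \<Rightarrow> (nat \<Rightarrow> real^2) \<Rightarrow> nat \<Rightarrow> real^2 \<Rightarrow> real^2" where
  "sim L b i x = (1 / real L) *\<^sub>R x + b i"

text \<open>The attractor is singled out by its characterising properties (non-empty, compact,
  invariant); by uniqueness of the attractor this determines \<open>E\<close> from \<open>L\<close> and \<open>b\<close>.\<close>

definition self_similar_1set :: "nat \<Rightarrow> (nat \<Rightarrow> real^2) \<Rightarrow> (real^2) set \<Rightarrow> bool" where
  "self_similar_1set L b E \<longleftrightarrow>
     3 \<le> L \<and> \<not> collinear (b ` {1..L}) \<and>
     E \<noteq> {} \<and> compact E \<and> E = (\<Union>i\<in>{1..L}. sim L b i ` E) \<and>
     (\<forall>i\<in>{1..L}. \<forall>j\<in>{1..L}. i \<noteq> j \<longrightarrow> sim L b i ` E \<inter> sim L b j ` E = {})"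

text \<open>Here \<open>cbox 0 1\<close> is the unit square: \<open>1 :: real^2\<close> is the vector \<open>(1, 1)\<close>.
  It is not required to contain \<open>E\<close>, nor are the iterates required to be nested.\<close>

primrec iterate :: "nat \<Rightarrow> (nat \<Rightarrow> real^2) \<Rightarrow> nat \<Rightarrow> (real^2) set" where
  "iterate L b 0 = cbox 0 1"
| "iterate L b (Suc n) = (\<Union>i\<in>{1..L}. sim L b i ` iterate L b n)"

definition proj_angle :: "real \<Rightarrow> real^2 \<Rightarrow> real" where
  "proj_angle \<theta> x = x $ 1 * cos \<theta> + x $ 2 * sin \<theta>"

definition Fav :: "(real^2) set \<Rightarrow> ennreal" where
  "Fav F = (\<integral>\<^sup>+\<theta>\<in>{0..pi}. emeasure lebesgue (proj_angle \<theta> ` F) \<partial>lborel)"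

text \<open>Four-dimensional space is \<open>real^2 \<times> real^2\<close> with points \<open>(x, y)\<close>; its coordinates, in the
  order \<open>x\<^sub>1, x\<^sub>2, y\<^sub>1, y\<^sub>2\<close>, are numbered 1 to 4 (\<open>coord_vec\<close> is only meaningful for these indices).\<close>

definition coord_vec :: "nat \<Rightarrow> (real^2) \<times> (real^2)" where
  "coord_vec i =
     (if i = 1 then (axis 1 1, 0) else if i = 2 then (axis 2 1, 0)
      else if i = 3 then (0, axis 1 1) else (0, axis 2 1))"

text \<open>\<open>partial i f\<close> is the \<open>i\<close>-th partial derivative, meaningful where \<open>f\<close> is differentiable.\<close>

definition partial :: "nat \<Rightarrow> ((real^2) \<times> (real^2) \<Rightarrow> real) \<Rightarrow> (real^2) \<times> (real^2) \<Rightarrow> real" where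
  "partial i f z = frechet_derivative f (at z) (coord_vec i)"

text \<open>Both predicates are used for open \<open>U\<close> only.\<close>

definition C1_on :: "((real^2) \<times> (real^2)) set \<Rightarrow> ((real^2) \<times> (real^2) \<Rightarrow> real) \<Rightarrow> bool" where
  "C1_on U f \<longleftrightarrow> f differentiable_on U \<and> (\<forall>i\<in>{1..4}. continuous_on U (partial i f))"

definition C2_on :: "((real^2) \<times> (real^2)) set \<Rightarrow> ((real^2) \<times> (real^2) \<Rightarrow> real) \<Rightarrow> bool" where
  "C2_on U f \<longleftrightarrow> C1_on U f \<and> (\<forall>i\<in>{1..4}. C1_on U (partial i f))"

definition grad_y :: "((real^2) \<times> (real^2) \<Rightarrow> real) \<Rightarrow> (real^2) \<times> (real^2) \<Rightarrow> real^2" where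
  "grad_y G z = vector [partial 3 G z, partial 4 G z]"

text \<open>In the lower right block, \<open>G\<^sub>i\<^sub>j\<close> is rendered as \<open>partial j (partial i G)\<close>; for \<open>C\<^sup>2\<close>
  functions the order of differentiation is immaterial.\<close>

definition curvature_matrix ::
  "((real^2) \<times> (real^2) \<Rightarrow> real) \<Rightarrow> (real^2) \<times> (real^2) \<Rightarrow> real^3^3" where
  "curvature_matrix G z = vector
     [vector [0,             partial 3 G z,               partial 4 G z],
      vector [partial 1 G z, partial 1 (partial 3 G) z,   partial 1 (partial 4 G) z],
      vector [partial 2 G z, partial 2 (partial 3 G) z,   partial 2 (partial 4 G) z]]"

definition level_curve ::
  "((real^2) \<times> (real^2)) set \<Rightarrow> ((real^2) \<times> (real^2) \<Rightarrow> real) \<Rightarrow> real^2 \<Rightarrow> (real^2) set" where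
  "level_curve U G x = {y. (x, y) \<in> U \<and> G (x, y) = 0}"

definition curve_union ::
  "((real^2) \<times> (real^2)) set \<Rightarrow> ((real^2) \<times> (real^2) \<Rightarrow> real) \<Rightarrow> (real^2) set \<Rightarrow> (real^2) set" where
  "curve_union U G F = (\<Union>x\<in>F. level_curve U G x)"

end

theory Submission
  imports Defs
begin

text \<open>
  Fix a scale \<open>L^-m\<close> and cut the \<open>n\<close>-th iterate, with \<open>m = \<lfloor>n/2\<rfloor>\<close>, into the \<open>L^m\<close> pieces of diameter
  \<open>d \<approx> L^-m\<close>. On a piece around \<open>x\<^sub>Q\<close>, linearise \<open>G\<close> in \<open>x\<close>: up to an error \<open>O(d\<^sup>2)\<close>, the curve of \<open>x\<close>
  passes through \<open>y\<close> iff the projection of \<open>x - x\<^sub>Q\<close> in the direction of \<open>\<nabla>\<^sub>x G(x\<^sub>Q, y)\<close> takes the value prescribed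
  by \<open>G(x\<^sub>Q, y)\<close>. The determinant condition says that (direction, value) is a local chart in \<open>y\<close>, so
  the measure of the union of these curves is bounded by the Favard length of the \<open>O(d\<^sup>2)\<close>-neighbourhood of
  the piece. Rescaling by \<open>L^m\<close> and summing replaces \<open>d\<^sup>2\<close> by \<open>d\<close>, and an
  \<open>O(L^-m)\<close>-neighbourhood of the \<open>m\<close>-th iterate has Favard length comparable to that of the iterate.

  For \<open>Fav E = 0\<close>: in every direction two first-level pieces of \<open>E\<close> overlap, since otherwise the
  \<open>\<epsilon>\<close>- and \<open>L\<epsilon>\<close>-neighbourhoods of the projection would have equal measure. Hence near every angle, at
  every scale, there is an interval of angles in which two small pieces almost coincide. If the
  projection has positive measure, its pieces cannot be too close, so the angles where it does form a countable union of
  porous sets, which are null.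
\<close>

text \<open>Halving n balances two scales. Once a piece is rescaled by \<open>L^m\<close>, the
  linearisation error is of order \<open>L^-m\<close>, so detail of the remaining
  \<open>n - m\<close> generations below that scale is blurred. Since \<open>n - m\<close> is
  \<open>m\<close> or \<open>m + 1\<close>, the rescaled piece lies within \<open>O(L^-m)\<close> of
  the m-th iterate, which is itself a union of squares of side \<open>L^-m\<close>.

  The iterates start from a fixed square that may be unrelated to E, so they need be neither nested
  nor supersets of E. Inclusions are therefore replaced by neighbourhoods of controlled radius, and
  a zero of G over E is shown to lie in V by perturbing it to a zero over a nearby point of an
  iterate.

  The limit set is treated by applying the same local estimate to the small pieces of E: the bound
  becomes the Favard length of a shrinking neighbourhood of E, which tends to
  \<open>Fav E = 0\<close>.

  The local estimate needs small pieces. The finitely many n that remain are absorbed into the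
  constant, because every iterate has positive Favard length.\<close>

section \<open>Overlapping pieces in projections of the attractor\<close>

text \<open>The closure of B is measurable and misses the same gaps, since these are open. On a
  short interval it lies in two subintervals of total length at most \<open>1 - \<kappa>\<close>
  times the original, and gaps exist at all smaller scales too, so iteration drives its measure to
  0.\<close>

lemma porous_negligible:
  fixes B :: "real set"
  assumes "0 < \<kappa>" "0 < h"
    and hole: "\<And>u v. \<lbrakk>u < v; v - u \<le> h\<rbrakk> \<Longrightarrow>
      \<exists>c d. u \<le> c \<and> d \<le> v \<and> \<kappa> * (v - u) \<le> d - c \<and> {c<..<d} \<inter> B = {}"
  shows "negligible B"
proof -
  define C where "C = closure B"
  have C: "C \<inter> {u..v} \<in> lmeasurable" for u v
    unfolding C_def by (intro lmeasurable_compact closed_Int_compact) auto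
  have \<kappa>1: "\<kappa> \<le> 1"
  proof -
    obtain c d where "0 \<le> c" "d \<le> h" "\<kappa> * (h - 0) \<le> d - c"
      using hole[of 0 h] \<open>0 < h\<close> by auto
    then have "\<kappa> * h \<le> 1 * h" by simp
    then show ?thesis using \<open>0 < h\<close> by (simp only: mult_le_cancel_right_pos)
  qed
  have contraction: "measure lebesgue (C \<inter> {u..v}) \<le> (1 - \<kappa>) ^ k * (v - u)"
    if "u \<le> v" "v - u \<le> h" for k u v
    using that
  proof (induction k arbitrary: u v)
    case 0
    have "measure lebesgue (C \<inter> {u..v}) \<le> measure lebesgue {u..v}"
      by (intro measure_mono_fmeasurable) (use C in auto)
    then show ?case using 0 by simp
  next
    case (Suc k)
    show ?case
    proof (cases "u = v")
      case True
      then have "negligible (C \<inter> {u..v})"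
        using negligible_subset[OF negligible_sing[of u], of "C \<inter> {u..v}"] by force
      then show ?thesis using True by (simp add: negligible_imp_measure0)
    next
      case False
      then have "u < v" using Suc.prems by simp
      then obtain c d where cd: "u \<le> c" "d \<le> v" "\<kappa> * (v - u) \<le> d - c" "{c<..<d} \<inter> B = {}"
        using hole[of u v] Suc.prems by meson
      have "0 < \<kappa> * (v - u)" using False Suc.prems \<open>0 < \<kappa>\<close> by simp
      then have "c < d" using cd by simp
      have "{c<..<d} \<inter> C = {}"
        unfolding C_def using cd(4) by (simp add: open_Int_closure_eq_empty)
      then have "C \<inter> {u..v} \<subseteq> (C \<inter> {u..c}) \<union> (C \<inter> {d..v})" by force
      then have "measure lebesgue (C \<inter> {u..v}) \<le> measure lebesgue ((C \<inter> {u..c}) \<union> (C \<inter> {d..v}))"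
        by (intro measure_mono_fmeasurable) (use C in auto)
      also have "\<dots> \<le> measure lebesgue (C \<inter> {u..c}) + measure lebesgue (C \<inter> {d..v})"
        by (intro measure_Un_le) (use C in auto)
      also have "\<dots> \<le> (1 - \<kappa>) ^ k * (c - u) + (1 - \<kappa>) ^ k * (v - d)"
        by (intro add_mono Suc.IH) (use cd \<open>c < d\<close> Suc.prems in auto)
      also have "\<dots> = (1 - \<kappa>) ^ k * ((c - u) + (v - d))" by (simp add: algebra_simps)
      also have "\<dots> \<le> (1 - \<kappa>) ^ k * ((1 - \<kappa>) * (v - u))"
        by (intro mult_left_mono) (use cd \<kappa>1 in \<open>auto simp: algebra_simps\<close>)
      finally show ?thesis by (simp add: algebra_simps)
    qed
  qed
  have null: "measure lebesgue (C \<inter> {u..v}) = 0" if "u \<le> v" "v - u \<le> h" for u v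
  proof -
    have "(\<lambda>k. (1 - \<kappa>) ^ k * (v - u)) \<longlonglongrightarrow> 0 * (v - u)"
      by (intro tendsto_mult LIMSEQ_power_zero tendsto_const) (use \<open>0 < \<kappa>\<close> \<kappa>1 in auto)
    then have "measure lebesgue (C \<inter> {u..v}) \<le> 0 * (v - u)"
      by (rule LIMSEQ_le_const) (use contraction[OF that] in auto)
    then show ?thesis by (simp add: order_antisym)
  qed
  have "negligible C"
  proof (rule locally_negligible_alt[THEN iffD2], intro ballI exI conjI)
    fix x assume "x \<in> C"
    then show "x \<in> C \<inter> {x - h/2<..<x + h/2}" using \<open>0 < h\<close> by auto
    show "openin (top_of_set C) (C \<inter> {x - h/2<..<x + h/2})" by auto
    have "negligible (C \<inter> {x - h/2..x + h/2})"
      using null[of "x - h/2" "x + h/2"] C[of "x - h/2" "x + h/2"] \<open>0 < h\<close>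
        unfolding negligible_iff_measure by (intro conjI) simp_all
    then show "negligible (C \<inter> {x - h/2<..<x + h/2})"
      by (rule negligible_subset) auto
  qed
  then show ?thesis unfolding C_def by (rule negligible_subset) (rule closure_subset)
qed

section \<open>Closed neighbourhoods and their measure\<close>

definition nbhd :: "real \<Rightarrow> 'a::metric_space set \<Rightarrow> 'a set" where
  "nbhd r F = (\<Union>x\<in>F. cball x r)"

lemma mem_nbhd: "y \<in> nbhd r F \<longleftrightarrow> (\<exists>x\<in>F. dist x y \<le> r)"
  by (auto simp: nbhd_def)

lemma subset_nbhd: "0 \<le> r \<Longrightarrow> F \<subseteq> nbhd r F"
  by (force simp: mem_nbhd)

lemma nbhd_mono: "r \<le> s \<Longrightarrow> F \<subseteq> G \<Longrightarrow> nbhd r F \<subseteq> nbhd s G"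
  by (force simp: mem_nbhd)

lemma nbhd_nbhd: "nbhd r (nbhd s F) \<subseteq> nbhd (r + s) F"
proof
  fix y assume "y \<in> nbhd r (nbhd s F)"
  then obtain x z where "x \<in> F" "dist x z \<le> s" "dist z y \<le> r" by (auto simp: mem_nbhd)
  then have "dist x y \<le> r + s" using dist_triangle[of x y z] by linarith
  with \<open>x \<in> F\<close> show "y \<in> nbhd (r + s) F" by (auto simp: mem_nbhd)
qed

lemma nbhd_affine:
  fixes F :: "'a::real_normed_vector set"
  assumes "0 < c"
  shows "nbhd (c * r) ((\<lambda>x. c *\<^sub>R x + t) ` F) = (\<lambda>x. c *\<^sub>R x + t) ` nbhd r F"
proof (intro set_eqI iffI)
  fix y assume "y \<in> nbhd (c * r) ((\<lambda>x. c *\<^sub>R x + t) ` F)"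
  then obtain x where x: "x \<in> F" "dist (c *\<^sub>R x + t) y \<le> c * r" by (auto simp: mem_nbhd)
  define y' where "y' = (1 / c) *\<^sub>R (y - t)"
  have y: "y = c *\<^sub>R y' + t" using assms by (simp add: y'_def)
  have "dist (c *\<^sub>R x + t) y = c * dist x y'"
    unfolding y using assms by (simp add: dist_norm flip: scaleR_diff_right)
  then have "dist x y' \<le> r" using x(2) assms by simp
  then have "y' \<in> nbhd r F" using x(1) by (auto simp: mem_nbhd)
  then show "y \<in> (\<lambda>x. c *\<^sub>R x + t) ` nbhd r F" using y by (intro image_eqI)
next
  fix y assume "y \<in> (\<lambda>x. c *\<^sub>R x + t) ` nbhd r F"
  then obtain x y' where "x \<in> F" "dist x y' \<le> r" "y = c *\<^sub>R y' + t" by (auto simp: mem_nbhd)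
  then show "y \<in> nbhd (c * r) ((\<lambda>x. c *\<^sub>R x + t) ` F)"
    using assms by (auto simp: mem_nbhd dist_norm simp flip: scaleR_diff_right intro!: bexI[of _ x])
qed

text \<open>This is why \<open>nbhd\<close> uses closed balls: the neighbourhood is a Minkowski sum
  of two compact sets, so it and its projections are compact and hence measurable.\<close>

lemma compact_nbhd:
  fixes F :: "'a::euclidean_space set"
  assumes "compact F"
  shows "compact (nbhd r F)"
proof -
  have "nbhd r F = (\<Union>x\<in>F. \<Union>y\<in>cball 0 r. {x + y})"
  proof (intro set_eqI iffI)
    fix y assume "y \<in> nbhd r F"
    then obtain x where "x \<in> F" "dist x y \<le> r" by (auto simp: mem_nbhd)
    then have "y = x + (y - x)" "y - x \<in> cball 0 r" by (auto simp: dist_norm norm_minus_commute)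
    with \<open>x \<in> F\<close> show "y \<in> (\<Union>x\<in>F. \<Union>y\<in>cball 0 r. {x + y})" by blast
  next
    fix y assume "y \<in> (\<Union>x\<in>F. \<Union>y\<in>cball 0 r. {x + y})"
    then obtain x v where "x \<in> F" "norm v \<le> r" "y = x + v" by auto
    then show "y \<in> nbhd r F" by (auto simp: mem_nbhd dist_norm intro!: bexI[of _ x])
  qed
  also have "\<dots> = {x + y |x y. x \<in> F \<and> y \<in> cball 0 r}" by blast
  also have "compact \<dots>" using assms by (intro compact_sums) auto
  finally show ?thesis .
qed

text \<open>Outer regularity gives an open set around K of almost the same measure; compactness fits
  a uniform neighbourhood of K into it.\<close>

lemma measure_nbhd_less:
  fixes K :: "'a::euclidean_space set"
  assumes "compact K" "measure lebesgue K < e"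
  obtains r where "0 < r" "measure lebesgue (nbhd r K) < e"
proof -
  have K: "K \<in> lmeasurable" using assms by (simp add: lmeasurable_compact)
  have e: "0 < e - measure lebesgue K" using assms by simp
  obtain T where T: "open T" "K \<subseteq> T" "T - K \<in> lmeasurable"
      "emeasure lebesgue (T - K) < ennreal (e - measure lebesgue K)"
    using sets_lebesgue_outer_open[OF fmeasurableD[OF K] e] .
  then have Te: "measure lebesgue (T - K) < e - measure lebesgue K"
    by (simp add: emeasure_eq_measure2 ennreal_less_iff)
  obtain r where r: "0 < r" "(\<Union>x\<in>K. cball x r) \<subseteq> T"
    using compact_subset_open_imp_cball_epsilon_subset[OF assms(1) T(1,2)] by blast
  have sub: "nbhd r K \<subseteq> K \<union> (T - K)" using r by (auto simp: nbhd_def)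
  have fin: "K \<union> (T - K) \<in> lmeasurable" using K T(3) by (rule fmeasurable.Un)
  have "measure lebesgue (nbhd r K) \<le> measure lebesgue (K \<union> (T - K))"
    using sub fin compact_nbhd[OF assms(1)]
    by (intro measure_mono_fmeasurable) (simp_all only: lmeasurable_compact fmeasurableD)
  also have "\<dots> \<le> measure lebesgue K + measure lebesgue (T - K)"
    using K T by (intro measure_Un_le) auto
  finally show ?thesis using that r Te by force
qed

section \<open>Self-similar sets on the line: overlap and separation of pieces\<close>

lemma measure_lebesgue_affine_real:
  fixes S :: "real set"
  shows "measure lebesgue ((\<lambda>x. m * x + t) ` S) = \<bar>m\<bar> * measure lebesgue S"
  using measure_lebesgue_affine[of m t S] by simp

lemma self_similar_real_overlap:
  fixes K :: "real set" and c :: "'i \<Rightarrow> real"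
  assumes "compact K" "K \<noteq> {}" "finite I" "2 \<le> card I"
    and K: "K = (\<Union>i\<in>I. (\<lambda>x. (1 / real (card I)) * x + c i) ` K)"
  shows "\<exists>i\<in>I. \<exists>j\<in>I. i \<noteq> j \<and>
    (\<lambda>x. (1 / real (card I)) * x + c i) ` K \<inter> (\<lambda>x. (1 / real (card I)) * x + c j) ` K \<noteq> {}"
proof (rule ccontr)
  define l where "l = real (card I)"
  define f where "f i x = (1 / l) * x + c i" for i x
  have l: "2 \<le> l" using assms by (simp add: l_def)
  have Kf: "K = (\<Union>i\<in>I. f i ` K)" using K by (simp add: f_def l_def)
  assume "\<not> ?thesis"
  then have disj: "f i ` K \<inter> f j ` K = {}" if "i \<in> I" "j \<in> I" "i \<noteq> j" for i j
    using that by (auto simp: f_def l_def)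
  have cf: "compact (f i ` K)" for i
    unfolding f_def by (intro compact_continuous_image continuous_intros assms)
  have sep: "\<forall>\<^sub>F r in at_right 0. nbhd r (f i ` K) \<inter> nbhd r (f j ` K) = {}"
    if ij: "i \<in> I" "j \<in> I" "i \<noteq> j" for i j
  proof -
    obtain d where d: "d > 0" "\<And>x y. x \<in> f i ` K \<Longrightarrow> y \<in> f j ` K \<Longrightarrow> d \<le> dist x y"
      using separate_compact_closed[OF cf compact_imp_closed[OF cf] disj[OF ij]] by blast
    have "nbhd r (f i ` K) \<inter> nbhd r (f j ` K) = {}" if "r < d / 2" for r
    proof (rule ccontr)
      assume "nbhd r (f i ` K) \<inter> nbhd r (f j ` K) \<noteq> {}"
      then obtain x y z where "x \<in> f i ` K" "y \<in> f j ` K" "dist x z \<le> r" "dist y z \<le> r"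
        unfolding disjoint_iff mem_nbhd by blast
      then show False using d(2)[of x y] dist_triangle2[of x y z] that by linarith
    qed
    then show ?thesis using d(1) by (intro eventually_at_rightI[of 0 "d/2"]) auto
  qed
  have "\<forall>\<^sub>F r in at_right 0. \<forall>i\<in>I. \<forall>j\<in>I. i \<noteq> j \<longrightarrow> nbhd r (f i ` K) \<inter> nbhd r (f j ` K) = {}"
    by (intro eventually_ball_finite ballI \<open>finite I\<close>) (use sep in \<open>auto intro: eventually_mono\<close>)
  then obtain r where r: "r > 0"
    "\<And>i j. i \<in> I \<Longrightarrow> j \<in> I \<Longrightarrow> i \<noteq> j \<Longrightarrow> nbhd r (f i ` K) \<inter> nbhd r (f j ` K) = {}"
    using eventually_happens[OF eventually_conj[OF eventually_at_right_less[of 0]]]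
      trivial_limit_at_right_real by (smt (verit, best))
  have lm: "nbhd s (A :: real set) \<in> lmeasurable" if "compact A" for s A
    using that by (intro lmeasurable_compact compact_nbhd)
  have piece: "nbhd r (f i ` K) = (\<lambda>x. (1 / l) * x + c i) ` nbhd (l * r) K" for i
    using nbhd_affine[of "1 / l" "l * r" "c i" K] l by (simp add: f_def[abs_def])
  have "nbhd r K = (\<Union>i\<in>I. nbhd r (f i ` K))"
    by (subst Kf) (auto simp: nbhd_def)
  then have "measure lebesgue (nbhd r K) = measure lebesgue (\<Union>i\<in>I. nbhd r (f i ` K))" by simp
  \<comment> \<open>Disjointness makes the measure additive; each of the l summands is a copy of the
    \<open>l * r\<close>-neighbourhood shrunk by \<open>1 / l\<close>.\<close>
  also have "\<dots> = (\<Sum>i\<in>I. measure lebesgue (nbhd r (f i ` K)))"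
    using r(2) fmeasurableD[OF lm[OF cf]] fmeasurableD2[OF lm[OF cf]]
    by (intro measure_finite_Union \<open>finite I\<close>) (auto simp: disjoint_family_on_def simp flip: infinity_ennreal_def)
  also have "\<dots> = (\<Sum>i\<in>I. (1 / l) * measure lebesgue (nbhd (l * r) K))"
    unfolding piece measure_lebesgue_affine_real using l by simp
  also have "\<dots> = measure lebesgue (nbhd (l * r) K)" using l by (simp add: l_def)
  finally have eq: "measure lebesgue (nbhd r K) = measure lebesgue (nbhd (l * r) K)" .
  \<comment> \<open>The two measures cannot agree: beyond the maximum of K the larger neighbourhood
    contains an interval of length \<open>(l - 1) * r\<close> which the smaller one does not
    reach.\<close>
  obtain M where M: "M \<in> K" "\<And>x. x \<in> K \<Longrightarrow> x \<le> M"
    using compact_attains_sup[OF assms(1,2)] by blast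
  have lr: "r < l * r" using l r(1) by simp
  have "nbhd r K \<union> {M + r<..M + l * r} \<subseteq> nbhd (l * r) K"
    using lr M(1) r(1) nbhd_mono[of r "l * r" K K] by (force simp: mem_nbhd dist_real_def)
  then have "measure lebesgue (nbhd r K \<union> {M + r<..M + l * r}) \<le> measure lebesgue (nbhd (l * r) K)"
    by (intro measure_mono_fmeasurable) (use lm[OF assms(1)] in \<open>auto simp: fmeasurableD\<close>)
  moreover have "measure lebesgue (nbhd r K \<union> {M + r<..M + l * r})
      = measure lebesgue (nbhd r K) + measure lebesgue {M + r<..M + l * r}"
  proof (intro measure_Union)
    show "nbhd r K \<inter> {M + r<..M + l * r} = {}"
    proof -
      have "y \<le> M + r" if y: "y \<in> nbhd r K" for y
      proof -
        obtain x where "x \<in> K" "\<bar>x - y\<bar> \<le> r" using y unfolding mem_nbhd dist_real_def by blast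
        then show ?thesis using M(2)[of x] by linarith
      qed
      then show ?thesis by force
    qed
  qed (use fmeasurableD[OF lm[OF assms(1), of r]] fmeasurableD2[OF lm[OF assms(1), of r]]
      emeasure_lborel_Ioc[of "M + r" "M + l * r"] lr in \<open>auto simp: infinity_ennreal_def\<close>)
  ultimately show False using eq lr by simp
qed

text \<open>The copies have total measure at most that of K, so a cover of K by them has nothing to
  waste. Two copies shifted by less than \<open>e * \<rho>\<close> both fit into one scaled copy of
  the \<open>e\<close>-neighbourhood, whose measure is less than that of two copies; the remaining
  ones cannot make up for the loss.\<close>

lemma affine_cover_separated:
  fixes K :: "real set" and t :: "'i \<Rightarrow> real"
  assumes K: "compact K" and "finite Z" "0 < \<rho>" "real (card Z) * \<rho> \<le> 1"
    and cover: "K \<subseteq> (\<Union>z\<in>Z. (\<lambda>x. \<rho> * x + t z) ` K)"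
    and e: "measure lebesgue (nbhd e K) < 2 * measure lebesgue K"
    and z: "z \<in> Z" "z' \<in> Z" "z \<noteq> z'"
  shows "e * \<rho> \<le> \<bar>t z - t z'\<bar>"
proof (rule ccontr)
  assume "\<not> ?thesis"
  then have close: "\<bar>t z' - t z\<bar> < e * \<rho>" by linarith
  then have "0 < e" using \<open>0 < \<rho>\<close> by (smt (verit) mult_nonpos_nonneg)
  define P where "P z = (\<lambda>x. \<rho> * x + t z) ` K" for z
  let ?m = "measure lebesgue K"
  have cP: "compact (P z)" for z
    unfolding P_def by (intro compact_continuous_image continuous_intros K)
  have lP: "P z \<in> lmeasurable" for z by (intro lmeasurable_compact cP)
  have mP: "measure lebesgue (P z) = \<rho> * ?m" for z
    unfolding P_def measure_lebesgue_affine_real using \<open>0 < \<rho>\<close> by simp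
  let ?N = "(\<lambda>x. \<rho> * x + t z) ` nbhd e K"
  have "P z \<subseteq> ?N" unfolding P_def using subset_nbhd[of e K] \<open>0 < e\<close> by auto
  moreover have "P z' \<subseteq> ?N"
  proof
    fix y assume "y \<in> P z'"
    then obtain x where x: "x \<in> K" "y = \<rho> * x + t z'" by (auto simp: P_def)
    have "dist x (x + (t z' - t z) / \<rho>) \<le> e"
      using close \<open>0 < \<rho>\<close> by (simp add: dist_real_def field_simps)
    then have "x + (t z' - t z) / \<rho> \<in> nbhd e K" using x(1) by (auto simp: mem_nbhd)
    moreover have "y = \<rho> * (x + (t z' - t z) / \<rho>) + t z"
      using x(2) \<open>0 < \<rho>\<close> by (simp add: field_simps)
    ultimately show "y \<in> ?N" by blast
  qed
  moreover have "compact ?N"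
    by (intro compact_continuous_image continuous_intros compact_nbhd K)
  ultimately have "measure lebesgue (P z \<union> P z') \<le> measure lebesgue ?N"
    by (intro measure_mono_fmeasurable) (use lP[of z] lP[of z'] in \<open>auto simp: lmeasurable_compact\<close>)
  also have "\<dots> = \<rho> * measure lebesgue (nbhd e K)"
    unfolding measure_lebesgue_affine_real using \<open>0 < \<rho>\<close> by simp
  also have "\<dots> < \<rho> * (2 * ?m)" using e \<open>0 < \<rho>\<close> by simp
  finally have two: "measure lebesgue (P z \<union> P z') < 2 * \<rho> * ?m" by simp
  have m0: "0 \<le> ?m" by simp
  let ?Z = "Z - {z, z'}"
  have "K \<subseteq> (\<Union>w\<in>?Z. P w) \<union> (P z \<union> P z')" using cover unfolding P_def by blast
  then have "?m \<le> measure lebesgue ((\<Union>w\<in>?Z. P w) \<union> (P z \<union> P z'))"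
    by (intro measure_mono_fmeasurable fmeasurable.Un fmeasurable.finite_UN)
      (use lP \<open>finite Z\<close> K in \<open>auto intro: fmeasurableD lmeasurable_compact\<close>)
  also have "\<dots> \<le> measure lebesgue (\<Union>w\<in>?Z. P w) + measure lebesgue (P z \<union> P z')"
    by (intro measure_Un_le sets.Un sets.finite_UN) (use lP \<open>finite Z\<close> in \<open>auto intro: fmeasurableD\<close>)
  also have "measure lebesgue (\<Union>w\<in>?Z. P w) \<le> (\<Sum>w\<in>?Z. measure lebesgue (P w))"
    by (intro measure_UNION_le) (use lP \<open>finite Z\<close> in \<open>auto intro: fmeasurableD\<close>)
  also have "\<dots> = (real (card Z) - 2) * (\<rho> * ?m)"
  proof -
    have "card ?Z = card Z - 2" using z by (simp add: card_Diff_subset)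
    moreover have "2 \<le> card Z" using card_mono[OF \<open>finite Z\<close>, of "{z, z'}"] z by simp
    ultimately have "real (card ?Z) = real (card Z) - 2" by simp
    then show ?thesis by (simp add: mP)
  qed
  finally have "?m < real (card Z) * \<rho> * ?m" using two by (simp add: algebra_simps)
  also have "\<dots> \<le> 1 * ?m" by (intro mult_right_mono assms m0)
  finally show False by simp
qed

text \<open>The translation parts of the n-fold compositions of the maps, that is, the images of the
  origin. Coinciding translations are merged, so \<open>L ^ n\<close> is only an upper bound for
  their number; the measure estimates use just that bound.\<close>

primrec shifts :: "nat \<Rightarrow> (nat \<Rightarrow> real^2) \<Rightarrow> nat \<Rightarrow> (real^2) set" where
  "shifts L b 0 = {0}"
| "shifts L b (Suc n) = (\<Union>i\<in>{1..L}. sim L b i ` shifts L b n)"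

lemma finite_shifts: "finite (shifts L b n)"
  by (induction n) auto

lemma card_shifts: "card (shifts L b n) \<le> L ^ n"
proof (induction n)
  case (Suc n)
  have "card (shifts L b (Suc n)) \<le> (\<Sum>i\<in>{1..L}. card (sim L b i ` shifts L b n))"
    by (simp add: card_UN_le)
  also have "\<dots> \<le> (\<Sum>i\<in>{1..L}. L ^ n)"
    by (intro sum_mono) (meson Suc card_image_le finite_shifts le_trans)
  finally show ?case by simp
qed simp

lemma sim_affine: "sim L b i (c *\<^sub>R x + z) = (c / real L) *\<^sub>R x + sim L b i z"
  by (simp add: sim_def scaleR_add_right)

text \<open>The sequence is left open so that both the iterates and the constant sequence E are
  instances.\<close>

lemma iterate_decomposition:
  assumes "\<And>n. A (Suc n) = (\<Union>i\<in>{1..L}. sim L b i ` A n)"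
  shows "A (m + k) = (\<Union>z\<in>shifts L b m. (\<lambda>x. (1 / real L) ^ m *\<^sub>R x + z) ` A k)"
proof (induction m)
  case (Suc m)
  have "A (Suc m + k) = (\<Union>i\<in>{1..L}. \<Union>z\<in>shifts L b m.
      (\<lambda>x. sim L b i ((1 / real L) ^ m *\<^sub>R x + z)) ` A k)"
    using assms[of "m + k"] Suc by (simp add: image_UN image_image)
  then show ?case
    by (auto simp: sim_affine)
qed simp

section \<open>Projections of the plane\<close>

lemma proj_angle_add: "proj_angle \<theta> (x + y) = proj_angle \<theta> x + proj_angle \<theta> y"
  by (simp add: proj_angle_def algebra_simps)

lemma proj_angle_diff: "proj_angle \<theta> (x - y) = proj_angle \<theta> x - proj_angle \<theta> y"
  by (simp add: proj_angle_def algebra_simps)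

lemma proj_angle_scaleR: "proj_angle \<theta> (c *\<^sub>R x) = c * proj_angle \<theta> x"
  by (simp add: proj_angle_def algebra_simps)

lemma norm_vec2: "norm (x :: real^2) ^ 2 = x $ 1 ^ 2 + x $ 2 ^ 2"
  by (simp add: norm_vec_def L2_set_def sum_2)

lemma proj_angle_orthogonal:
  "proj_angle \<theta> x ^ 2 + proj_angle (\<theta> + pi / 2) x ^ 2 = norm x ^ 2"
proof -
  have "proj_angle (\<theta> + pi / 2) x = x $ 2 * cos \<theta> - x $ 1 * sin \<theta>"
    by (simp add: proj_angle_def sin_add cos_add)
  then have "proj_angle \<theta> x ^ 2 + proj_angle (\<theta> + pi / 2) x ^ 2 = x $ 1 ^ 2 + x $ 2 ^ 2"
    unfolding proj_angle_def using sin_cos_squared_add[of \<theta>] by algebra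
  then show ?thesis by (simp add: norm_vec2)
qed

lemma abs_proj_angle_le: "\<bar>proj_angle \<theta> x\<bar> \<le> norm x"
  using proj_angle_orthogonal[of \<theta> x]
  by (intro abs_le_square_iff[THEN iffD2, of _ "norm x", simplified])
     (smt (verit) zero_le_power2)

lemma proj_angle_shift:
  "proj_angle (\<theta> + \<eta>) x = proj_angle \<theta> x * cos \<eta> + proj_angle (\<theta> + pi / 2) x * sin \<eta>"
  by (simp add: proj_angle_def sin_add cos_add algebra_simps)

lemma continuous_on_proj_angle [continuous_intros]: "continuous_on S (proj_angle \<theta>)"
  unfolding proj_angle_def by (intro continuous_intros)

lemma compact_proj_angle: "compact F \<Longrightarrow> compact (proj_angle \<theta> ` F)"
  by (intro compact_continuous_image continuous_intros)

text \<open>Let f and g be the projections of x in the directions \<open>\<theta>\<close> and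
  \<open>\<theta> + pi / 2\<close>. If f is at most half the norm, then g is at least half of it.
  Rotating by \<open>arctan (- f / g)\<close> makes the direction orthogonal to x, and
  \<open>\<bar>arctan t\<bar> \<le> \<bar>t\<bar>\<close> bounds the rotation.\<close>

lemma proj_angle_zero_near:
  assumes small: "2 * \<bar>proj_angle \<theta> x\<bar> \<le> norm x" and "x \<noteq> 0"
  obtains \<eta> where "\<bar>\<eta>\<bar> \<le> 2 * \<bar>proj_angle \<theta> x\<bar> / norm x" "proj_angle (\<theta> + \<eta>) x = 0"
proof -
  let ?f = "proj_angle \<theta> x" and ?g = "proj_angle (\<theta> + pi / 2) x"
  have n: "0 < norm x" using \<open>x \<noteq> 0\<close> by simp
  have "?f\<^sup>2 \<le> (norm x / 2)\<^sup>2"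
    using small by (intro abs_le_square_iff[THEN iffD1]) simp
  then have "(norm x / 2)\<^sup>2 \<le> ?g\<^sup>2"
    using proj_angle_orthogonal[of \<theta> x] by (simp add: power2_eq_square) (smt (verit) zero_le_square)
  then have g: "norm x / 2 \<le> \<bar>?g\<bar>"
    by (metis abs_le_square_iff abs_of_pos half_gt_zero n)
  then have g0: "?g \<noteq> 0" using n by auto
  let ?\<eta> = "arctan (- ?f / ?g)"
  have "\<bar>?\<eta>\<bar> \<le> \<bar>- ?f / ?g\<bar>" by (rule abs_arctan_le)
  also have "\<dots> \<le> 2 * \<bar>?f\<bar> / norm x"
    using mult_left_mono[OF g, of "\<bar>?f\<bar>"] g0 n by (simp add: field_simps)
  finally show ?thesis
  proof (rule that)
    show "proj_angle (\<theta> + ?\<eta>) x = 0"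
    proof -
      have "sin ?\<eta> = (- ?f / ?g) * cos ?\<eta>" by (simp only: sin_arctan cos_arctan) simp
      then have "?g * sin ?\<eta> = - ?f * cos ?\<eta>" using g0 by simp
      then show ?thesis using proj_angle_shift[of \<theta> ?\<eta> x] by linarith
    qed
  qed
qed

section \<open>Projections of the attractor\<close>

context
  fixes L b E
  assumes E: "self_similar_1set L b E"
begin

lemma L_ge: "3 \<le> L"
  using E unfolding self_similar_1set_def by (elim conjE)

lemma compact_E: "compact E"
  using E unfolding self_similar_1set_def by (elim conjE)

lemma E_ne: "E \<noteq> {}"
  using E unfolding self_similar_1set_def by (elim conjE)

lemma E_eq: "E = (\<Union>i\<in>{1..L}. sim L b i ` E)"
  using E unfolding self_similar_1set_def by (elim conjE)

lemma E_decomposition: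
  "E = (\<Union>z\<in>shifts L b n. (\<lambda>x. (1 / real L) ^ n *\<^sub>R x + z) ` E)"
  using iterate_decomposition[of "\<lambda>_. E", OF E_eq] by simp

lemma proj_E_separated:
  assumes "measure lebesgue (nbhd e (proj_angle \<theta> ` E)) < 2 * measure lebesgue (proj_angle \<theta> ` E)"
    and "z \<in> shifts L b n" "z' \<in> shifts L b n" "z \<noteq> z'"
  shows "e * (1 / real L) ^ n \<le> \<bar>proj_angle \<theta> (z - z')\<bar>"
  unfolding proj_angle_diff
proof (rule affine_cover_separated[where Z = "shifts L b n" and K = "proj_angle \<theta> ` E"])
  show "real (card (shifts L b n)) * (1 / real L) ^ n \<le> 1"
    using card_shifts[of L b n] L_ge
    by (simp add: power_one_over field_simps)
  show "proj_angle \<theta> ` E \<subseteq>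
      (\<Union>z\<in>shifts L b n. (\<lambda>x. (1 / real L) ^ n * x + proj_angle \<theta> z) ` proj_angle \<theta> ` E)"
    by (subst E_decomposition[of n])
       (simp add: image_UN image_image proj_angle_add proj_angle_scaleR)
  show "0 < (1 / real L) ^ n" using L_ge by simp
qed (fact assms finite_shifts compact_proj_angle[OF compact_E])+

text \<open>Projection preserves self-similarity: the image of E on a line has L maps of ratio
  \<open>1 / L\<close>, the inverse of their number, as \<open>self_similar_real_overlap\<close>
  demands.\<close>

lemma proj_E_overlap:
  obtains i j x y where "i \<in> {1..L}" "j \<in> {1..L}" "i \<noteq> j"
    "x \<in> sim L b i ` E" "y \<in> sim L b j ` E" "proj_angle \<theta> x = proj_angle \<theta> y"
proof -
  let ?K = "proj_angle \<theta> ` E"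
  have img: "proj_angle \<theta> ` sim L b i ` E = (\<lambda>x. (1 / real L) * x + proj_angle \<theta> (b i)) ` ?K" for i
    by (simp add: image_image sim_def proj_angle_add proj_angle_scaleR)
  have "\<exists>i\<in>{1..L}. \<exists>j\<in>{1..L}. i \<noteq> j \<and>
    (\<lambda>x. (1 / real (card {1..L})) * x + proj_angle \<theta> (b i)) ` ?K \<inter>
    (\<lambda>x. (1 / real (card {1..L})) * x + proj_angle \<theta> (b j)) ` ?K \<noteq> {}"
  proof (rule self_similar_real_overlap)
    show "?K = (\<Union>i\<in>{1..L}. (\<lambda>x. (1 / real (card {1..L})) * x + proj_angle \<theta> (b i)) ` ?K)"
      by (subst E_eq) (simp only: image_UN img card_atLeastAtMost diff_Suc_1 add_diff_cancel_right' Suc_eq_plus1)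
  qed (use L_ge compact_E E_ne in \<open>auto intro: compact_proj_angle\<close>)
  then have "\<exists>i\<in>{1..L}. \<exists>j\<in>{1..L}. i \<noteq> j \<and>
      proj_angle \<theta> ` sim L b i ` E \<inter> proj_angle \<theta> ` sim L b j ` E \<noteq> {}"
    unfolding img by simp
  then obtain i j where ij: "i \<in> {1..L}" "j \<in> {1..L}" "i \<noteq> j"
      "proj_angle \<theta> ` sim L b i ` E \<inter> proj_angle \<theta> ` sim L b j ` E \<noteq> {}" by meson
  then obtain u where "u \<in> proj_angle \<theta> ` sim L b i ` E" "u \<in> proj_angle \<theta> ` sim L b j ` E"
    unfolding disjoint_iff by meson
  then obtain x y where "x \<in> sim L b i ` E" "u = proj_angle \<theta> x" "y \<in> sim L b j ` E" "u = proj_angle \<theta> y"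
    by (elim imageE[of u]) simp
  then show ?thesis using that[OF ij(1-3), of x y] by simp
qed

lemma pieces_separated:
  "\<exists>\<delta>>0. \<forall>i\<in>{1..L}. \<forall>j\<in>{1..L}. i \<noteq> j \<longrightarrow>
    (\<forall>x\<in>sim L b i ` E. \<forall>y\<in>sim L b j ` E. \<delta> \<le> dist x y)"
proof -
  have c: "compact (sim L b i ` E)" for i
    unfolding sim_def by (intro compact_continuous_image continuous_intros compact_E)
  have "\<forall>\<^sub>F d in at_right 0. \<forall>x\<in>sim L b i ` E. \<forall>y\<in>sim L b j ` E. d \<le> dist x y"
    if ij: "i \<in> {1..L}" "j \<in> {1..L}" "i \<noteq> j" for i j
  proof -
    have disj: "sim L b i ` E \<inter> sim L b j ` E = {}"
      using E ij unfolding self_similar_1set_def by meson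
    obtain d where "d > 0" "\<And>x y. x \<in> sim L b i ` E \<Longrightarrow> y \<in> sim L b j ` E \<Longrightarrow> d \<le> dist x y"
      using separate_compact_closed[OF c compact_imp_closed[OF c] disj] by meson
    then show ?thesis by (intro eventually_at_rightI[of 0 d]) force+
  qed
  then have "\<forall>\<^sub>F d in at_right 0. \<forall>i\<in>{1..L}. \<forall>j\<in>{1..L}. i \<noteq> j \<longrightarrow>
      (\<forall>x\<in>sim L b i ` E. \<forall>y\<in>sim L b j ` E. d \<le> dist x y)"
    by (intro eventually_ball_finite ballI) (auto intro: eventually_mono)
  then show ?thesis
    using eventually_happens[OF eventually_conj[OF eventually_at_right_less[of "0::real"]]]
      trivial_limit_at_right_real by blast
qed

end

lemma attractor_point:
  assumes E: "self_similar_1set L b E" and "x \<in> E"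
  shows "\<exists>z\<in>shifts L b n. \<exists>x'\<in>E. x = (1 / real L) ^ n *\<^sub>R x' + z"
proof -
  have "x \<in> (\<Union>z\<in>shifts L b n. (\<lambda>x. (1 / real L) ^ n *\<^sub>R x + z) ` E)"
    by (rule subsetD[OF equalityD1[OF E_decomposition[OF E]] \<open>x \<in> E\<close>])
  then show ?thesis by (elim UN_E imageE) (intro bexI)
qed

lemma sim_image_subset:
  assumes E: "self_similar_1set L b E" and "i \<in> {1..L}" "x \<in> sim L b i ` E"
  shows "x \<in> E"
  using assms(2,3) by (intro subsetD[OF equalityD2[OF E_eq[OF E]]] UN_I[of i])

text \<open>An overlap in direction \<theta> yields two level-n translations whose difference is
  nearly orthogonal to \<theta>. A slight rotation makes it exactly orthogonal, and an interval of
  angles around that one violates the separation. Choosing \<open>L^-n\<close> comparable to a given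
  interval of angles makes this gap a fixed fraction of it.\<close>

lemma negligible_separated_angles:
  assumes E: "self_similar_1set L b E" and "0 < e"
  shows "negligible {\<theta>. \<forall>n. \<forall>z\<in>shifts L b n. \<forall>z'\<in>shifts L b n. z \<noteq> z' \<longrightarrow>
    e * (1 / real L) ^ n \<le> \<bar>proj_angle \<theta> (z - z')\<bar>}" (is "negligible ?B")
proof -
  have L: "3 \<le> L" using L_ge[OF E] .
  obtain R where R: "0 < R" "\<And>x. x \<in> E \<Longrightarrow> norm x \<le> R"
    using compact_imp_bounded[OF compact_E[OF E]] unfolding bounded_pos by meson
  obtain \<delta> where \<delta>: "0 < \<delta>" "\<forall>i\<in>{1..L}. \<forall>j\<in>{1..L}. i \<noteq> j \<longrightarrow>
      (\<forall>x\<in>sim L b i ` E. \<forall>y\<in>sim L b j ` E. \<delta> \<le> dist x y)"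
    using pieces_separated[OF E] by meson
  \<comment> \<open>In units of the scale s, the first summand bounds the rotation \<eta> that
    reaches orthogonality, and the second is the half-length a of the gap around it.\<close>
  define C where "C = 8 * R / \<delta> + e / (4 * R)"
  have C: "0 < C" unfolding C_def using R \<delta> \<open>0 < e\<close> by (simp add: add_pos_pos)
  show ?thesis
  proof (rule porous_negligible)
    \<comment> \<open>The gap has length \<open>2 * a = e * s / (2 * R)\<close> and the interval has
      length \<open>2 * w < 2 * C * L * s\<close>; this is the quotient of the two.\<close>
    show "0 < e / (4 * R * L * C)" using R C \<open>0 < e\<close> L by simp
    \<comment> \<open>The bound 1 keeps s small against \<delta>, so that approximation at level n
      does not merge points of different first-level pieces. The bound C excludes level 0, so that
      the preceding level exists.\<close>
    show "0 < min 1 C" using C by simp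
    fix u v :: real assume uv: "u < v" "v - u \<le> min 1 C"
    define \<theta> w where "\<theta> = (u + v) / 2" and "w = (v - u) / 2"
    have w: "0 < w" "w \<le> 1 / 2" "w < C" "u = \<theta> - w" "v = \<theta> + w"
      using uv C by (auto simp: w_def \<theta>_def field_simps)
    \<comment> \<open>The coarsest level whose gap fits into the interval. Failure of level
      \<open>n - 1\<close> gives the reverse comparison \<open>w < C * L * s\<close>.\<close>
    define n where "n = (LEAST n. C * (1 / real L) ^ n \<le> w)"
    have "\<exists>n. (1 / real L) ^ n < w / C" using w C L by (intro real_arch_pow_inv) auto
    then obtain n0 where "(1 / real L) ^ n0 < w / C" by blast
    then have "C * (1 / real L) ^ n0 \<le> w" using C by (simp add: pos_less_divide_eq mult.commute)
    then have n: "C * (1 / real L) ^ n \<le> w" unfolding n_def by (rule LeastI)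
    have "n \<noteq> 0" using n w by (intro notI) simp
    then obtain k where k: "n = Suc k" by (cases n) auto
    have "\<not> C * (1 / real L) ^ k \<le> w" using not_less_Least[of k "\<lambda>n. C * (1 / real L) ^ n \<le> w"] k
      unfolding n_def by simp
    define s where "s = (1 / real L) ^ n"
    have s: "0 < s" "s \<le> 1" unfolding s_def using L by (auto intro!: power_le_one)
    have Cs: "C * s \<le> w" using n unfolding s_def .
    have wCs: "w < C * L * s"
      using \<open>\<not> C * (1 / real L) ^ k \<le> w\<close> L unfolding s_def k by simp
    have "8 * R * s / \<delta> \<le> C * s" unfolding C_def using R \<open>0 < e\<close> s by (simp add: algebra_simps)
    then have "8 * R * s / \<delta> \<le> 1 / 2" using Cs w by linarith
    then have Rs: "16 * R * s \<le> \<delta>" using \<delta>(1) by (simp add: field_simps)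
    obtain i j x y where xy: "i \<in> {1..L}" "j \<in> {1..L}" "i \<noteq> j"
      "x \<in> sim L b i ` E" "y \<in> sim L b j ` E" "proj_angle \<theta> x = proj_angle \<theta> y"
      by (rule proj_E_overlap[OF E])
    have near: "\<exists>z\<in>shifts L b n. norm (x - z) \<le> R * s" if x: "x \<in> E" for x
    proof -
      obtain z x' where z: "z \<in> shifts L b n" "x' \<in> E" "x = s *\<^sub>R x' + z"
        using attractor_point[OF E x, of n] unfolding s_def by meson
      have "norm (x - z) = s * norm x'" using z(3) s by simp
      then have "norm (x - z) \<le> R * s" using R(2)[OF z(2)] s by (simp add: mult.commute)
      then show ?thesis using z(1) by blast
    qed
    have xE: "x \<in> E" "y \<in> E" by (rule sim_image_subset[OF E xy(1,4)], rule sim_image_subset[OF E xy(2,5)])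
    obtain z z' where z: "z \<in> shifts L b n" "norm (x - z) \<le> R * s"
        and z': "z' \<in> shifts L b n" "norm (y - z') \<le> R * s"
      using near[OF xE(1)] near[OF xE(2)] by blast
    let ?d = "z - z'"
    \<comment> \<open>All bounds on \<open>?d\<close> come from this splitting: \<open>x - y\<close>
      projects to 0 and has norm at least \<delta>, while the correction has norm at most
      \<open>2 * R * s\<close>.\<close>
    have d: "?d = (x - y) - ((x - z) - (y - z'))" by simp
    have diff: "norm ((x - z) - (y - z')) \<le> 2 * R * s"
      using norm_triangle_ineq4[of "x - z" "y - z'"] z(2) z'(2) by linarith
    have "\<delta> \<le> norm (x - y)" using \<delta>(2) xy(1-5) unfolding dist_norm by blast
    then have d_ge: "\<delta> / 2 \<le> norm ?d"
      unfolding d using norm_triangle_ineq2[of "x - y" "(x - z) - (y - z')"] diff Rs R s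
        zero_le_mult_iff[of R s] by linarith
    have "norm (x - y) \<le> 2 * R"
      using norm_triangle_ineq4[of x y] R(2)[OF xE(1)] R(2)[OF xE(2)] by linarith
    moreover have "2 * R * s \<le> 2 * R" using R s by simp
    ultimately have d_le: "norm ?d \<le> 4 * R"
      unfolding d using norm_triangle_ineq4[of "x - y" "(x - z) - (y - z')"] diff by linarith
    have "proj_angle \<theta> ?d = - proj_angle \<theta> ((x - z) - (y - z'))"
      using xy(6) by (simp add: proj_angle_diff)
    then have f: "\<bar>proj_angle \<theta> ?d\<bar> \<le> 2 * R * s"
      using abs_proj_angle_le[of \<theta> "(x - z) - (y - z')"] diff by linarith
    have Rs0: "0 < R * s" using R s by simp
    have d0: "0 < norm ?d" using d_ge \<delta>(1) by linarith
    have "2 * \<bar>proj_angle \<theta> ?d\<bar> \<le> norm ?d" using f Rs d_ge Rs0 by linarith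
    then obtain \<eta> where \<eta>: "\<bar>\<eta>\<bar> \<le> 2 * \<bar>proj_angle \<theta> ?d\<bar> / norm ?d" "proj_angle (\<theta> + \<eta>) ?d = 0"
      using d0 proj_angle_zero_near[of \<theta> ?d] by (metis norm_zero order_less_irrefl)
    have "2 * \<bar>proj_angle \<theta> ?d\<bar> / norm ?d \<le> 4 * R * s / (\<delta> / 2)"
      by (intro frac_le) (use f d_ge \<delta>(1) Rs0 in auto)
    then have \<eta>_le: "\<bar>\<eta>\<bar> \<le> 8 * R * s / \<delta>" using \<eta>(1) by simp
    define a where "a = e * s / (4 * R)"
    have a: "0 < a" unfolding a_def using \<open>0 < e\<close> s R by simp
    have "\<bar>\<eta>\<bar> + a \<le> C * s" unfolding C_def a_def using \<eta>_le by (simp add: algebra_simps)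
    then have \<eta>a: "\<bar>\<eta>\<bar> + a \<le> w" using Cs by simp
    show "\<exists>c d. u \<le> c \<and> d \<le> v \<and> e / (4 * R * L * C) * (v - u) \<le> d - c \<and> {c<..<d} \<inter> ?B = {}"
    proof (intro exI conjI)
      show "u \<le> \<theta> + \<eta> - a" "\<theta> + \<eta> + a \<le> v" using \<eta>a w(4,5) by linarith+
      have "e / (4 * R * L * C) * (v - u) = e / (4 * R * L * C) * 2 * w" using w by simp
      also have "\<dots> \<le> e / (4 * R * L * C) * 2 * (C * L * s)"
        using wCs R C \<open>0 < e\<close> by (intro mult_left_mono) auto
      also have "\<dots> = 2 * a" unfolding a_def using R C L by (simp add: field_simps)
      finally show "e / (4 * R * L * C) * (v - u) \<le> (\<theta> + \<eta> + a) - (\<theta> + \<eta> - a)" by simp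
      have "t \<notin> ?B" if t: "t \<in> {\<theta> + \<eta> - a<..<\<theta> + \<eta> + a}" for t
      proof -
        define \<tau> where "\<tau> = t - (\<theta> + \<eta>)"
        have \<tau>: "\<bar>\<tau>\<bar> < a" using t by (auto simp: \<tau>_def)
        have "proj_angle t ?d = proj_angle (\<theta> + \<eta> + pi / 2) ?d * sin \<tau>"
          using proj_angle_shift[of "\<theta> + \<eta>" \<tau> ?d] \<eta>(2) by (simp add: \<tau>_def)
        then have "\<bar>proj_angle t ?d\<bar> = \<bar>proj_angle (\<theta> + \<eta> + pi / 2) ?d\<bar> * \<bar>sin \<tau>\<bar>"
          by (simp add: abs_mult)
        also have "\<dots> \<le> norm ?d * \<bar>\<tau>\<bar>"
          by (intro mult_mono abs_proj_angle_le abs_sin_x_le_abs_x) auto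
        also have "\<dots> \<le> 4 * R * \<bar>\<tau>\<bar>" by (intro mult_right_mono d_le) auto
        also have "\<dots> < 4 * R * a" using \<tau> R by simp
        also have "\<dots> = e * s" unfolding a_def using R by simp
        finally have small: "\<bar>proj_angle t ?d\<bar> < e * (1 / real L) ^ n" unfolding s_def .
        have "z \<noteq> z'" using d0 by auto
        show ?thesis
        proof
          assume "t \<in> ?B"
          then have "e * (1 / real L) ^ n \<le> \<bar>proj_angle t ?d\<bar>"
            using z(1) z'(1) \<open>z \<noteq> z'\<close> by simp
          then show False using small by simp
        qed
      qed
      then show "{\<theta> + \<eta> - a<..<\<theta> + \<eta> + a} \<inter> ?B = {}" unfolding disjoint_iff by meson
    qed
  qed
qed

lemma Fav_self_similar_eq_0:
  assumes E: "self_similar_1set L b E"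
  shows "Fav E = 0"
proof -
  define B where "B e = {\<theta>. \<forall>n. \<forall>z\<in>shifts L b n. \<forall>z'\<in>shifts L b n. z \<noteq> z' \<longrightarrow>
    e * (1 / real L) ^ n \<le> \<bar>proj_angle \<theta> (z - z')\<bar>}" for e
  have neg: "negligible (\<Union>k. B (1 / real (Suc k)))"
    unfolding B_def
    by (rule negligible_Union_nat, rule negligible_separated_angles[OF E]) simp
  have K: "proj_angle \<theta> ` E \<in> lmeasurable" for \<theta>
    by (intro lmeasurable_compact compact_proj_angle compact_E[OF E])
  have null: "emeasure lebesgue (proj_angle \<theta> ` E) = 0" if \<theta>: "\<theta> \<notin> (\<Union>k. B (1 / real (Suc k)))" for \<theta>
  proof (rule ccontr)
    assume "emeasure lebesgue (proj_angle \<theta> ` E) \<noteq> 0"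
    \<comment> \<open>Positive measure is below its own double, which leaves room for a
      neighbourhood; this is the hypothesis under which the pieces are separated.\<close>
    then have "measure lebesgue (proj_angle \<theta> ` E) < 2 * measure lebesgue (proj_angle \<theta> ` E)"
      using K[of \<theta>] by (simp add: emeasure_eq_measure2 zero_less_measure_iff)
    then obtain r where r: "0 < r"
      "measure lebesgue (nbhd r (proj_angle \<theta> ` E)) < 2 * measure lebesgue (proj_angle \<theta> ` E)"
      by (rule measure_nbhd_less[OF compact_proj_angle[OF compact_E[OF E]]])
    obtain k where k: "1 / real (Suc k) < r" by (rule nat_approx_posE[OF r(1)])
    have "\<theta> \<in> B (1 / real (Suc k))"
      unfolding B_def
    proof (intro CollectI allI ballI impI)
      fix n z z' assume z: "z \<in> shifts L b n" "z' \<in> shifts L b n" "z \<noteq> z'"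
      have "1 / real (Suc k) * (1 / real L) ^ n \<le> r * (1 / real L) ^ n"
        by (intro mult_right_mono) (use k in auto)
      also have "\<dots> \<le> \<bar>proj_angle \<theta> (z - z')\<bar>" by (rule proj_E_separated[OF E r(2) z])
      finally show "1 / real (Suc k) * (1 / real L) ^ n \<le> \<bar>proj_angle \<theta> (z - z')\<bar>" .
    qed
    then show False using \<theta> by blast
  qed
  have "AE \<theta> in lebesgue. \<theta> \<notin> (\<Union>k. B (1 / real (Suc k)))"
    using neg unfolding negligible_iff_null_sets by (rule AE_not_in)
  then have "AE \<theta> in lebesgue. emeasure lebesgue (proj_angle \<theta> ` E) = 0"
    by (rule eventually_mono) (rule null)
  then have "AE \<theta> in lborel. emeasure lebesgue (proj_angle \<theta> ` E) = 0"
    by (simp add: AE_completion_iff)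
  then have "AE \<theta> in lborel. emeasure lebesgue (proj_angle \<theta> ` E) * indicator {0..pi} \<theta> = 0"
    by (rule eventually_mono) simp
  then have "Fav E = (\<integral>\<^sup>+(\<theta>::real). 0 \<partial>lborel)"
    unfolding Fav_def by (rule nn_integral_cong_AE)
  then show ?thesis by simp
qed

section \<open>Favard length of neighbourhoods\<close>

text \<open>Its vertical sections are the projections, so the Favard length becomes the planar
  measure of a single compact set. Measurability in the angle and regularity arguments then come
  from the plane.\<close>

definition proj_graph :: "real set \<Rightarrow> (real^2) set \<Rightarrow> (real \<times> real) set" where
  "proj_graph J F = (\<lambda>(\<theta>, x). (\<theta>, proj_angle \<theta> x)) ` (J \<times> F)"

lemma vimage_proj_graph:
  "Pair \<theta> -` proj_graph J F = (if \<theta> \<in> J then proj_angle \<theta> ` F else {})"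
  by (auto simp: proj_graph_def)

lemma compact_proj_graph:
  assumes "compact J" "compact F"
  shows "compact (proj_graph J F)"
  unfolding proj_graph_def split_beta proj_angle_def
  by (intro compact_continuous_image compact_Times continuous_intros assms)

lemma emeasure_lebesgue_compact:
  fixes K :: "'a::euclidean_space set"
  shows "compact K \<Longrightarrow> emeasure lebesgue K = emeasure lborel K"
  by (simp add: compact_imp_closed borel_closed)

lemma emeasure_proj_graph_section:
  assumes "compact F"
  shows "emeasure lborel (Pair \<theta> -` proj_graph J F) =
    emeasure lebesgue (proj_angle \<theta> ` F) * indicator J \<theta>"
  using emeasure_lebesgue_compact[OF compact_proj_angle[OF assms]]
  by (simp add: vimage_proj_graph indicator_def)

lemma measurable_proj_length:
  assumes "compact F" "compact J"
  shows "(\<lambda>\<theta>. emeasure lebesgue (proj_angle \<theta> ` F) * indicator J \<theta>) \<in> borel_measurable lborel"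
proof -
  have "proj_graph J F \<in> sets (lborel \<Otimes>\<^sub>M lborel)"
    unfolding lborel_prod sets_lborel by (intro borel_compact compact_proj_graph assms)
  from lborel.measurable_emeasure_Pair[OF this] show ?thesis
    by (simp add: emeasure_proj_graph_section[OF assms(1)])
qed

lemma emeasure_proj_graph:
  assumes "compact F" "compact J"
  shows "emeasure lborel (proj_graph J F) = (\<integral>\<^sup>+\<theta>\<in>J. emeasure lebesgue (proj_angle \<theta> ` F) \<partial>lborel)"
proof -
  have "proj_graph J F \<in> sets (lborel \<Otimes>\<^sub>M lborel)"
    unfolding lborel_prod sets_lborel by (intro borel_compact compact_proj_graph assms)
  from lborel.emeasure_pair_measure_alt[OF this] show ?thesis
    by (simp add: emeasure_proj_graph_section[OF assms(1)] lborel_prod)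
qed

lemma Fav_eq_emeasure: "compact F \<Longrightarrow> Fav F = emeasure lborel (proj_graph {0..pi} F)"
  by (simp add: Fav_def emeasure_proj_graph)

lemma Fav_mono:
  assumes "F \<subseteq> G" "compact G"
  shows "Fav F \<le> Fav G"
  unfolding Fav_def
  by (intro nn_integral_mono mult_right_mono emeasure_mono image_mono assms)
     (use compact_proj_angle[OF assms(2)] in \<open>auto simp: borel_compact\<close>)

lemma Fav_affine:
  assumes "0 \<le> c" "compact F"
  shows "Fav ((\<lambda>x. c *\<^sub>R x + t) ` F) = ennreal c * Fav F"
proof -
  have "proj_angle \<theta> ` (\<lambda>x. c *\<^sub>R x + t) ` F = (\<lambda>s. c *\<^sub>R s + proj_angle \<theta> t) ` proj_angle \<theta> ` F" for \<theta>
    by (simp add: image_image proj_angle_add proj_angle_scaleR)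
  then have "emeasure lebesgue (proj_angle \<theta> ` (\<lambda>x. c *\<^sub>R x + t) ` F) =
      ennreal c * emeasure lebesgue (proj_angle \<theta> ` F)" for \<theta>
    using emeasure_lebesgue_affine[of c "proj_angle \<theta> t" "proj_angle \<theta> ` F"] assms by simp
  then show ?thesis
    unfolding Fav_def using measurable_proj_length[OF assms(2), of "{0..pi}"]
    by (simp add: mult.assoc nn_integral_cmult)
qed

text \<open>Outer regularity is applied to the planar graph instead of to each projection, which
  yields one radius for all angles: moving a point of F by at most r moves its point in the graph
  vertically by at most r.\<close>

lemma Fav_nbhd_small:
  assumes F: "compact F" and "Fav F = 0" and "0 < e"
  obtains r where "0 < r" "Fav (nbhd r F) \<le> ennreal e"
proof -
  let ?P = "proj_graph {0..pi} F"
  have P: "compact ?P" by (intro compact_proj_graph F) simp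
  have P0: "emeasure lebesgue ?P = 0"
    using Fav_eq_emeasure[OF F] assms(2) emeasure_lebesgue_compact[OF P] by simp
  have Ps: "?P \<in> sets lebesgue" using lmeasurable_compact[OF P] by (rule fmeasurableD)
  obtain T where T: "open T" "?P \<subseteq> T" "emeasure lebesgue (T - ?P) < ennreal e"
    using sets_lebesgue_outer_open[OF Ps \<open>0 < e\<close>] by metis
  obtain r where r: "0 < r" "(\<Union>p\<in>?P. cball p r) \<subseteq> T"
    using compact_subset_open_imp_cball_epsilon_subset[OF P T(1,2)] by blast
  have sub: "proj_graph {0..pi} (nbhd r F) \<subseteq> T"
  proof
    fix p assume "p \<in> proj_graph {0..pi} (nbhd r F)"
    then obtain \<theta> x y where p: "\<theta> \<in> {0..pi}" "x \<in> F" "dist x y \<le> r" "p = (\<theta>, proj_angle \<theta> y)"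
      by (auto simp: proj_graph_def mem_nbhd)
    have "dist (\<theta>, proj_angle \<theta> x) p = \<bar>proj_angle \<theta> (x - y)\<bar>"
      by (simp add: p(4) dist_Pair_Pair dist_real_def proj_angle_diff)
    also have "\<dots> \<le> r" using abs_proj_angle_le[of \<theta> "x - y"] p(3) by (simp add: dist_norm)
    finally have "p \<in> cball (\<theta>, proj_angle \<theta> x) r" by simp
    moreover have "(\<theta>, proj_angle \<theta> x) \<in> ?P" using p(1,2) by (auto simp: proj_graph_def)
    ultimately show "p \<in> T" using r(2) by blast
  qed
  have Ts: "T \<in> sets lebesgue" using T(1) by simp
  have "Fav (nbhd r F) = emeasure lebesgue (proj_graph {0..pi} (nbhd r F))"
    using Fav_eq_emeasure[OF compact_nbhd[OF F]]
      emeasure_lebesgue_compact[OF compact_proj_graph[OF _ compact_nbhd[OF F]]] by simp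
  also have "\<dots> \<le> emeasure lebesgue ((T - ?P) \<union> ?P)"
    using sub Ts Ps by (intro emeasure_mono) auto
  also have "\<dots> \<le> emeasure lebesgue (T - ?P) + emeasure lebesgue ?P"
    using Ts Ps by (intro emeasure_subadditive) auto
  also have "\<dots> \<le> ennreal e" using T(3) P0 by simp
  finally show ?thesis using that r(1) by simp
qed

section \<open>Projections of squares and thickened iterates\<close>

lemma proj_angle_unit: "proj_angle \<theta> (c + t *\<^sub>R vector [cos \<theta>, sin \<theta>]) = proj_angle \<theta> c + t"
proof -
  have "proj_angle \<theta> (vector [cos \<theta>, sin \<theta>]) = 1"
    using sin_cos_squared_add3[of \<theta>] by (simp add: proj_angle_def)
  then show ?thesis by (simp add: proj_angle_add proj_angle_scaleR)
qed

text \<open>The square contains the disc of radius 1/2 about its centre, hence a unit segment in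
  every direction.\<close>

lemma proj_angle_unit_square:
  obtains p q where "proj_angle \<theta> ` cbox 0 1 = {p..q}" "p + 1 \<le> q"
proof -
  let ?Q = "cbox 0 1 :: (real^2) set"
  have "compact (proj_angle \<theta> ` ?Q)" "connected (proj_angle \<theta> ` ?Q)"
    by (intro compact_continuous_image connected_continuous_image continuous_intros
        compact_cbox convex_connected convex_box)+
  then obtain p q where pq: "proj_angle \<theta> ` ?Q = {p..q}"
    using connected_compact_interval_1 by meson
  define c :: "real^2" where "c = vector [1/2, 1/2]"
  have "c + t *\<^sub>R vector [cos \<theta>, sin \<theta>] \<in> ?Q" if t: "\<bar>t\<bar> = 1 / 2" for t
  proof -
    have "\<bar>t * cos \<theta>\<bar> \<le> 1/2 * 1" "\<bar>t * sin \<theta>\<bar> \<le> 1/2 * 1"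
      unfolding abs_mult t by (intro mult_left_mono; simp)+
    then show ?thesis by (auto simp: mem_box_cart forall_2 c_def abs_le_iff)
  qed
  then have "proj_angle \<theta> c + t \<in> {p..q}" if "\<bar>t\<bar> = 1 / 2" for t
    using that proj_angle_unit[of \<theta> c t] pq by (metis image_eqI)
  from this[of "1/2"] this[of "- 1/2"] have "p + 1 \<le> q" by simp
  with pq show ?thesis by (rule that)
qed

lemma compact_iterate: "compact (iterate L b n)"
  unfolding sim_def
proof (induction n)
  case (Suc n)
  have "compact (sim L b i ` iterate L b n)" for i
    unfolding sim_def by (intro compact_continuous_image continuous_intros Suc)
  then show ?case by (auto intro: compact_UN)
qed (simp add: compact_cbox)

lemma iterate_add:
  "iterate L b (m + k) = (\<Union>z\<in>shifts L b m. (\<lambda>x. (1 / real L) ^ m *\<^sub>R x + z) ` iterate L b k)"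
  by (rule iterate_decomposition) simp

text \<open>Each iterate contains a scaled unit square, all of whose projections have positive
  length. Positivity is what allows finitely many n to be absorbed into a constant.\<close>

lemma Fav_iterate_pos:
  assumes "0 < L"
  shows "0 < Fav (iterate L b n)"
proof -
  have "(\<integral>\<^sup>+\<theta>. indicator {0..pi} \<theta> \<partial>lborel) \<le> Fav (cbox 0 1)"
    unfolding Fav_def
  proof (intro nn_integral_mono)
    fix \<theta> :: real
    obtain p q where "proj_angle \<theta> ` cbox 0 1 = {p..q}" "p + 1 \<le> q"
      by (rule proj_angle_unit_square)
    then have "1 \<le> emeasure lebesgue (proj_angle \<theta> ` cbox 0 1)" by (simp add: ennreal_le_iff2 flip: ennreal_1)
    from mult_right_mono[OF this, of "indicator {0..pi} \<theta>"]
    show "indicator {0..pi} \<theta> \<le> emeasure lebesgue (proj_angle \<theta> ` cbox 0 1) * indicator {0..pi} \<theta>" by simp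
  qed
  then have Q: "0 < Fav (cbox 0 1)" using pi_gt_zero less_le_trans[of 0 "ennreal pi"] by simp
  have "shifts L b n \<noteq> {}" using assms by (induction n) auto
  then obtain z where z: "z \<in> shifts L b n" by blast
  have "ennreal ((1 / real L) ^ n) * Fav (cbox 0 1) = Fav ((\<lambda>x. (1 / real L) ^ n *\<^sub>R x + z) ` cbox 0 1)"
    by (intro Fav_affine[symmetric]) (auto simp: compact_cbox)
  also have "\<dots> \<le> Fav (iterate L b n)"
    using z iterate_add[of L b n 0] by (intro Fav_mono compact_iterate) auto
  finally have "ennreal ((1 / real L) ^ n) * Fav (cbox 0 1) \<le> Fav (iterate L b n)" .
  moreover have "0 < ennreal ((1 / real L) ^ n) * Fav (cbox 0 1)"
    using assms Q by (simp add: ennreal_zero_less_mult_iff)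
  ultimately show ?thesis by simp
qed

text \<open>A walk in steps of length l cannot jump over an interval of length at least l. From a
  point at distance at most \<open>N * l\<close>, at most N such steps reach the interval.\<close>

lemma nbhd_subset_shifts:
  fixes A :: "real set"
  assumes "0 < l" and fat: "\<And>r. r \<in> A \<Longrightarrow> \<exists>p q. r \<in> {p..q} \<and> {p..q} \<subseteq> A \<and> p + l \<le> q"
  shows "nbhd (real N * l) A \<subseteq> (\<Union>k\<in>{- int N..int N}. (\<lambda>x. 1 *\<^sub>R x + of_int k * l) ` A)"
proof
  fix s assume "s \<in> nbhd (real N * l) A"
  then obtain r where r: "r \<in> A" "\<bar>r - s\<bar> \<le> real N * l" unfolding mem_nbhd dist_real_def by blast
  then obtain p q where pq: "r \<in> {p..q}" "{p..q} \<subseteq> A" "p + l \<le> q" using fat by meson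
  have "\<exists>k\<in>{- int N..int N}. s - of_int k * l \<in> {p..q}"
  proof (cases "s > q")
    case True
    \<comment> \<open>The least number of steps to the left that brings s to q or below; being
      least, it stops above \<open>q - l\<close>, hence inside the interval.\<close>
    define j where "j = \<lceil>(s - q) / l\<rceil>"
    have k: "(s - q) / l \<le> of_int j" "of_int j < (s - q) / l + 1" unfolding j_def by linarith+
    have "s - q \<le> real N * l" using r(2) pq(1) unfolding abs_le_iff by auto
    then have "(s - q) / l \<le> real N" using \<open>0 < l\<close> by (simp add: pos_divide_le_eq)
    then have "j \<le> int N" by (simp add: j_def ceiling_le_iff)
    moreover have "0 \<le> j" using True \<open>0 < l\<close> k(1)
      by (smt (verit, best) divide_pos_pos of_int_0_le_iff)
    moreover have "s - q \<le> of_int j * l" using k(1) \<open>0 < l\<close> by (simp only: pos_divide_le_eq)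
    moreover have "of_int j * l < s - q + l"
      using mult_strict_right_mono[OF k(2) \<open>0 < l\<close>] \<open>0 < l\<close> by (simp add: distrib_right)
    ultimately have "s - of_int j * l \<in> {p..q}" "j \<in> {- int N..int N}" using pq(3) by auto
    then show ?thesis by (intro bexI[of _ j])
  next
    case nq: False
    show ?thesis
    proof (cases "s < p")
      case True
      define j where "j = \<lceil>(p - s) / l\<rceil>"
      have k: "(p - s) / l \<le> of_int j" "of_int j < (p - s) / l + 1" unfolding j_def by linarith+
      have "p - s \<le> real N * l" using r(2) pq(1) unfolding abs_le_iff by auto
      then have "(p - s) / l \<le> real N" using \<open>0 < l\<close> by (simp add: pos_divide_le_eq)
      then have "j \<le> int N" by (simp add: j_def ceiling_le_iff)
      moreover have "0 \<le> j" using True \<open>0 < l\<close> k(1)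
        by (smt (verit, best) divide_pos_pos of_int_0_le_iff)
      moreover have "p - s \<le> of_int j * l" using k(1) \<open>0 < l\<close> by (simp only: pos_divide_le_eq)
    moreover have "of_int j * l < p - s + l"
      using mult_strict_right_mono[OF k(2) \<open>0 < l\<close>] \<open>0 < l\<close> by (simp add: distrib_right)
    ultimately have "s - of_int (- j) * l \<in> {p..q}" "j \<in> {- int N..int N}" using pq(3) by auto
      then show ?thesis by (intro bexI[of _ "- j"]) auto
    next
      case False
      then show ?thesis using nq by (intro bexI[of _ 0]) auto
    qed
  qed
  then obtain k where "k \<in> {- int N..int N}" "s - of_int k * l \<in> A" using pq(2) by blast
  then show "s \<in> (\<Union>k\<in>{- int N..int N}. (\<lambda>x. 1 *\<^sub>R x + of_int k * l) ` A)"
    by (intro UN_I[of k] image_eqI[of _ _ "s - of_int k * l"]) auto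
qed

text \<open>Every projection of the iterate is a union of intervals of length at least
  \<open>L^-m\<close>, one for each square, so \<open>2 * N + 1\<close> translates cover the
  thickened projection.\<close>

lemma Fav_nbhd_iterate:
  assumes "0 < L"
  shows "Fav (nbhd (real N * (1 / real L) ^ m) (iterate L b m)) \<le> ennreal (2 * real N + 1) * Fav (iterate L b m)"
proof -
  define l where "l = (1 / real L) ^ m"
  have l: "0 < l" using assms by (simp add: l_def)
  let ?F = "iterate L b m"
  have len: "emeasure lebesgue (proj_angle \<theta> ` nbhd (real N * l) ?F)
      \<le> ennreal (2 * real N + 1) * emeasure lebesgue (proj_angle \<theta> ` ?F)" for \<theta>
  proof -
    let ?A = "proj_angle \<theta> ` ?F"
    have fat: "\<exists>p q. r \<in> {p..q} \<and> {p..q} \<subseteq> ?A \<and> p + l \<le> q" if "r \<in> ?A" for r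
    proof -
      obtain p q where pq: "proj_angle \<theta> ` cbox 0 1 = {p..q}" "p + 1 \<le> q"
        by (rule proj_angle_unit_square)
      have F: "?F = (\<Union>z\<in>shifts L b m. (\<lambda>x. l *\<^sub>R x + z) ` cbox 0 1)"
        using iterate_add[of L b m 0] by (simp add: l_def)
      then obtain z where z: "z \<in> shifts L b m" "r \<in> proj_angle \<theta> ` (\<lambda>x. l *\<^sub>R x + z) ` cbox 0 1"
        using \<open>r \<in> ?A\<close> by blast
      have "proj_angle \<theta> ` (\<lambda>x. l *\<^sub>R x + z) ` cbox 0 1 = (\<lambda>x. l * x + proj_angle \<theta> z) ` {p..q}"
        unfolding pq(1)[symmetric] by (simp add: image_image proj_angle_add proj_angle_scaleR)
      also have "\<dots> = {l * p + proj_angle \<theta> z..l * q + proj_angle \<theta> z}"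
        using l pq(2) by (simp add: image_affinity_atLeastAtMost)
      finally have img: "proj_angle \<theta> ` (\<lambda>x. l *\<^sub>R x + z) ` cbox 0 1
          = {l * p + proj_angle \<theta> z..l * q + proj_angle \<theta> z}" .
      have sub: "proj_angle \<theta> ` (\<lambda>x. l *\<^sub>R x + z) ` cbox 0 1 \<subseteq> ?A"
        using z(1) F by blast
      have "l * (p + 1) \<le> l * q" using pq(2) l by simp
      then have "l * p + proj_angle \<theta> z + l \<le> l * q + proj_angle \<theta> z" by (simp add: algebra_simps)
      then show ?thesis using z(2) sub unfolding img by blast
    qed
    have cA: "compact ?A" by (intro compact_proj_angle compact_iterate)
    let ?k = "{- int N..int N}"
    have "proj_angle \<theta> ` nbhd (real N * l) ?F \<subseteq> nbhd (real N * l) ?A"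
    proof
      fix s assume "s \<in> proj_angle \<theta> ` nbhd (real N * l) ?F"
      then obtain x y where "x \<in> ?F" "dist x y \<le> real N * l" "s = proj_angle \<theta> y" by (auto simp: mem_nbhd)
      then show "s \<in> nbhd (real N * l) ?A"
        using abs_proj_angle_le[of \<theta> "x - y"]
        by (force simp: mem_nbhd dist_norm proj_angle_diff)
    qed
    also have "\<dots> \<subseteq> (\<Union>k\<in>?k. (\<lambda>x. 1 *\<^sub>R x + of_int k * l) ` ?A)"
      by (rule nbhd_subset_shifts[OF l fat])
    finally have sub: "proj_angle \<theta> ` nbhd (real N * l) ?F \<subseteq> (\<Union>k\<in>?k. (\<lambda>x. 1 *\<^sub>R x + of_int k * l) ` ?A)" .
    have meas: "(\<lambda>x. 1 *\<^sub>R x + of_int k * l) ` ?A \<in> sets lebesgue" for k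
      by (intro fmeasurableD lmeasurable_compact compact_continuous_image continuous_intros cA)
    have "emeasure lebesgue (proj_angle \<theta> ` nbhd (real N * l) ?F)
        \<le> emeasure lebesgue (\<Union>k\<in>?k. (\<lambda>x. 1 *\<^sub>R x + of_int k * l) ` ?A)"
      by (intro emeasure_mono sub sets.finite_UN meas) simp
    also have "\<dots> \<le> (\<Sum>k\<in>?k. emeasure lebesgue ((\<lambda>x. 1 *\<^sub>R x + of_int k * l) ` ?A))"
      by (intro emeasure_subadditive_finite) (use meas in auto)
    also have "\<dots> = (\<Sum>k\<in>?k. emeasure lebesgue ?A)"
      unfolding emeasure_lebesgue_affine by simp
    also have "\<dots> = ennreal (2 * real N + 1) * emeasure lebesgue ?A"
    proof -
      have "real (card ?k) = 2 * real N + 1" by simp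
      then show ?thesis by (metis sum_constant ennreal_of_nat_eq_real_of_nat)
    qed
    finally show ?thesis .
  qed
  have "Fav (nbhd (real N * l) ?F) \<le>
     (\<integral>\<^sup>+\<theta>. ennreal (2 * real N + 1) * (emeasure lebesgue (proj_angle \<theta> ` ?F) * indicator {0..pi} \<theta>) \<partial>lborel)"
    unfolding Fav_def mult.assoc[symmetric] by (intro nn_integral_mono mult_right_mono len) simp
  also have "\<dots> = ennreal (2 * real N + 1) * Fav ?F"
    unfolding Fav_def by (intro nn_integral_cmult measurable_proj_length compact_iterate) simp
  finally show ?thesis unfolding l_def .
qed

section \<open>Change of variables\<close>

text \<open>Links the two models of the plane: sections are taken in pairs of reals, differentiable
  maps are treated on \<open>real^2\<close>.\<close>

lemma lborel_pair_eq_distr_vec2: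
  "(lborel :: (real \<times> real) measure) = distr (lborel :: (real^2) measure) borel (\<lambda>v. (v $ 1, v $ 2))"
proof (rule lborel_eqI)
  have meas: "(\<lambda>v :: real^2. (v $ 1, v $ 2)) \<in> borel_measurable lborel"
    using borel_measurable_continuous_onI[of "\<lambda>v :: real^2. (v $ 1, v $ 2)"]
    by (simp add: continuous_intros)
  fix l u :: "real \<times> real"
  assume le: "\<And>b. b \<in> Basis \<Longrightarrow> l \<bullet> b \<le> u \<bullet> b"
  then have le': "fst l \<le> fst u" "snd l \<le> snd u"
    using le[of "(1, 0)"] le[of "(0, 1)"] by (auto simp: Basis_prod_def inner_prod_def)
  let ?l = "vector [fst l, snd l] :: real^2" and ?u = "vector [fst u, snd u] :: real^2"
  have "(\<lambda>v :: real^2. (v $ 1, v $ 2)) -` box l u = box ?l ?u"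
    by (auto simp: box_def Basis_prod_def inner_prod_def Basis_vec_def inner_axis UNIV_2)
  moreover have "emeasure lborel (box ?l ?u) = (\<Prod>b\<in>Basis. (?u - ?l) \<bullet> b)"
    using le' by (intro emeasure_lborel_box) (auto simp: Basis_vec_def inner_axis UNIV_2)
  moreover have "(\<Prod>b\<in>Basis. (?u - ?l) \<bullet> b) = (fst u - fst l) * (snd u - snd l)"
  proof -
    have B: "(Basis :: (real^2) set) = {axis 1 1, axis 2 1}"
      by (auto simp: Basis_vec_def UNIV_2)
    have ne: "axis 1 1 \<noteq> (axis 2 1 :: real^2)" by (simp add: axis_eq_axis)
    show ?thesis unfolding B using ne by (subst prod.insert) (auto simp: inner_axis)
  qed
  moreover have "(\<Prod>b\<in>Basis. (u - l) \<bullet> b) = (fst u - fst l) * (snd u - snd l)"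
  proof -
    have B: "(Basis :: (real \<times> real) set) = {(1, 0), (0, 1)}" by (auto simp: Basis_prod_def)
    show ?thesis unfolding B by (subst prod.insert) (auto simp: inner_prod_def)
  qed
  ultimately show "emeasure (distr lborel borel (\<lambda>v :: real^2. (v $ 1, v $ 2))) (box l u)
      = (\<Prod>b\<in>Basis. (u - l) \<bullet> b)"
    using meas by (simp add: emeasure_distr)
qed simp

lemma emeasure_vec2:
  assumes "T \<in> sets borel"
  shows "emeasure lborel {v :: real^2. (v $ 1, v $ 2) \<in> T} = emeasure lborel T"
proof -
  have "(\<lambda>v :: real^2. (v $ 1, v $ 2)) \<in> borel_measurable lborel"
    using borel_measurable_continuous_onI[of "\<lambda>v :: real^2. (v $ 1, v $ 2)"]
    by (simp add: continuous_intros)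
  then show ?thesis
    using assms by (subst lborel_pair_eq_distr_vec2) (simp add: emeasure_distr vimage_def)
qed

section \<open>Slopes in place of angles\<close>

lemma proj_length_add_pi:
  "emeasure lebesgue (proj_angle (\<theta> + pi) ` F) = emeasure lebesgue (proj_angle \<theta> ` F)"
proof -
  have "proj_angle (\<theta> + pi) ` F = (\<lambda>s. (- 1) *\<^sub>R s + 0) ` proj_angle \<theta> ` F"
    by (simp add: image_image proj_angle_def)
  then show ?thesis using emeasure_lebesgue_affine[of "-1" "0::real" "proj_angle \<theta> ` F"] by simp
qed

text \<open>Turning by pi only reflects the projection, so negative angles can be moved into the
  range defining \<open>Fav\<close>. The two halves are bounded separately, at the price of the
  factor 2.\<close>

lemma proj_length_half_turn_le:
  assumes F: "compact F"
  shows "(\<integral>\<^sup>+\<theta>\<in>{- pi / 2..pi / 2}. emeasure lebesgue (proj_angle \<theta> ` F) \<partial>lborel) \<le> 2 * Fav F"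
proof -
  let ?l = "\<lambda>\<theta>. emeasure lebesgue (proj_angle \<theta> ` F)"
  have m: "(\<lambda>\<theta>. ?l \<theta> * indicator {u..v} \<theta>) \<in> borel_measurable borel" for u v
    using measurable_proj_length[OF F, of "{u..v}"] by simp
  have le: "(\<integral>\<^sup>+\<theta>\<in>J. ?l \<theta> \<partial>lborel) \<le> Fav F" if "J \<subseteq> {0..pi}" for J
    unfolding Fav_def using that
    by (intro nn_integral_mono mult_left_mono) (auto simp: indicator_def)
  have "(\<integral>\<^sup>+\<theta>\<in>{- pi / 2..pi / 2}. ?l \<theta> \<partial>lborel)
      \<le> (\<integral>\<^sup>+\<theta>. ?l \<theta> * indicator {- pi / 2..0} \<theta> + ?l \<theta> * indicator {0..pi / 2} \<theta> \<partial>lborel)"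
    by (intro nn_integral_mono) (auto simp: indicator_def)
  also have "\<dots> = (\<integral>\<^sup>+\<theta>\<in>{- pi / 2..0}. ?l \<theta> \<partial>lborel) + (\<integral>\<^sup>+\<theta>\<in>{0..pi / 2}. ?l \<theta> \<partial>lborel)"
    by (intro nn_integral_add) (use m in simp_all)
  also have "(\<integral>\<^sup>+\<theta>\<in>{- pi / 2..0}. ?l \<theta> \<partial>lborel)
      = (\<integral>\<^sup>+\<theta>. ?l (- pi + 1 * \<theta>) * indicator {- pi / 2..0} (- pi + 1 * \<theta>) \<partial>lborel)"
    using nn_integral_real_affine[OF m, of 1 "- pi / 2" 0 "- pi"] by simp
  also have "\<dots> = (\<integral>\<^sup>+\<theta>\<in>{pi / 2..pi}. ?l \<theta> \<partial>lborel)"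
  proof (intro nn_integral_cong)
    fix \<theta>
    have "?l (- pi + 1 * \<theta>) = ?l \<theta>" using proj_length_add_pi[of "\<theta> - pi" F] by simp
    then show "?l (- pi + 1 * \<theta>) * indicator {- pi / 2..0} (- pi + 1 * \<theta>) = ?l \<theta> * indicator {pi / 2..pi} \<theta>"
      by (auto simp: indicator_def field_simps)
  qed
  also have "\<dots> + (\<integral>\<^sup>+\<theta>\<in>{0..pi / 2}. ?l \<theta> \<partial>lborel) \<le> Fav F + Fav F"
    by (intro add_mono le) auto
  finally show ?thesis by (simp add: mult_2)
qed

lemma proj_length_reflected_le:
  assumes F: "compact F"
  shows "(\<integral>\<^sup>+\<theta>\<in>{- pi / 2..pi / 2}. emeasure lebesgue (proj_angle (pi / 2 - \<theta>) ` F) \<partial>lborel) \<le> 2 * Fav F"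
proof -
  let ?l = "\<lambda>\<theta>. emeasure lebesgue (proj_angle \<theta> ` F)"
  have m: "(\<lambda>\<theta>. ?l \<theta> * indicator {0..pi} \<theta>) \<in> borel_measurable borel"
    using measurable_proj_length[OF F, of "{0..pi}"] by simp
  have "Fav F = (\<integral>\<^sup>+\<theta>. ?l (pi / 2 + (- 1) * \<theta>) * indicator {0..pi} (pi / 2 + (- 1) * \<theta>) \<partial>lborel)"
    unfolding Fav_def using nn_integral_real_affine[OF m, of "- 1" "pi / 2"] by simp
  also have "\<dots> = (\<integral>\<^sup>+\<theta>\<in>{- pi / 2..pi / 2}. ?l (pi / 2 - \<theta>) \<partial>lborel)"
    by (intro nn_integral_cong) (auto simp: indicator_def field_simps)
  finally show ?thesis by (simp add: mult_2)
qed

text \<open>The analogue of \<open>proj_graph\<close> with directions given by bounded slopes: the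
  quotients of derivatives occurring later are slopes already. The indices choose the coordinate
  with coefficient 1, so that directions near either axis can be treated.\<close>

definition slope_graph :: "2 \<Rightarrow> 2 \<Rightarrow> real \<Rightarrow> (real^2) set \<Rightarrow> (real \<times> real) set" where
  "slope_graph a c M F = (\<lambda>(p, u). (p, u $ a + p * u $ c)) ` ({- M..M} \<times> F)"

lemma compact_slope_graph: "compact F \<Longrightarrow> compact (slope_graph a c M F)"
  unfolding slope_graph_def split_beta
  by (intro compact_continuous_image compact_Times continuous_intros) auto

lemma vimage_slope_graph:
  "Pair p -` slope_graph a c M F = (if p \<in> {- M..M} then (\<lambda>u. u $ a + p * u $ c) ` F else {})"
  by (force simp: slope_graph_def)

text \<open>With \<open>p = tan \<alpha>\<close>, the section of the slope graph over \<open>p\<close> is the orthogonal projection in the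
  direction \<open>\<alpha>\<close> (or \<open>\<pi>/2 - \<alpha>\<close>, if the coordinates are swapped), scaled by \<open>1 / cos \<alpha>\<close>.\<close>

lemma emeasure_slope_graph_le:
  assumes F: "compact F" and ac: "(a, c) = (1, 2) \<or> (a, c) = (2, 1)" and "0 \<le> M"
  shows "emeasure lborel (slope_graph a c M F) \<le> ennreal (2 / cos (arctan M) ^ 3) * Fav F"
proof -
  define A where "A = arctan M"
  have A: "0 \<le> A" "A < pi / 2" using \<open>0 \<le> M\<close> arctan_ubound[of M] by (auto simp: A_def)
  have cA: "0 < cos A" using A by (intro cos_gt_zero_pi) auto
  have cos_ge: "cos A \<le> cos \<alpha>" if "\<alpha> \<in> {- A..A}" for \<alpha>
    using that A cos_monotone_0_pi_le[of \<alpha> A] cos_monotone_0_pi_le[of "- \<alpha>" A]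
    by (cases "0 \<le> \<alpha>") auto
  let ?T = "slope_graph a c M F"
  \<comment> \<open>The sections are compact, so their lengths are finite and may be treated as real
    numbers in the substitution \<open>p = tan \<alpha>\<close>.\<close>
  define f where "f p = measure lborel (Pair p -` ?T)" for p
  have Ts: "?T \<in> sets (lborel \<Otimes>\<^sub>M lborel)"
    unfolding lborel_prod sets_lborel by (intro borel_compact compact_slope_graph F)
  have fm: "f \<in> borel_measurable borel"
    using lborel.measurable_emeasure_Pair[OF Ts] unfolding f_def measure_def by simp
  have csec: "compact (Pair p -` ?T)" for p
    unfolding vimage_slope_graph by (auto intro!: compact_continuous_image continuous_intros F)
  have sec: "emeasure lborel (Pair p -` ?T) = ennreal (f p) * indicator {- M..M} p" for p
  proof (cases "p \<in> {- M..M}")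
    case True
    then show ?thesis
      unfolding f_def using emeasure_compact_finite[OF csec[of p]]
      by (simp add: emeasure_eq_ennreal_measure)
  next
    case False
    then have "Pair p -` ?T = {}" by (simp only: vimage_slope_graph if_False)
    then show ?thesis using False by simp
  qed
  define g where "g \<alpha> = (if a = 1 then \<alpha> else pi / 2 - \<alpha>)" for \<alpha> :: real
  let ?l = "\<lambda>\<alpha>. emeasure lebesgue (proj_angle (g \<alpha>) ` F)"
  have f_tan: "ennreal (f (tan \<alpha>)) \<le> ennreal (1 / cos A) * ?l \<alpha>" if \<alpha>: "\<alpha> \<in> {- A..A}" for \<alpha>
  proof -
    have c\<alpha>: "0 < cos \<alpha>" using cos_ge[OF \<alpha>] cA by simp
    have arg: "u $ a + tan \<alpha> * u $ c = (1 / cos \<alpha>) *\<^sub>R proj_angle (g \<alpha>) u + 0" for u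
    proof -
      have "proj_angle (g \<alpha>) u = cos \<alpha> * u $ a + sin \<alpha> * u $ c"
        using ac by (auto simp: g_def proj_angle_def cos_diff sin_diff)
      then show ?thesis using c\<alpha> by (simp add: tan_def field_simps)
    qed
    have cK: "compact (proj_angle (g \<alpha>) ` F)" by (intro compact_proj_angle F)
    have "Pair (tan \<alpha>) -` ?T \<subseteq> (\<lambda>u. u $ a + tan \<alpha> * u $ c) ` F"
      unfolding vimage_slope_graph by auto
    then have sub: "Pair (tan \<alpha>) -` ?T \<subseteq> (\<lambda>s. (1 / cos \<alpha>) *\<^sub>R s + 0) ` proj_angle (g \<alpha>) ` F"
      unfolding arg by (simp add: image_image)
    have "ennreal (f (tan \<alpha>)) = emeasure lborel (Pair (tan \<alpha>) -` ?T)"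
      unfolding f_def using emeasure_compact_finite[OF csec[of "tan \<alpha>"]]
      by (simp add: emeasure_eq_ennreal_measure)
    also have "\<dots> = emeasure lebesgue (Pair (tan \<alpha>) -` ?T)"
      using emeasure_lebesgue_compact[OF csec] by simp
    also have "\<dots> \<le> emeasure lebesgue ((\<lambda>s. (1 / cos \<alpha>) *\<^sub>R s + 0) ` proj_angle (g \<alpha>) ` F)"
      by (intro emeasure_mono sub fmeasurableD lmeasurable_compact compact_continuous_image continuous_intros cK)
    also have "\<dots> = ennreal (1 / cos \<alpha>) * ?l \<alpha>"
      unfolding emeasure_lebesgue_affine using c\<alpha> by simp
    also have "\<dots> \<le> ennreal (1 / cos A) * ?l \<alpha>"
      using cos_ge[OF \<alpha>] cA by (intro mult_right_mono ennreal_leI frac_le) auto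
    finally show ?thesis .
  qed
  have "emeasure lborel ?T = (\<integral>\<^sup>+p. ennreal (f p) * indicator {- M..M} p \<partial>lborel)"
    using lborel.emeasure_pair_measure_alt[OF Ts] by (simp add: sec lborel_prod)
  also have "\<dots> = (\<integral>\<^sup>+p. ennreal (f p * indicator {tan (- A)..tan A} p) \<partial>lborel)"
    by (intro nn_integral_cong) (simp add: A_def tan_arctan indicator_def)
  also have "\<dots> = (\<integral>\<^sup>+\<alpha>. ennreal (f (tan \<alpha>) * (1 / cos \<alpha> ^ 2) * indicator {- A..A} \<alpha>) \<partial>lborel)"
  proof (rule nn_integral_substitution)
    show "set_borel_measurable borel {tan (- A)..tan A} f"
      unfolding set_borel_measurable_def using fm by simp
    fix \<alpha> assume \<alpha>: "\<alpha> \<in> {- A..A}"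
    then have "cos \<alpha> \<noteq> 0" using cos_ge[OF \<alpha>] cA by simp
    then show "(tan has_real_derivative 1 / cos \<alpha> ^ 2) (at \<alpha>)"
      by (auto intro!: derivative_eq_intros simp: field_simps)
    show "0 \<le> 1 / cos \<alpha> ^ 2" by simp
  next
    show "continuous_on {- A..A} (\<lambda>\<alpha>. 1 / cos \<alpha> ^ 2)"
      using cos_ge cA by (intro continuous_intros) force
    show "- A \<le> A" using A by simp
  qed
  \<comment> \<open>Of the three factors \<open>1 / cos A\<close>, one comes from the scaled
    projection and two from the derivative of tan.\<close>
  also have "\<dots> \<le> (\<integral>\<^sup>+\<alpha>. ennreal (1 / cos A ^ 3) * (?l \<alpha> * indicator {- pi / 2..pi / 2} \<alpha>) \<partial>lborel)"
  proof (intro nn_integral_mono)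
    fix \<alpha> :: real
    show "ennreal (f (tan \<alpha>) * (1 / cos \<alpha> ^ 2) * indicator {- A..A} \<alpha>)
        \<le> ennreal (1 / cos A ^ 3) * (?l \<alpha> * indicator {- pi / 2..pi / 2} \<alpha>)"
    proof (cases "\<alpha> \<in> {- A..A}")
      case True
      have "ennreal (f (tan \<alpha>) * (1 / cos \<alpha> ^ 2)) = ennreal (1 / cos \<alpha> ^ 2) * ennreal (f (tan \<alpha>))"
        by (subst ennreal_mult[symmetric]) (auto simp: f_def mult.commute)
      also have "\<dots> \<le> ennreal (1 / cos A ^ 2) * (ennreal (1 / cos A) * ?l \<alpha>)"
        using f_tan[OF True] cos_ge[OF True] cA
        by (intro mult_mono ennreal_leI frac_le power_mono) auto
      also have "\<dots> = ennreal (1 / cos A ^ 3) * ?l \<alpha>"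
        using cA by (simp add: mult.assoc[symmetric] ennreal_mult[symmetric] power3_eq_cube power2_eq_square)
      finally show ?thesis using True A by simp
    qed simp
  qed
  also have "\<dots> = ennreal (1 / cos A ^ 3) * (\<integral>\<^sup>+\<alpha>\<in>{- pi / 2..pi / 2}. ?l \<alpha> \<partial>lborel)"
  proof (intro nn_integral_cmult)
    have m: "(\<lambda>\<theta>. emeasure lebesgue (proj_angle \<theta> ` F) * indicator J \<theta>) \<in> borel_measurable borel"
      if "compact J" for J
      using measurable_proj_length[OF F that] by simp
    show "(\<lambda>\<alpha>. ?l \<alpha> * indicator {- pi / 2..pi / 2} \<alpha>) \<in> borel_measurable lborel"
    proof (cases "a = 1")
      case True
      then show ?thesis using m[of "{- pi / 2..pi / 2}"] by (simp add: g_def)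
    next
      case False
      have "(\<lambda>\<alpha>. pi / 2 - \<alpha>) \<in> borel_measurable borel" by simp
      from measurable_compose[OF this m[of "{0..pi}"]]
      have "(\<lambda>\<alpha>. emeasure lebesgue (proj_angle (pi / 2 - \<alpha>) ` F) * indicator {0..pi} (pi / 2 - \<alpha>))
          \<in> borel_measurable borel" by simp
      also have "(\<lambda>\<alpha>. emeasure lebesgue (proj_angle (pi / 2 - \<alpha>) ` F) * indicator {0..pi} (pi / 2 - \<alpha>))
        = (\<lambda>\<alpha>. ?l \<alpha> * indicator {- pi / 2..pi / 2} \<alpha>)"
        using False by (auto simp: g_def indicator_def fun_eq_iff)
      finally show ?thesis by simp
    qed
  qed
  also have "\<dots> \<le> ennreal (1 / cos A ^ 3) * (2 * Fav F)"
    using proj_length_half_turn_le[OF F] proj_length_reflected_le[OF F]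
    by (intro mult_left_mono) (cases "a = 1"; simp add: g_def)+
  also have "\<dots> = ennreal (2 / cos A ^ 3) * Fav F"
    using cA by (simp add: mult.assoc[symmetric] mult.commute[of _ 2] flip: ennreal_mult ennreal_numeral)
  finally show ?thesis unfolding A_def .
qed

section \<open>Area estimate for a planar chart\<close>

lemma mvt_segment:
  fixes f :: "'a::real_normed_vector \<Rightarrow> real"
  assumes "\<And>w. w \<in> closed_segment y y' \<Longrightarrow> (f has_derivative D w) (at w)"
  shows "\<exists>w\<in>closed_segment y y'. f y' - f y = D w (y' - y)"
proof -
  let ?g = "\<lambda>t::real. y + t *\<^sub>R (y' - y)"
  have seg: "?g t \<in> closed_segment y y'" if "t \<in> {0..1}" for t
    using that by (auto simp: closed_segment_def algebra_simps intro!: exI[of _ t])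
  have "\<exists>t\<in>{0..1}. (f \<circ> ?g) 1 - (f \<circ> ?g) 0 = (D (?g t) \<circ> (\<lambda>h. h *\<^sub>R (y' - y))) (1 - 0)"
  proof (rule mvt_very_simple)
    fix t :: real assume t: "0 \<le> t" "t \<le> 1"
    have "(?g has_derivative (\<lambda>h. h *\<^sub>R (y' - y))) (at t within {0..1})"
      by (auto intro!: derivative_eq_intros)
    moreover have "(f has_derivative D (?g t)) (at (?g t) within ?g ` {0..1})"
      by (rule has_derivative_at_withinI, rule assms, rule seg) (use t in auto)
    ultimately show "(f \<circ> ?g has_derivative (D (?g t) \<circ> (\<lambda>h. h *\<^sub>R (y' - y)))) (at t within {0..1})"
      by (rule diff_chain_within)
  qed simp
  then obtain t where "t \<in> {0..1}" "f y' - f y = D (?g t) (y' - y)" by auto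
  then show ?thesis using seg by (intro bexI[of _ "?g t"])
qed

lemma det2_eq_0:
  fixes a b c d :: real
  assumes "a * h + b * k = 0" "c * h + d * k = 0" "a * d - b * c \<noteq> 0"
  shows "h = 0" "k = 0"
proof -
  have "(a * d - b * c) * h = 0" "(a * d - b * c) * k = 0" using assms(1,2) by algebra+
  then show "h = 0" "k = 0" using assms(3) by auto
qed

text \<open>The two points \<open>z\<close>, \<open>z'\<close> in the Jacobian hypothesis make it usable after applying the
  mean value theorem to each component separately; this gives injectivity of the chart.\<close>

lemma emeasure_chart_preimage_le:
  fixes p q p1 p2 q1 q2 :: "real^2 \<Rightarrow> real" and T :: "(real \<times> real) set"
  assumes S: "convex S" "compact S"
    and p: "\<And>y. y \<in> S \<Longrightarrow> (p has_derivative (\<lambda>h. p1 y * h $ 1 + p2 y * h $ 2)) (at y)"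
    and q: "\<And>y. y \<in> S \<Longrightarrow> (q has_derivative (\<lambda>h. q1 y * h $ 1 + q2 y * h $ 2)) (at y)"
    and "0 < \<delta>"
    and jac: "\<And>z z'. z \<in> S \<Longrightarrow> z' \<in> S \<Longrightarrow> \<delta> \<le> \<bar>p1 z * q2 z' - p2 z * q1 z'\<bar>"
    and T: "compact T"
  shows "compact {y \<in> S. (p y, q y) \<in> T}"
    and "emeasure lebesgue {y \<in> S. (p y, q y) \<in> T} \<le> ennreal (1 / \<delta>) * emeasure lborel T"
proof -
  define \<Phi> :: "real^2 \<Rightarrow> real^2" where "\<Phi> y = p y *\<^sub>R axis 1 1 + q y *\<^sub>R axis 2 1" for y
  define \<Phi>' :: "real^2 \<Rightarrow> real^2 \<Rightarrow> real^2" where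
    "\<Phi>' y h = (p1 y * h $ 1 + p2 y * h $ 2) *\<^sub>R axis 1 1 + (q1 y * h $ 1 + q2 y * h $ 2) *\<^sub>R axis 2 1" for y h
  define P where "P = {y \<in> S. (p y, q y) \<in> T}"
  have comp: "\<Phi> y $ 1 = p y" "\<Phi> y $ 2 = q y" for y
    by (simp_all add: \<Phi>_def axis_def)
  have deriv: "(\<Phi> has_derivative \<Phi>' y) (at y)" if "y \<in> S" for y
    unfolding \<Phi>_def[abs_def] \<Phi>'_def[abs_def]
    by (intro has_derivative_add has_derivative_scaleR_left p q that)
  have "continuous_on S (\<lambda>y. (p y, q y))"
    by (intro continuous_on_Pair continuous_at_imp_continuous_on ballI)
       (use p q in \<open>blast intro: has_derivative_continuous\<close>)+
  then have cP: "compact P"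
    unfolding P_def using S(2) T continuous_closedin_preimage[of S "\<lambda>y. (p y, q y)" T]
    by (auto simp: vimage_def Int_def Collect_conj_eq[symmetric] compact_imp_closed
        intro: closedin_compact)
  have inj: "inj_on \<Phi> P"
  proof (rule inj_onI)
    fix y y' assume y: "y \<in> P" "y' \<in> P" "\<Phi> y = \<Phi> y'"
    have seg: "closed_segment y y' \<subseteq> S"
      using y S(1) by (auto simp: P_def closed_segment_subset)
    have eq: "p y' - p y = 0" "q y' - q y = 0" using y(3) comp by (metis diff_self)+
    let ?h = "y' - y"
    have "\<exists>z\<in>closed_segment y y'. p y' - p y = p1 z * ?h $ 1 + p2 z * ?h $ 2"
      by (rule mvt_segment) (use seg p in blast)
    then obtain z where z: "z \<in> S" "p1 z * ?h $ 1 + p2 z * ?h $ 2 = 0"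
      unfolding eq using seg by fastforce
    have "\<exists>z\<in>closed_segment y y'. q y' - q y = q1 z * ?h $ 1 + q2 z * ?h $ 2"
      by (rule mvt_segment) (use seg q in blast)
    then obtain z' where z': "z' \<in> S" "q1 z' * ?h $ 1 + q2 z' * ?h $ 2 = 0"
      unfolding eq using seg by fastforce
    have "p1 z * q2 z' - p2 z * q1 z' \<noteq> 0" using jac[OF z(1) z'(1)] \<open>0 < \<delta>\<close> by auto
    from det2_eq_0[OF z(2) z'(2) this] show "y = y'" by (simp add: vec_eq_iff forall_2)
  qed
  have Ps: "P \<in> lmeasurable" by (rule lmeasurable_compact[OF cP])
  have PS: "P \<subseteq> S" by (auto simp: P_def)
  have "compact (\<Phi> ` P)"
    using PS by (intro compact_continuous_image cP continuous_at_imp_continuous_on ballI)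
      (blast intro: has_derivative_continuous[OF deriv])
  then have \<Phi>P: "\<Phi> ` P \<in> lmeasurable" by (rule lmeasurable_compact)
  define m where "m = measure lebesgue (\<Phi> ` P)"
  \<comment> \<open>By injectivity the Jacobian integrates over P to the measure of the image; since
    the Jacobian is at least \<delta>, the image has at least \<delta> times the measure of
    P.\<close>
  have "((\<lambda>y. \<bar>det (matrix (\<Phi>' y))\<bar>) has_integral m) P"
    using has_measure_differentiable_image[of P \<Phi> \<Phi>' m] Ps \<Phi>P inj PS deriv
    by (auto simp: m_def fmeasurableD intro: has_derivative_at_withinI)
  moreover have "((\<lambda>y. \<delta>) has_integral \<delta> * measure lebesgue P) P"
  proof -
    have "((\<lambda>y. 1::real) has_integral measure lebesgue P) P"
      using Ps lmeasure_integral[OF Ps] integrable_integral[of "\<lambda>y. 1::real" P]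
      by (simp add: lmeasurable_iff_integrable_on)
    from has_integral_mult_right[OF this, of \<delta>] show ?thesis by simp
  qed
  moreover have "\<delta> \<le> \<bar>det (matrix (\<Phi>' y))\<bar>" if "y \<in> P" for y
    using jac[of y y] that PS by (auto simp: det_2 matrix_def \<Phi>'_def axis_def)
  ultimately have "\<delta> * measure lebesgue P \<le> m" using has_integral_le by blast
  then have "measure lebesgue P \<le> 1 / \<delta> * m" using \<open>0 < \<delta>\<close> by (simp add: field_simps)
  then have "emeasure lebesgue P \<le> ennreal (1 / \<delta> * m)"
    using Ps by (simp add: emeasure_eq_measure2 ennreal_leI)
  also have "\<dots> = ennreal (1 / \<delta>) * emeasure lebesgue (\<Phi> ` P)"
    using \<Phi>P \<open>0 < \<delta>\<close> by (subst ennreal_mult) (auto simp: emeasure_eq_measure2 m_def)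
  also have "\<dots> \<le> ennreal (1 / \<delta>) * emeasure lebesgue {v :: real^2. (v $ 1, v $ 2) \<in> T}"
  proof (intro mult_left_mono emeasure_mono)
    show "\<Phi> ` P \<subseteq> {v. (v $ 1, v $ 2) \<in> T}" by (auto simp: P_def comp)
    have "closed {v :: real^2. (v $ 1, v $ 2) \<in> T}"
      using closed_vimage[OF compact_imp_closed[OF T], of "\<lambda>v :: real^2. (v $ 1, v $ 2)"]
      by (simp add: vimage_def continuous_intros)
    then show "{v :: real^2. (v $ 1, v $ 2) \<in> T} \<in> sets lebesgue" by simp
  qed simp
  also have "emeasure lebesgue {v :: real^2. (v $ 1, v $ 2) \<in> T} = emeasure lborel T"
  proof -
    have "closed {v :: real^2. (v $ 1, v $ 2) \<in> T}"
      using closed_vimage[OF compact_imp_closed[OF T], of "\<lambda>v :: real^2. (v $ 1, v $ 2)"]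
      by (simp add: vimage_def continuous_intros)
    then show ?thesis
      using emeasure_vec2[OF borel_compact[OF T]] by (simp add: borel_closed)
  qed
  finally show "emeasure lebesgue {y \<in> S. (p y, q y) \<in> T} \<le> ennreal (1 / \<delta>) * emeasure lborel T"
    unfolding P_def .
  show "compact {y \<in> S. (p y, q y) \<in> T}" using cP unfolding P_def .
qed

section \<open>Linearisation and local control\<close>

lemma norm_coord_vec [simp]: "norm (coord_vec i) = 1"
  by (simp add: coord_vec_def norm_Pair norm_axis_1)

lemma differentiable_imp_has_derivative_partials:
  assumes "f differentiable (at z)"
  shows "(f has_derivative (\<lambda>h. partial 1 f z * fst h $ 1 + partial 2 f z * fst h $ 2
    + partial 3 f z * snd h $ 1 + partial 4 f z * snd h $ 2)) (at z)"
proof -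
  let ?D = "frechet_derivative f (at z)"
  have D: "(f has_derivative ?D) (at z)" using assms frechet_derivative_works by blast
  interpret linear ?D by (rule has_derivative_linear[OF D])
  have "?D h = partial 1 f z * fst h $ 1 + partial 2 f z * fst h $ 2
      + partial 3 f z * snd h $ 1 + partial 4 f z * snd h $ 2" for h
  proof -
    have "h = fst h $ 1 *\<^sub>R coord_vec 1 + fst h $ 2 *\<^sub>R coord_vec 2
        + snd h $ 1 *\<^sub>R coord_vec 3 + snd h $ 2 *\<^sub>R coord_vec 4"
      by (cases h) (auto simp: coord_vec_def vec_eq_iff forall_2 axis_def)
    then have "?D h = ?D (fst h $ 1 *\<^sub>R coord_vec 1 + fst h $ 2 *\<^sub>R coord_vec 2
        + snd h $ 1 *\<^sub>R coord_vec 3 + snd h $ 2 *\<^sub>R coord_vec 4)" by (rule arg_cong)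
    then show ?thesis by (simp add: add scale partial_def mult.commute)
  qed
  then have "?D = (\<lambda>h. partial 1 f z * fst h $ 1 + partial 2 f z * fst h $ 2
      + partial 3 f z * snd h $ 1 + partial 4 f z * snd h $ 2)" by (rule ext)
  with D show ?thesis by (rule subst[rotated])
qed

lemma has_derivative_slice_snd:
  assumes "f differentiable (at (x, y))"
  shows "((\<lambda>y. f (x, y)) has_derivative (\<lambda>h. partial 3 f (x, y) * h $ 1 + partial 4 f (x, y) * h $ 2)) (at y)"
proof -
  have "((\<lambda>y. (x, y)) has_derivative (\<lambda>h. (0, h))) (at y)" by (auto intro!: derivative_eq_intros)
  from has_derivative_compose[OF this differentiable_imp_has_derivative_partials[OF assms]]
  show ?thesis by simp
qed

lemma has_derivative_slice_fst:
  assumes "f differentiable (at (x, y))"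
  shows "((\<lambda>x. f (x, y)) has_derivative (\<lambda>h. partial 1 f (x, y) * h $ 1 + partial 2 f (x, y) * h $ 2)) (at x)"
proof -
  have "((\<lambda>x. (x, y)) has_derivative (\<lambda>h. (h, 0))) (at x)" by (auto intro!: derivative_eq_intros)
  from has_derivative_compose[OF this differentiable_imp_has_derivative_partials[OF assms]]
  show ?thesis by simp
qed

lemma frechet_derivative_coord_vec:
  assumes "f differentiable (at w)"
  shows "frechet_derivative f (at w) (s *\<^sub>R coord_vec i) = s * partial i f w"
  using linear_frechet_derivative[OF assms] by (simp add: partial_def linear_cmul)

text \<open>The mean value theorem is used twice: in direction i for the increment of G in direction
  j, then in direction j for \<open>partial i G\<close>. The total displacement is at most
  \<open>2 * s\<close>, so the intermediate point stays in the ball.\<close>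

lemma second_difference_mvt:
  fixes G :: "(real^2) \<times> (real^2) \<Rightarrow> real"
  assumes B: "ball z r \<subseteq> U" and "open U"
    and G: "G differentiable_on U" "partial i G differentiable_on U"
    and s: "0 < s" "2 * s < r"
  shows "\<exists>w\<in>ball z r. G (z + s *\<^sub>R coord_vec i + s *\<^sub>R coord_vec j) - G (z + s *\<^sub>R coord_vec i)
    - G (z + s *\<^sub>R coord_vec j) + G z = s\<^sup>2 * partial j (partial i G) w"
proof -
  let ?u = "coord_vec i" and ?v = "coord_vec j"
  have diff: "f differentiable (at w)" if "f differentiable_on U" "w \<in> ball z r" for f :: "(real^2) \<times> (real^2) \<Rightarrow> real" and w
    using that B \<open>open U\<close> by (meson differentiable_on_eq_differentiable_at subsetD)
  have in_ball: "z + h + k \<in> ball z r" if "norm h \<le> s" "norm k \<le> s" for h k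
  proof -
    have "dist z (z + h + k) \<le> norm h + norm k"
      using norm_triangle_ineq4[of "- h" k] by (simp add: dist_norm)
    then show ?thesis using that s by simp
  qed
  have seg: "\<exists>h. w = a + h \<and> norm h \<le> s" if w: "w \<in> closed_segment a (a + s *\<^sub>R coord_vec k)" for w a k
  proof -
    obtain t where t: "0 \<le> t" "t \<le> 1" "w = (1 - t) *\<^sub>R a + t *\<^sub>R (a + s *\<^sub>R coord_vec k)"
      using w unfolding closed_segment_def by blast
    then have "w = a + (t * s) *\<^sub>R coord_vec k" by (simp add: algebra_simps)
    moreover have "norm ((t * s) *\<^sub>R coord_vec k) \<le> s"
      using t s by (simp add: mult_le_cancel_right1)
    ultimately show ?thesis by blast
  qed
  let ?g = "\<lambda>w. G (w + s *\<^sub>R ?v) - G w"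
  have "\<exists>w\<in>closed_segment z (z + s *\<^sub>R ?u). ?g (z + s *\<^sub>R ?u) - ?g z =
      frechet_derivative G (at (w + s *\<^sub>R ?v)) (z + s *\<^sub>R ?u - z) - frechet_derivative G (at w) (z + s *\<^sub>R ?u - z)"
  proof (rule mvt_segment)
    fix w assume "w \<in> closed_segment z (z + s *\<^sub>R ?u)"
    then obtain h where h: "w = z + h" "norm h \<le> s" using seg by blast
    have d1: "(G has_derivative frechet_derivative G (at (w + s *\<^sub>R ?v))) (at (w + s *\<^sub>R ?v))"
      using diff[OF G(1) in_ball[OF h(2), of "s *\<^sub>R ?v"]] s h(1) by (simp flip: frechet_derivative_works)
    have d2: "(G has_derivative frechet_derivative G (at w)) (at w)"
      using diff[OF G(1) in_ball[OF h(2), of 0]] s h(1) by (simp flip: frechet_derivative_works)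
    have "((\<lambda>w. w + s *\<^sub>R ?v) has_derivative (\<lambda>h. h)) (at w)" by (auto intro!: derivative_eq_intros)
    from has_derivative_diff[OF has_derivative_compose[OF this d1] d2]
    show "(?g has_derivative (\<lambda>h. frechet_derivative G (at (w + s *\<^sub>R ?v)) h - frechet_derivative G (at w) h)) (at w)" .
  qed
  then obtain w where w: "w \<in> closed_segment z (z + s *\<^sub>R ?u)" "?g (z + s *\<^sub>R ?u) - ?g z =
      frechet_derivative G (at (w + s *\<^sub>R ?v)) (s *\<^sub>R ?u) - frechet_derivative G (at w) (s *\<^sub>R ?u)" by auto
  obtain h where h: "w = z + h" "norm h \<le> s" using seg w(1) by blast
  have g: "?g (z + s *\<^sub>R ?u) - ?g z = s * (partial i G (w + s *\<^sub>R ?v) - partial i G w)"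
    using w(2) frechet_derivative_coord_vec[OF diff[OF G(1) in_ball[OF h(2), of "s *\<^sub>R ?v"]], of s i]
      frechet_derivative_coord_vec[OF diff[OF G(1) in_ball[OF h(2), of 0]], of s i] s h(1)
    by (simp add: algebra_simps)
  have "\<exists>w'\<in>closed_segment w (w + s *\<^sub>R ?v). partial i G (w + s *\<^sub>R ?v) - partial i G w =
      frechet_derivative (partial i G) (at w') (w + s *\<^sub>R ?v - w)"
  proof (rule mvt_segment)
    fix w' assume "w' \<in> closed_segment w (w + s *\<^sub>R ?v)"
    then obtain k where "w' = w + k" "norm k \<le> s" using seg by blast
    then show "(partial i G has_derivative frechet_derivative (partial i G) (at w')) (at w')"
      using diff[OF G(2) in_ball[OF h(2)], of k] h(1) by (simp flip: frechet_derivative_works)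
  qed
  then obtain w' where w': "w' \<in> closed_segment w (w + s *\<^sub>R ?v)" "partial i G (w + s *\<^sub>R ?v) - partial i G w =
      frechet_derivative (partial i G) (at w') (s *\<^sub>R ?v)" by auto
  obtain k where k: "w' = w + k" "norm k \<le> s" using seg w'(1) by blast
  have w'B: "w' \<in> ball z r" using in_ball[OF h(2) k(2)] h(1) k(1) by simp
  have "partial i G (w + s *\<^sub>R ?v) - partial i G w = s * partial j (partial i G) w'"
    using w'(2) frechet_derivative_coord_vec[OF diff[OF G(2) w'B]] by simp
  then show ?thesis using g w'B by (intro bexI[of _ w']) (simp_all add: power2_eq_square algebra_simps)
qed

text \<open>The second difference of G is symmetric in i and j, so values of the two mixed partials
  agree at points arbitrarily near z, and continuity concludes. The determinant hypothesis
  differentiates in y first, the chart below in x first.\<close>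

lemma mixed_partials_commute:
  fixes G :: "(real^2) \<times> (real^2) \<Rightarrow> real"
  assumes "open U" "z \<in> U" "G differentiable_on U"
    and i: "partial i G differentiable_on U" "continuous_on U (partial j (partial i G))"
    and j: "partial j G differentiable_on U" "continuous_on U (partial i (partial j G))"
  shows "partial j (partial i G) z = partial i (partial j G) z"
proof (rule ccontr)
  let ?P = "partial j (partial i G)" and ?Q = "partial i (partial j G)"
  assume "?P z \<noteq> ?Q z"
  define e where "e = \<bar>?P z - ?Q z\<bar> / 2"
  have e: "0 < e" using \<open>?P z \<noteq> ?Q z\<close> by (simp add: e_def)
  have "isCont ?P z" "isCont ?Q z"
    using i(2) j(2) assms(1,2) by (simp_all add: continuous_on_eq_continuous_at)
  then obtain r1 r2 where r: "0 < r1" "\<And>w. dist w z < r1 \<Longrightarrow> dist (?P w) (?P z) < e"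
      "0 < r2" "\<And>w. dist w z < r2 \<Longrightarrow> dist (?Q w) (?Q z) < e"
    unfolding continuous_at_eps_delta using e by metis
  obtain r3 where r3: "0 < r3" "ball z r3 \<subseteq> U" using assms(1,2) by (meson open_contains_ball)
  define r where "r = min r1 (min r2 r3)"
  have r0: "0 < r" "ball z r \<subseteq> U" using r r3 by (auto simp: r_def)
  define s where "s = r / 4"
  have s: "0 < s" "2 * s < r" using r0 by (auto simp: s_def)
  obtain w where w: "w \<in> ball z r" "G (z + s *\<^sub>R coord_vec i + s *\<^sub>R coord_vec j) - G (z + s *\<^sub>R coord_vec i)
    - G (z + s *\<^sub>R coord_vec j) + G z = s\<^sup>2 * ?P w"
    using second_difference_mvt[OF r0(2) assms(1,3) i(1) s] by blast
  obtain w' where w': "w' \<in> ball z r" "G (z + s *\<^sub>R coord_vec j + s *\<^sub>R coord_vec i) - G (z + s *\<^sub>R coord_vec j)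
    - G (z + s *\<^sub>R coord_vec i) + G z = s\<^sup>2 * ?Q w'"
    using second_difference_mvt[OF r0(2) assms(1,3) j(1) s] by blast
  have "z + s *\<^sub>R coord_vec j + s *\<^sub>R coord_vec i = z + s *\<^sub>R coord_vec i + s *\<^sub>R coord_vec j"
    by (simp add: algebra_simps)
  from w'(2)[unfolded this] have "s\<^sup>2 * ?P w = s\<^sup>2 * ?Q w'" using w(2) by linarith
  then have eq: "?P w = ?Q w'" using s by simp
  have "\<bar>?P w - ?P z\<bar> < e" "\<bar>?Q w' - ?Q z\<bar> < e"
    using r(2)[of w] r(4)[of w'] w(1) w'(1) by (auto simp: r_def dist_commute dist_real_def)
  then have "?P z - ?Q z < 2 * e" "- (?P z - ?Q z) < 2 * e"
    unfolding eq abs_less_iff by linarith+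
  then have "\<bar>?P z - ?Q z\<bar> < 2 * e" by (simp only: abs_less_iff)
  then show False by (simp add: e_def)
qed

text \<open>The mean value theorem evaluates the two first partials at an intermediate point. Each
  has moved by at most \<open>2 * B\<close> times the displacement, one \<open>B\<close> per
  coordinate, which gives the constant 4.\<close>

lemma taylor_fst:
  fixes G :: "(real^2) \<times> (real^2) \<Rightarrow> real"
  assumes G: "\<And>w. w \<in> closed_segment x x' \<Longrightarrow> G differentiable (at (w, y))"
      "\<And>w i. i \<in> {1, 2} \<Longrightarrow> w \<in> closed_segment x x' \<Longrightarrow> partial i G differentiable (at (w, y))"
    and B: "\<And>w i j. i \<in> {1, 2} \<Longrightarrow> j \<in> {1, 2} \<Longrightarrow> w \<in> closed_segment x x' \<Longrightarrow>
      \<bar>partial j (partial i G) (w, y)\<bar> \<le> B"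
  shows "\<bar>G (x', y) - G (x, y) - (partial 1 G (x, y) * (x' - x) $ 1 + partial 2 G (x, y) * (x' - x) $ 2)\<bar>
    \<le> 4 * B * (norm (x' - x))\<^sup>2"
proof -
  let ?h = "x' - x"
  have B0: "0 \<le> B" using B[of 1 1 x] by auto
  have "\<exists>w\<in>closed_segment x x'. G (x', y) - G (x, y) = partial 1 G (w, y) * ?h $ 1 + partial 2 G (w, y) * ?h $ 2"
    by (rule mvt_segment) (intro has_derivative_slice_fst G)
  then obtain w where w: "w \<in> closed_segment x x'"
      "G (x', y) - G (x, y) = partial 1 G (w, y) * ?h $ 1 + partial 2 G (w, y) * ?h $ 2" by blast
  have sub: "closed_segment x w \<subseteq> closed_segment x x'" using w(1) by (simp add: subset_closed_segment)
  have wx: "norm (w - x) \<le> norm ?h" using segment_bound(1)[OF w(1)] by simp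
  have p: "\<bar>partial i G (w, y) - partial i G (x, y)\<bar> \<le> 2 * B * norm ?h" if i: "i \<in> {1, 2}" for i
  proof -
    have "\<exists>v\<in>closed_segment x w. partial i G (w, y) - partial i G (x, y)
        = partial 1 (partial i G) (v, y) * (w - x) $ 1 + partial 2 (partial i G) (v, y) * (w - x) $ 2"
      by (rule mvt_segment) (use sub i in \<open>intro has_derivative_slice_fst G; blast\<close>)
    then obtain v where v: "v \<in> closed_segment x x'" "partial i G (w, y) - partial i G (x, y)
        = partial 1 (partial i G) (v, y) * (w - x) $ 1 + partial 2 (partial i G) (v, y) * (w - x) $ 2"
      using sub by blast
    have "\<bar>partial k (partial i G) (v, y) * (w - x) $ l\<bar> \<le> B * norm ?h" if "k \<in> {1, 2}" for k l
      unfolding abs_mult using B[OF i that v(1)] component_le_norm_cart[of "w - x" l] wx B0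
      by (intro mult_mono) auto
    from this[of 1 1] this[of 2 2] show ?thesis unfolding v(2) by (simp add: abs_le_iff)
  qed
  have "\<bar>(partial i G (w, y) - partial i G (x, y)) * ?h $ l\<bar> \<le> (2 * B * norm ?h) * norm ?h" if "i \<in> {1, 2}" for i l
    unfolding abs_mult using p[OF that] component_le_norm_cart[of ?h l] B0 by (intro mult_mono) auto
  from this[of 1 1] this[of 2 2] show ?thesis
    unfolding w(2) by (simp add: abs_le_iff power2_eq_square algebra_simps)
qed

lemma has_derivative_quotient2:
  fixes f g :: "real^2 \<Rightarrow> real"
  assumes f: "(f has_derivative (\<lambda>h. f1 * h $ 1 + f2 * h $ 2)) (at y)"
    and g: "(g has_derivative (\<lambda>h. g1 * h $ 1 + g2 * h $ 2)) (at y)" and "g y \<noteq> 0"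
  shows "((\<lambda>y. f y / g y) has_derivative
    (\<lambda>h. (f1 * g y - f y * g1) / (g y)\<^sup>2 * h $ 1 + (f2 * g y - f y * g2) / (g y)\<^sup>2 * h $ 2)) (at y)"
proof -
  have "((f1 * h $ 1 + f2 * h $ 2) * g y - f y * (g1 * h $ 1 + g2 * h $ 2)) / (g y * g y)
    = (f1 * g y - f y * g1) / (g y)\<^sup>2 * h $ 1 + (f2 * g y - f y * g2) / (g y)\<^sup>2 * h $ 2" for h :: "real^2"
    using \<open>g y \<noteq> 0\<close> by (simp add: field_simps power2_eq_square)
  with has_derivative_divide'[OF f g \<open>g y \<noteq> 0\<close>] show ?thesis by simp
qed

lemma C2_onD:
  assumes "C2_on U G" "open U"
  shows "G differentiable_on U"
    and "i \<in> {1..4} \<Longrightarrow> partial i G differentiable_on U"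
    and "z \<in> U \<Longrightarrow> G differentiable (at z)"
    and "i \<in> {1..4} \<Longrightarrow> z \<in> U \<Longrightarrow> partial i G differentiable (at z)"
    and "i \<in> {1..4} \<Longrightarrow> continuous_on U (partial i G)"
    and "i \<in> {1..4} \<Longrightarrow> j \<in> {1..4} \<Longrightarrow> continuous_on U (partial j (partial i G))"
  using assms unfolding C2_on_def C1_on_def
  by (blast intro: differentiable_on_eq_differentiable_at[THEN iffD1, rule_format])+

text \<open>The constants serve all small compact sets F at once. W is arbitrary, so the points y
  need not form a measurable set; asking for a measurable cover makes the property pass to subsets
  and finite unions of W, and thus from local neighbourhoods to the compact set V.\<close>

definition favard_controlled :: "((real^2) \<times> (real^2) \<Rightarrow> real) \<Rightarrow> ((real^2) \<times> (real^2)) set \<Rightarrow> bool" where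
  "favard_controlled G W \<longleftrightarrow> (\<exists>d0>0. \<exists>C\<ge>0. \<exists>K\<ge>0. \<forall>F xQ d. compact F \<longrightarrow> 0 < d \<longrightarrow> d \<le> d0 \<longrightarrow> F \<subseteq> cball xQ d \<longrightarrow>
     (\<exists>S\<in>sets lebesgue. {y. \<exists>x\<in>F. (x, y) \<in> W \<and> G (x, y) = 0} \<subseteq> S \<and>
        emeasure lebesgue S \<le> ennreal C * Fav (nbhd (K * d\<^sup>2) F)))"

text \<open>For \<open>x\<close> near a fixed \<open>x\<^sub>Q\<close>, Taylor expansion in \<open>x\<close> turns \<open>G (x, y) = 0\<close> into
  \<open>q y = u\<^sub>a + p y * u\<^sub>c\<close> up to a quadratic error, where \<open>u = x - x\<^sub>Q\<close> and \<open>p\<close>, \<open>q\<close> are the quotients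
  \<open>G\<^sub>k / G\<^sub>i\<close> and \<open>- G / G\<^sub>i\<close> at \<open>(x\<^sub>Q, y)\<close>. The error is absorbed by a neighbourhood of \<open>F\<close>, and the
  determinant condition makes \<open>(p, q)\<close> a chart in \<open>y\<close>.\<close>

lemma local_favard_control:
  fixes G :: "(real^2) \<times> (real^2) \<Rightarrow> real"
  assumes U: "open U" "z0 \<in> U" and G: "C2_on U G"
    and B: "\<And>i j z. i \<in> {1..4} \<Longrightarrow> j \<in> {1..4} \<Longrightarrow> z \<in> U \<Longrightarrow> \<bar>partial j (partial i G) z\<bar> \<le> B"
    and ac: "(a :: 2, c :: 2, i, k) = (1, 2, 1, 2) \<or> (a, c, i, k) = (2, 1, 2, 1)"
    and z0: "G z0 = 0" "partial i G z0 \<noteq> 0"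
    and jac0: "(partial 3 (partial k G) z0 * partial i G z0 - partial k G z0 * partial 3 (partial i G) z0) * partial 4 G z0
      \<noteq> (partial 4 (partial k G) z0 * partial i G z0 - partial k G z0 * partial 4 (partial i G) z0) * partial 3 G z0"
  shows "\<exists>W. open W \<and> z0 \<in> W \<and> favard_controlled G W"
proof -
  have ik: "i \<in> {1..4}" "k \<in> {1..4}" "i \<in> {1, 2}" "k \<in> {1, 2}" using ac by auto
  note C2 = C2_onD[OF G U(1)]
  let ?Gi = "partial i G" and ?Gk = "partial k G"
  define D where "D = {z \<in> U. ?Gi z \<noteq> 0}"
  have D: "open D" "z0 \<in> D" "D \<subseteq> U"
    unfolding D_def using U z0 continuous_open_preimage[OF C2(5)[OF ik(1)] U(1), of "- {0}"]
    by (auto simp: vimage_def Int_def)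
  define p where "p z = ?Gk z / ?Gi z" for z
  define q where "q z = - G z / ?Gi z" for z
  define pj where "pj j z = (partial j ?Gk z * ?Gi z - ?Gk z * partial j ?Gi z) / (?Gi z)\<^sup>2" for j :: nat and z
  define qj where "qj j z = (- partial j G z * ?Gi z - (- G z) * partial j ?Gi z) / (?Gi z)\<^sup>2" for j :: nat and z
  \<comment> \<open>The two rows of the Jacobian are taken at independent points, as the injectivity
    argument for the chart requires.\<close>
  define J where "J w = pj 3 (fst w) * qj 4 (snd w) - pj 4 (fst w) * qj 3 (snd w)" for w
  have Gcont: "continuous_on D G"
    using differentiable_imp_continuous_on[OF C2(1)] D(3) by (rule continuous_on_subset)
  have c1: "continuous_on D (partial j G)" if "j \<in> {1..4}" for j
    using C2(5)[OF that] D(3) by (rule continuous_on_subset)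
  have c2: "continuous_on D (partial j (partial l G))" if "l \<in> {1..4}" "j \<in> {1..4}" for j l
    using C2(6)[OF that] D(3) by (rule continuous_on_subset)
  have Gi0: "\<forall>z\<in>D. ?Gi z \<noteq> 0" "\<forall>z\<in>D. (?Gi z)\<^sup>2 \<noteq> 0" by (auto simp: D_def)
  have cp: "continuous_on D p"
    unfolding p_def by (intro continuous_intros c1 ik Gi0)
  have cpj: "continuous_on D (pj j)" if "j \<in> {3, 4}" for j
    unfolding pj_def using that by (intro continuous_intros c1 c2 ik Gi0) auto
  have cqj: "continuous_on D (qj j)" if "j \<in> {3, 4}" for j
    unfolding qj_def using that by (intro continuous_intros Gcont c1 c2 ik Gi0) auto
  have cf: "continuous_on (D \<times> D) (\<lambda>w. f (fst w))" "continuous_on (D \<times> D) (\<lambda>w. f (snd w))"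
    if "continuous_on D f" for f :: "(real^2) \<times> (real^2) \<Rightarrow> real"
    by (rule continuous_on_compose2[OF that]; auto intro: continuous_intros)+
  have "continuous_on (D \<times> D) J"
    unfolding J_def by (intro continuous_intros cf cpj cqj) auto
  then have J_cont: "isCont J (z0, z0)"
    using D by (simp add: continuous_on_eq_continuous_at open_Times)
  \<comment> \<open>Since G vanishes at \<open>z0\<close>, the derivatives of q reduce to
    \<open>- partial j G z0 / ?Gi z0\<close>; what remains is minus the difference in the hypothesis
    \<open>jac0\<close>, divided by the cube of \<open>?Gi z0\<close>.\<close>
  have "J (z0, z0) * (?Gi z0)^3 =
     - ((partial 3 ?Gk z0 * ?Gi z0 - ?Gk z0 * partial 3 ?Gi z0) * partial 4 G z0
      - (partial 4 ?Gk z0 * ?Gi z0 - ?Gk z0 * partial 4 ?Gi z0) * partial 3 G z0)"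
    unfolding J_def pj_def qj_def using z0
    by (simp add: power2_eq_square power3_eq_cube divide_simps)
  then have J0: "J (z0, z0) \<noteq> 0" using jac0 by auto
  define \<delta> where "\<delta> = \<bar>J (z0, z0)\<bar> / 2"
  have \<delta>: "0 < \<delta>" using J0 by (simp add: \<delta>_def)
  obtain r1 where r1: "0 < r1" "\<And>w. dist w (z0, z0) < r1 \<Longrightarrow> dist (J w) (J (z0, z0)) < \<delta>"
    using J_cont \<delta> unfolding continuous_at_eps_delta by metis
  define \<eta> where "\<eta> = \<bar>?Gi z0\<bar> / 2"
  have \<eta>: "0 < \<eta>" using z0 by (simp add: \<eta>_def)
  have "isCont ?Gi z0" "isCont p z0"
    using D cp c1[OF ik(1)] by (simp_all add: continuous_on_eq_continuous_at)
  then obtain r2 r3 where r23: "0 < r2" "\<And>w. dist w z0 < r2 \<Longrightarrow> dist (?Gi w) (?Gi z0) < \<eta>"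
      "0 < r3" "\<And>w. dist w z0 < r3 \<Longrightarrow> dist (p w) (p z0) < 1"
    unfolding continuous_at_eps_delta using \<eta> by (metis zero_less_one)
  obtain r4 where r4: "0 < r4" "ball z0 r4 \<subseteq> D" using D by (meson open_contains_ball)
  \<comment> \<open>Half of \<open>r1\<close>, because J depends on two points, each at distance
    less than r from \<open>z0\<close>.\<close>
  define r where "r = min (min (r1 / 2) r2) (min r3 r4)"
  have r: "0 < r" using r1 r23 r4 by (simp add: r_def)
  have rD: "z \<in> D" if "dist z z0 < r" for z
    using that r4(2) by (auto simp: r_def dist_commute)
  have r\<eta>: "\<eta> \<le> \<bar>?Gi z\<bar>" if "dist z z0 < r" for z
  proof -
    have "\<bar>?Gi z - ?Gi z0\<bar> < \<eta>" using r23(2)[of z] that by (simp add: r_def dist_real_def)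
    moreover have "\<bar>?Gi z0\<bar> = 2 * \<eta>" by (simp add: \<eta>_def)
    ultimately show ?thesis by linarith
  qed
  define M where "M = \<bar>p z0\<bar> + 1"
  have rM: "\<bar>p z\<bar> \<le> M" if "dist z z0 < r" for z
  proof -
    have "\<bar>p z - p z0\<bar> < 1" using r23(4)[of z] that by (simp add: r_def dist_real_def)
    then show ?thesis unfolding M_def by linarith
  qed
  have rJ: "\<delta> \<le> \<bar>J (z, z')\<bar>" if "dist z z0 < r" "dist z' z0 < r" for z z'
  proof -
    have "dist (z, z') (z0, z0) \<le> dist z z0 + dist z' z0"
      by (simp add: dist_Pair_Pair sqrt_sum_squares_le_sum)
    also have "\<dots> < r1" using that by (simp add: r_def)
    finally have "\<bar>J (z, z') - J (z0, z0)\<bar> < \<delta>" using r1(2) by (simp add: dist_real_def)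
    moreover have "\<bar>J (z0, z0)\<bar> = 2 * \<delta>" by (simp add: \<delta>_def)
    ultimately show ?thesis by linarith
  qed
  obtain x0 y0 where xy0: "z0 = (x0, y0)" by (cases z0)
  define \<rho> where "\<rho> = r / 3"
  have \<rho>: "0 < \<rho>" using r by (simp add: \<rho>_def)
  have box: "dist (x, y) z0 < r" if "x \<in> cball x0 \<rho>" "y \<in> cball y0 \<rho>" for x y
  proof -
    have "dist (x, y) z0 \<le> dist x x0 + dist y y0"
      unfolding xy0 by (simp add: dist_Pair_Pair sqrt_sum_squares_le_sum)
    also have "\<dots> < r" using that r by (simp add: \<rho>_def dist_commute)
    finally show ?thesis .
  qed
  \<comment> \<open>The x-factor has half the radius: if F meets it and
    \<open>d \<le> \<rho> / 4\<close>, then \<open>xQ\<close> and all of F stay within distance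
    \<rho> of \<open>x0\<close>.\<close>
  define W where "W = ball x0 (\<rho> / 2) \<times> ball y0 \<rho>"
  have W: "open W" "z0 \<in> W" unfolding W_def xy0 using \<rho> by (auto intro: open_Times)
  \<comment> \<open>The Taylor constant divided by the lower bound \<eta> for the denominator
    \<open>?Gi\<close>.\<close>
  define K where "K = 4 * B / \<eta>"
  have "0 \<le> B" using B[OF ik(1) ik(1) U(2)] by linarith
  then have K: "0 \<le> K" using \<eta> by (simp add: K_def)
  define C where "C = 1 / \<delta> * (2 / cos (arctan M) ^ 3)"
  have cosM: "0 < cos (arctan M)" by (simp add: cos_arctan add_pos_nonneg)
  have C: "0 \<le> C" unfolding C_def using \<delta> cosM by simp
  have M0: "0 \<le> M" by (simp add: M_def)
  have "\<exists>S\<in>sets lebesgue. {y. \<exists>x\<in>F. (x, y) \<in> W \<and> G (x, y) = 0} \<subseteq> S \<and>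
        emeasure lebesgue S \<le> ennreal C * Fav (nbhd (K * d\<^sup>2) F)"
    if F: "compact F" and d: "0 < d" "d \<le> \<rho> / 4" and FQ: "F \<subseteq> cball xQ d" for F xQ d
  proof (cases "\<exists>x\<in>F. dist x x0 < \<rho> / 2")
    case False
    then have "{y. \<exists>x\<in>F. (x, y) \<in> W \<and> G (x, y) = 0} \<subseteq> {}"
      by (auto simp: W_def dist_commute)
    then show ?thesis by (intro bexI[of _ "{}"]) auto
  next
    case True
    then obtain x1 where x1: "x1 \<in> F" "dist x1 x0 < \<rho> / 2" by blast
    have xQ1: "dist xQ x1 \<le> d" using FQ x1(1) by auto
    have "dist x0 xQ \<le> \<rho>" using xQ1 x1(2) d dist_triangle[of x0 xQ x1] by (simp add: dist_commute)
    then have xQ: "xQ \<in> cball x0 \<rho>" by simp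
    have Fx0: "x \<in> cball x0 \<rho>" if "x \<in> F" for x
    proof -
      have "dist xQ x \<le> d" using FQ that by auto
      then show ?thesis
        using xQ1 x1(2) d dist_triangle[of x0 x xQ] dist_triangle[of x0 xQ x1] by (simp add: dist_commute)
    qed
    define F' where "F' = (\<lambda>v. 1 *\<^sub>R v + - xQ) ` nbhd (K * d\<^sup>2) F"
    have cN: "compact (nbhd (K * d\<^sup>2) F)" by (rule compact_nbhd[OF F])
    have cF': "compact F'"
      unfolding F'_def by (intro compact_continuous_image continuous_intros cN)
    let ?T = "slope_graph a c M F'"
    have cT: "compact ?T" by (rule compact_slope_graph[OF cF'])
    define S where "S = {y \<in> cball y0 \<rho>. (p (xQ, y), q (xQ, y)) \<in> ?T}"
    have inD: "(xQ, y) \<in> D" if "y \<in> cball y0 \<rho>" for y by (rule rD[OF box[OF xQ that]])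
    have inU: "(xQ, y) \<in> U" if "y \<in> cball y0 \<rho>" for y using inD[OF that] D(3) by blast
    have dp: "((\<lambda>y. p (xQ, y)) has_derivative (\<lambda>h. pj 3 (xQ, y) * h $ 1 + pj 4 (xQ, y) * h $ 2)) (at y)"
      if y: "y \<in> cball y0 \<rho>" for y
      unfolding p_def pj_def
      by (rule has_derivative_quotient2[OF has_derivative_slice_snd[OF C2(4)[OF ik(2) inU[OF y]]]
            has_derivative_slice_snd[OF C2(4)[OF ik(1) inU[OF y]]]])
        (use inD[OF y] in \<open>simp add: D_def\<close>)
    have dq: "((\<lambda>y. q (xQ, y)) has_derivative (\<lambda>h. qj 3 (xQ, y) * h $ 1 + qj 4 (xQ, y) * h $ 2)) (at y)"
      if y: "y \<in> cball y0 \<rho>" for y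
    proof -
      have "((\<lambda>y. - G (xQ, y)) has_derivative
          (\<lambda>h. - partial 3 G (xQ, y) * h $ 1 + - partial 4 G (xQ, y) * h $ 2)) (at y)"
        using has_derivative_minus[OF has_derivative_slice_snd[OF C2(3)[OF inU[OF y]]]] by simp
      then show ?thesis
        unfolding q_def qj_def
        by (rule has_derivative_quotient2[OF _ has_derivative_slice_snd[OF C2(4)[OF ik(1) inU[OF y]]]])
          (use inD[OF y] in \<open>simp add: D_def\<close>)
    qed
    have jac: "\<delta> \<le> \<bar>pj 3 (xQ, y) * qj 4 (xQ, y') - pj 4 (xQ, y) * qj 3 (xQ, y')\<bar>"
      if "y \<in> cball y0 \<rho>" "y' \<in> cball y0 \<rho>" for y y'
      using rJ[OF box[OF xQ that(1)] box[OF xQ that(2)]] by (simp add: J_def)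
    have chart: "compact S" "emeasure lebesgue S \<le> ennreal (1 / \<delta>) * emeasure lborel ?T"
      unfolding S_def by (rule emeasure_chart_preimage_le[OF convex_cball compact_cball dp dq \<delta> jac cT]; assumption)+
    have "emeasure lebesgue S \<le> ennreal (1 / \<delta>) * emeasure lborel ?T" by (rule chart(2))
    also have "\<dots> \<le> ennreal (1 / \<delta>) * (ennreal (2 / cos (arctan M) ^ 3) * Fav F')"
      by (intro mult_left_mono emeasure_slope_graph_le cF' M0) (use ac in auto)
    also have "\<dots> = ennreal C * Fav F'"
      unfolding C_def using \<delta> cosM by (subst ennreal_mult) (auto simp: mult.assoc)
    also have "Fav F' = Fav (nbhd (K * d\<^sup>2) F)"
      unfolding F'_def using Fav_affine[of 1, OF _ cN, of "- xQ"] by simp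
    finally have "emeasure lebesgue S \<le> ennreal C * Fav (nbhd (K * d\<^sup>2) F)" .
    moreover have "S \<in> sets lebesgue" using chart(1) by (intro fmeasurableD lmeasurable_compact)
    moreover have "{y. \<exists>x\<in>F. (x, y) \<in> W \<and> G (x, y) = 0} \<subseteq> S"
    proof
      fix y assume "y \<in> {y. \<exists>x\<in>F. (x, y) \<in> W \<and> G (x, y) = 0}"
      then obtain x where x: "x \<in> F" "(x, y) \<in> W" "G (x, y) = 0" by blast
      have y: "y \<in> cball y0 \<rho>" using x(2) by (auto simp: W_def)
      let ?u = "x - xQ" and ?z = "(xQ, y)"
      have seg: "closed_segment xQ x \<subseteq> cball x0 \<rho>"
        by (intro closed_segment_subset xQ Fx0 x convex_cball)
      have segU: "(w, y) \<in> U" if "w \<in> closed_segment xQ x" for w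
        using rD[OF box[OF subsetD[OF seg that] y]] D(3) by blast
      have "\<bar>G (x, y) - G ?z - (partial 1 G ?z * ?u $ 1 + partial 2 G ?z * ?u $ 2)\<bar> \<le> 4 * B * (norm ?u)\<^sup>2"
        by (rule taylor_fst) (intro C2 B segU; auto)+
      also have "norm ?u \<le> d" using FQ x(1) by (auto simp: dist_norm norm_minus_commute)
      then have "4 * B * (norm ?u)\<^sup>2 \<le> 4 * B * d\<^sup>2"
        using \<open>0 \<le> B\<close> by (intro mult_left_mono power_mono) auto
      finally have taylor: "\<bar>- G ?z - ?Gi ?z * ?u $ a - ?Gk ?z * ?u $ c\<bar> \<le> 4 * B * d\<^sup>2"
        using ac x(3) by (auto simp: algebra_simps)
      \<comment> \<open>The Taylor remainder divided by \<open>?Gi\<close>. Moving x by \<epsilon>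
        along the a-th axis makes the linearised equation exact and leaves the c-th coordinate
        unchanged.\<close>
      define \<epsilon> where "\<epsilon> = (- G ?z - ?Gi ?z * ?u $ a - ?Gk ?z * ?u $ c) / ?Gi ?z"
      have z_near: "dist ?z z0 < r" by (rule box[OF xQ y])
      have Gi_z: "?Gi ?z \<noteq> 0" using r\<eta>[OF z_near] \<eta> by auto
      have "\<bar>\<epsilon>\<bar> \<le> 4 * B * d\<^sup>2 / \<eta>"
        unfolding \<epsilon>_def abs_divide using taylor r\<eta>[OF z_near] \<eta> \<open>0 \<le> B\<close> by (intro frac_le) auto
      then have \<epsilon>: "\<bar>\<epsilon>\<bar> \<le> K * d\<^sup>2" by (simp add: K_def)
      let ?v = "x + \<epsilon> *\<^sub>R axis a 1"
      have "dist x ?v = \<bar>\<epsilon>\<bar>" by (simp add: dist_norm norm_axis_1)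
      then have "?v \<in> nbhd (K * d\<^sup>2) F" using x(1) \<epsilon> unfolding mem_nbhd by (intro bexI[of _ x]) simp_all
      then have v: "?v - xQ \<in> F'" unfolding F'_def by (intro image_eqI[of _ _ ?v]) auto
      have "q ?z = (?v - xQ) $ a + p ?z * (?v - xQ) $ c"
        using ac Gi_z by (auto simp: q_def p_def \<epsilon>_def axis_def field_simps)
      moreover have "p ?z \<in> {- M..M}" using rM[OF z_near] by (simp add: abs_le_iff)
      ultimately have "(p ?z, q ?z) \<in> ?T"
        unfolding slope_graph_def using v by (intro image_eqI[of _ _ "(p ?z, ?v - xQ)"]) auto
      then show "y \<in> S" using y by (simp add: S_def)
    qed
    ultimately show ?thesis by blast
  qed
  then have "favard_controlled G W"
    unfolding favard_controlled_def
    by (intro exI[of _ "\<rho> / 4"] conjI exI[of _ C] exI[of _ K] C K allI impI) (use \<rho> in simp_all)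
  then show ?thesis using W by blast
qed

section \<open>From local to global control\<close>

lemma favard_controlledE:
  assumes "favard_controlled G W"
  obtains d0 C K where "0 < d0" "0 \<le> C" "0 \<le> K"
    "\<forall>F xQ d. compact F \<longrightarrow> 0 < d \<longrightarrow> d \<le> d0 \<longrightarrow> F \<subseteq> cball xQ d \<longrightarrow>
     (\<exists>S\<in>sets lebesgue. {y. \<exists>x\<in>F. (x, y) \<in> W \<and> G (x, y) = 0} \<subseteq> S \<and>
        emeasure lebesgue S \<le> ennreal C * Fav (nbhd (K * d\<^sup>2) F))"
  using assms unfolding favard_controlled_def by (elim exE conjE) (rule that)

lemma favard_controlled_mono:
  assumes "favard_controlled G W" "W' \<subseteq> W"
  shows "favard_controlled G W'"
proof -
  obtain d0 C K where 1: "0 < d0" "0 \<le> C" "0 \<le> K"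
    and c: "\<forall>F xQ d. compact F \<longrightarrow> 0 < d \<longrightarrow> d \<le> d0 \<longrightarrow> F \<subseteq> cball xQ d \<longrightarrow>
     (\<exists>S\<in>sets lebesgue. {y. \<exists>x\<in>F. (x, y) \<in> W \<and> G (x, y) = 0} \<subseteq> S \<and>
        emeasure lebesgue S \<le> ennreal C * Fav (nbhd (K * d\<^sup>2) F))"
    using assms(1) by (rule favard_controlledE)
  have sub: "{y. \<exists>x\<in>F. (x, y) \<in> W' \<and> G (x, y) = 0} \<subseteq> {y. \<exists>x\<in>F. (x, y) \<in> W \<and> G (x, y) = 0}" for F
    using assms(2) by blast
  show ?thesis
    unfolding favard_controlled_def
  proof (rule exI[of _ d0], rule conjI[OF 1(1)], rule exI[of _ C], rule conjI[OF 1(2)],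
      rule exI[of _ K], rule conjI[OF 1(3)], intro allI impI)
    fix F :: "(real^2) set" and xQ d
    assume "compact F" "0 < d" "d \<le> d0" "F \<subseteq> cball xQ d"
    then obtain S where "S \<in> sets lebesgue" "{y. \<exists>x\<in>F. (x, y) \<in> W \<and> G (x, y) = 0} \<subseteq> S"
        "emeasure lebesgue S \<le> ennreal C * Fav (nbhd (K * d\<^sup>2) F)"
      using c by meson
    then show "\<exists>S\<in>sets lebesgue. {y. \<exists>x\<in>F. (x, y) \<in> W' \<and> G (x, y) = 0} \<subseteq> S \<and>
        emeasure lebesgue S \<le> ennreal C * Fav (nbhd (K * d\<^sup>2) F)"
      using sub[of F] by (intro bexI[of _ S] conjI order_trans[OF sub[of F]])
  qed
qed

lemma favard_controlled_empty: "favard_controlled G {}"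
  unfolding favard_controlled_def by (intro exI[of _ 1] conjI exI[of _ 0] allI impI bexI[of _ "{}"]) auto

lemma favard_controlled_Un:
  assumes "favard_controlled G W1" "favard_controlled G W2"
  shows "favard_controlled G (W1 \<union> W2)"
proof -
  obtain d1 C1 K1 where 1: "0 < d1" "0 \<le> C1" "0 \<le> K1"
    and c1: "\<forall>F xQ d. compact F \<longrightarrow> 0 < d \<longrightarrow> d \<le> d1 \<longrightarrow> F \<subseteq> cball xQ d \<longrightarrow>
     (\<exists>S\<in>sets lebesgue. {y. \<exists>x\<in>F. (x, y) \<in> W1 \<and> G (x, y) = 0} \<subseteq> S \<and>
        emeasure lebesgue S \<le> ennreal C1 * Fav (nbhd (K1 * d\<^sup>2) F))"
    using assms(1) by (rule favard_controlledE)
  obtain d2 C2 K2 where 2: "0 < d2" "0 \<le> C2" "0 \<le> K2"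
    and c2: "\<forall>F xQ d. compact F \<longrightarrow> 0 < d \<longrightarrow> d \<le> d2 \<longrightarrow> F \<subseteq> cball xQ d \<longrightarrow>
     (\<exists>S\<in>sets lebesgue. {y. \<exists>x\<in>F. (x, y) \<in> W2 \<and> G (x, y) = 0} \<subseteq> S \<and>
        emeasure lebesgue S \<le> ennreal C2 * Fav (nbhd (K2 * d\<^sup>2) F))"
    using assms(2) by (rule favard_controlledE)
  define K where "K = max K1 K2"
  have "\<exists>S\<in>sets lebesgue. {y. \<exists>x\<in>F. (x, y) \<in> W1 \<union> W2 \<and> G (x, y) = 0} \<subseteq> S \<and>
        emeasure lebesgue S \<le> ennreal (C1 + C2) * Fav (nbhd (K * d\<^sup>2) F)"
    if F: "compact F" and d: "0 < d" "d \<le> min d1 d2" "F \<subseteq> cball xQ d" for F xQ d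
  proof -
    obtain S1 where S1: "S1 \<in> sets lebesgue" "{y. \<exists>x\<in>F. (x, y) \<in> W1 \<and> G (x, y) = 0} \<subseteq> S1"
        "emeasure lebesgue S1 \<le> ennreal C1 * Fav (nbhd (K1 * d\<^sup>2) F)"
      using c1 F d by (meson min.boundedE)
    obtain S2 where S2: "S2 \<in> sets lebesgue" "{y. \<exists>x\<in>F. (x, y) \<in> W2 \<and> G (x, y) = 0} \<subseteq> S2"
        "emeasure lebesgue S2 \<le> ennreal C2 * Fav (nbhd (K2 * d\<^sup>2) F)"
      using c2 F d by (meson min.boundedE)
    have K: "Fav (nbhd (K1 * d\<^sup>2) F) \<le> Fav (nbhd (K * d\<^sup>2) F)" "Fav (nbhd (K2 * d\<^sup>2) F) \<le> Fav (nbhd (K * d\<^sup>2) F)"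
      unfolding K_def by (intro Fav_mono nbhd_mono compact_nbhd F mult_right_mono; simp)+
    have "emeasure lebesgue (S1 \<union> S2) \<le> emeasure lebesgue S1 + emeasure lebesgue S2"
      by (intro emeasure_subadditive S1 S2)
    also have "\<dots> \<le> ennreal C1 * Fav (nbhd (K * d\<^sup>2) F) + ennreal C2 * Fav (nbhd (K * d\<^sup>2) F)"
      by (intro add_mono order_trans[OF S1(3)] order_trans[OF S2(3)] mult_left_mono K) auto
    also have "\<dots> = ennreal (C1 + C2) * Fav (nbhd (K * d\<^sup>2) F)"
      using 1 2 by (simp add: distrib_right ennreal_plus)
    finally show ?thesis using S1 S2 by (intro bexI[of _ "S1 \<union> S2"]) auto
  qed
  then show ?thesis
    unfolding favard_controlled_def
    by (intro exI[of _ "min d1 d2"] conjI exI[of _ "C1 + C2"] exI[of _ K] allI impI)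
       (use 1 2 in \<open>simp_all add: K_def\<close>)
qed

lemma favard_controlled_compact:
  assumes V: "compact V" and loc: "\<And>z. z \<in> V \<Longrightarrow> \<exists>W. open W \<and> z \<in> W \<and> favard_controlled G W"
  shows "favard_controlled G V"
proof -
  obtain \<W> where W: "\<W> \<subseteq> {W. open W \<and> favard_controlled G W}" "finite \<W>" "V \<subseteq> \<Union>\<W>"
    by (rule compactE[OF V, of "{W. open W \<and> favard_controlled G W}"]) (use loc in blast)+
  have "favard_controlled G (\<Union>\<W>)"
    using W(2,1) by (induction rule: finite_induct) (auto simp: favard_controlled_empty favard_controlled_Un)
  then show ?thesis using W(3) by (rule favard_controlled_mono)
qed

lemma det_curvature_matrix:
  "det (curvature_matrix G z) =
    partial 4 G z * (partial 1 G z * partial 2 (partial 3 G) z - partial 2 G z * partial 1 (partial 3 G) z)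
    - partial 3 G z * (partial 1 G z * partial 2 (partial 4 G) z - partial 2 G z * partial 1 (partial 4 G) z)"
  by (simp add: curvature_matrix_def det_3 algebra_simps)

lemma favard_control:
  fixes G :: "(real^2) \<times> (real^2) \<Rightarrow> real"
  assumes U: "open U" and G: "C2_on U G"
    and B: "\<forall>i\<in>{1..4}. \<forall>j\<in>{1..4}. bounded (partial j (partial i G) ` U)"
    and det: "\<And>z. z \<in> U \<Longrightarrow> det (curvature_matrix G z) \<noteq> 0"
    and V: "compact V" "V \<subseteq> U"
  shows "favard_controlled G V"
proof (rule favard_controlled_compact[OF V(1)])
  fix z0 assume "z0 \<in> V"
  then have z0: "z0 \<in> U" using V(2) by blast
  note C2 = C2_onD[OF G U]
  show "\<exists>W. open W \<and> z0 \<in> W \<and> favard_controlled G W"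
  proof (cases "G z0 = 0")
    case False
    \<comment> \<open>Near a point where G does not vanish there are no zeros to cover.\<close>
    let ?W = "U \<inter> G -` (- {0})"
    have "open ?W"
      using continuous_open_preimage[OF differentiable_imp_continuous_on[OF C2(1)] U, of "- {0}"] by auto
    moreover have "favard_controlled G ?W"
      unfolding favard_controlled_def by (intro exI[of _ 1] conjI exI[of _ 0] allI impI bexI[of _ "{}"]) auto
    ultimately show ?thesis using z0 False by blast
  next
    case True
    have "\<forall>i\<in>{1..4}. \<forall>j\<in>{1..4}. \<exists>b. \<forall>z\<in>U. \<bar>partial j (partial i G) z\<bar> \<le> b"
      using B unfolding bounded_iff by (simp add: image_iff)
    then obtain b where b: "\<And>i j z. i \<in> {1..4} \<Longrightarrow> j \<in> {1..4} \<Longrightarrow> z \<in> U \<Longrightarrow> \<bar>partial j (partial i G) z\<bar> \<le> b i j"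
      by metis
    define b' where "b' = Max ((\<lambda>(i, j). b i j) ` ({1..4} \<times> {1..4}))"
    have bound: "\<bar>partial j (partial i G) z\<bar> \<le> b'" if "i \<in> {1..4}" "j \<in> {1..4}" "z \<in> U" for i j z
    proof -
      have "b i j \<le> b'" unfolding b'_def using that by (intro Max_ge) force+
      then show ?thesis using b[OF that] by linarith
    qed
    have sym: "partial j (partial i G) z0 = partial i (partial j G) z0" if "i \<in> {1..4}" "j \<in> {1..4}" for i j
      by (rule mixed_partials_commute[OF U z0 C2(1) C2(2)[OF that(1)] C2(6)[OF that] C2(2)[OF that(2)] C2(6)[OF that(2,1)]])
    have d: "partial 4 G z0 * (partial 1 G z0 * partial 3 (partial 2 G) z0 - partial 2 G z0 * partial 3 (partial 1 G) z0)
      - partial 3 G z0 * (partial 1 G z0 * partial 4 (partial 2 G) z0 - partial 2 G z0 * partial 4 (partial 1 G) z0) \<noteq> 0"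
      using det[OF z0] sym[of 1 3] sym[of 1 4] sym[of 2 3] sym[of 2 4] unfolding det_curvature_matrix by simp
    \<comment> \<open>The first column of the curvature matrix cannot vanish; its nonzero entry
      becomes the denominator of the chart.\<close>
    then have "partial 1 G z0 \<noteq> 0 \<or> partial 2 G z0 \<noteq> 0" by auto
    then show ?thesis
    proof
      assume "partial 1 G z0 \<noteq> 0"
      then show ?thesis
        by (intro local_favard_control[OF U z0 G bound, of 1 2 1 2]) (use d True in \<open>auto simp: algebra_simps\<close>)
    next
      assume "partial 2 G z0 \<noteq> 0"
      then show ?thesis
        by (intro local_favard_control[OF U z0 G bound, of 2 1 2 1]) (use d True in \<open>auto simp: algebra_simps\<close>)
    qed
  qed
qed

section \<open>Summation over the pieces\<close>

lemma ennreal_multiple_bound: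
  fixes x a :: ennreal
  assumes "x < \<infinity>" "0 < a"
  shows "\<exists>c\<ge>0. x \<le> ennreal c * a"
proof (cases a)
  case (real r)
  obtain t where t: "x = ennreal t" "0 \<le> t" using assms(1) by (cases x) auto
  have "0 < r" using real assms(2) by simp
  then have "x = ennreal (t / r) * a" using t real by (simp add: ennreal_mult[symmetric])
  then show ?thesis using t(2) \<open>0 < r\<close> by (intro exI[of _ "t / r"]) simp
next
  case top
  then show ?thesis by (intro exI[of _ 1]) simp
qed

text \<open>The set is the projection to y of a closed part of V. This makes the curve unions
  compact, hence measurable and of finite measure.\<close>

lemma compact_zero_slice:
  fixes G :: "'a::metric_space \<times> 'b::metric_space \<Rightarrow> real"
  assumes "compact F" "compact V" "continuous_on V G"
  shows "compact {y. \<exists>x\<in>F. (x, y) \<in> V \<and> G (x, y) = 0}"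
proof -
  let ?Z = "V \<inter> G -` {0} \<inter> fst -` F"
  have "closed (V \<inter> G -` {0})"
    using continuous_closed_preimage[OF assms(3) compact_imp_closed[OF assms(2)]] by simp
  moreover have "closed (fst -` F :: ('a \<times> 'b) set)"
    by (intro closed_vimage compact_imp_closed assms continuous_intros)
  ultimately have "closed ?Z" by (rule closed_Int)
  then have "compact (V \<inter> ?Z)" by (rule compact_Int_closed[OF assms(2)])
  moreover have "V \<inter> ?Z = ?Z" by blast
  ultimately have "compact (snd ` ?Z)"
    by (intro compact_continuous_image continuous_intros) simp
  moreover have "snd ` ?Z = {y. \<exists>x\<in>F. (x, y) \<in> V \<and> G (x, y) = 0}" by force
  ultimately show ?thesis by simp
qed

text \<open>On the line through y along the y-gradient, G changes sign at y. The signs at two points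
  on either side persist when x is moved a little, and the intermediate value theorem gives a zero
  between them.\<close>

lemma nearby_zero:
  fixes G :: "(real^2) \<times> (real^2) \<Rightarrow> real"
  assumes "open U" "(x, y) \<in> U" "G differentiable_on U" "G (x, y) = 0" "grad_y G (x, y) \<noteq> 0" "0 < \<epsilon>"
  obtains \<delta> where "0 < \<delta>" "\<And>x'. dist x' x < \<delta> \<Longrightarrow> \<exists>y'. (x', y') \<in> ball (x, y) \<epsilon> \<and> G (x', y') = 0"
proof -
  obtain \<epsilon>0 where "0 < \<epsilon>0" "ball (x, y) \<epsilon>0 \<subseteq> U" using assms(1,2) by (meson open_contains_ball)
  define e where "e = min \<epsilon> \<epsilon>0"
  have e: "0 < e" "e \<le> \<epsilon>" "ball (x, y) e \<subseteq> U"
    using \<open>0 < \<epsilon>\<close> \<open>0 < \<epsilon>0\<close> \<open>ball (x, y) \<epsilon>0 \<subseteq> U\<close> by (auto simp: e_def)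
  define v where "v = grad_y G (x, y)"
  have v0: "0 < norm v" using assms(5) by (simp add: v_def)
  have near: "(x', y + t *\<^sub>R v) \<in> ball (x, y) e" if "dist x' x < e / 2" "\<bar>t\<bar> * norm v \<le> e / 2" for x' t
  proof -
    have "dist (x', y + t *\<^sub>R v) (x, y) \<le> dist x' x + dist (y + t *\<^sub>R v) y"
      by (simp add: dist_Pair_Pair sqrt_sum_squares_le_sum)
    also have "dist (y + t *\<^sub>R v) y = \<bar>t\<bar> * norm v" by (simp add: dist_norm)
    finally show ?thesis using that by (simp add: dist_commute)
  qed
  have diff: "G differentiable (at z)" if "z \<in> U" for z
    using assms(1,3) that by (simp add: differentiable_on_eq_differentiable_at)
  have cont: "isCont G z" if "z \<in> ball (x, y) e" for z
  proof -
    have "z \<in> U" using e(3) that by blast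
    then show ?thesis by (rule differentiable_imp_continuous_within[OF diff])
  qed
  let ?\<phi> = "\<lambda>t. G (x, y + t *\<^sub>R v)"
  have "((\<lambda>t. y + t *\<^sub>R v) has_derivative (\<lambda>h. h *\<^sub>R v)) (at 0)"
    using has_derivative_add[OF has_derivative_const[of y] has_derivative_scaleR_left[OF has_derivative_ident, of v]]
    by simp
  moreover have "((\<lambda>y. G (x, y)) has_derivative (\<lambda>h. partial 3 G (x, y) * h $ 1 + partial 4 G (x, y) * h $ 2)) (at (y + 0 *\<^sub>R v))"
    using has_derivative_slice_snd[OF diff[OF assms(2)]] by simp
  ultimately have "(?\<phi> has_derivative (\<lambda>h. partial 3 G (x, y) * (h *\<^sub>R v) $ 1 + partial 4 G (x, y) * (h *\<^sub>R v) $ 2)) (at 0)"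
    by (rule has_derivative_compose)
  moreover have "(\<lambda>h. partial 3 G (x, y) * (h *\<^sub>R v) $ 1 + partial 4 G (x, y) * (h *\<^sub>R v) $ 2) = (*) ((norm v)\<^sup>2)"
    unfolding norm_vec2 by (auto simp: v_def grad_y_def fun_eq_iff power2_eq_square algebra_simps)
  ultimately have D: "(?\<phi> has_real_derivative (norm v)\<^sup>2) (at 0)"
    unfolding has_field_derivative_def by simp
  have pos: "0 < (norm v)\<^sup>2" using v0 by simp
  obtain d1 where d1: "0 < d1" "\<forall>h>0. h < d1 \<longrightarrow> ?\<phi> 0 < ?\<phi> (0 + h)"
    using DERIV_pos_inc_right[OF D pos] by blast
  obtain d2 where d2: "0 < d2" "\<forall>h>0. h < d2 \<longrightarrow> ?\<phi> (0 - h) < ?\<phi> 0"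
    using DERIV_pos_inc_left[OF D pos] by blast
  \<comment> \<open>Small enough for both strict signs, and for the segment to use only half of the
    radius e; the other half is left for moving x.\<close>
  define t where "t = min (min (d1 / 2) (d2 / 2)) (e / (2 * norm v))"
  have t: "0 < t" "t < d1" "t < d2" "t * norm v \<le> e / 2"
  proof -
    show "0 < t" "t < d1" "t < d2" using d1(1) d2(1) e v0 by (auto simp: t_def)
    have "t \<le> e / (2 * norm v)" by (simp add: t_def)
    then show "t * norm v \<le> e / 2" using v0 by (simp add: field_simps)
  qed
  have signs: "0 < ?\<phi> t" "?\<phi> (- t) < 0" using d1(2) d2(2) t assms(4) by auto
  have slice: "isCont (\<lambda>x'. G (x', y + s *\<^sub>R v)) x" if "\<bar>s\<bar> = t" for s
  proof -
    have "(x, y + s *\<^sub>R v) \<in> ball (x, y) e" using near[of x s] e t that by simp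
    then have "isCont G (x, y + s *\<^sub>R v)" by (rule cont)
    moreover have "isCont (\<lambda>x'. (x', y + s *\<^sub>R v)) x" by (intro continuous_intros)
    ultimately show ?thesis
      by (intro isCont_o2[where f = "\<lambda>x'. (x', y + s *\<^sub>R v)" and g = G and a = x])
  qed
  have "\<bar>t\<bar> = t" "\<bar>- t\<bar> = t" "0 < - ?\<phi> (- t)" using t(1) signs(2) by auto
  note eps = slice[OF this(1), unfolded continuous_at_eps_delta, rule_format, OF signs(1)]
    slice[OF this(2), unfolded continuous_at_eps_delta, rule_format, OF this(3)]
  obtain \<delta>1 where \<delta>1: "0 < \<delta>1" "\<forall>x'. dist x' x < \<delta>1 \<longrightarrow> dist (G (x', y + t *\<^sub>R v)) (?\<phi> t) < ?\<phi> t"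
    using eps(1) by blast
  obtain \<delta>2 where \<delta>2: "0 < \<delta>2"
      "\<forall>x'. dist x' x < \<delta>2 \<longrightarrow> dist (G (x', y + (- t) *\<^sub>R v)) (?\<phi> (- t)) < - ?\<phi> (- t)"
    using eps(2) by blast
  show ?thesis
  proof (rule that[of "min (min \<delta>1 \<delta>2) (e / 2)"])
    show "0 < min (min \<delta>1 \<delta>2) (e / 2)" using \<delta>1 \<delta>2 e by simp
    fix x' assume x': "dist x' x < min (min \<delta>1 \<delta>2) (e / 2)"
    have up: "0 \<le> G (x', y + t *\<^sub>R v)" using \<delta>1(2)[rule_format, of x'] x' by (simp add: dist_real_def)
    have lo: "G (x', y + (- t) *\<^sub>R v) \<le> 0" using \<delta>2(2)[rule_format, of x'] x' by (simp add: dist_real_def)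
    have inb: "(x', y + s *\<^sub>R v) \<in> ball (x, y) e" if "- t \<le> s" "s \<le> t" for s
    proof (rule near)
      show "dist x' x < e / 2" using x' by simp
      have "\<bar>s\<bar> * norm v \<le> t * norm v" using that by (intro mult_right_mono) auto
      then show "\<bar>s\<bar> * norm v \<le> e / 2" using t(4) by linarith
    qed
    have "\<forall>s. - t \<le> s \<and> s \<le> t \<longrightarrow> isCont (\<lambda>s. G (x', y + s *\<^sub>R v)) s"
    proof (intro allI impI)
      fix s assume "- t \<le> s \<and> s \<le> t"
      then have "isCont G (x', y + s *\<^sub>R v)" by (intro cont inb) auto
      moreover have "isCont (\<lambda>s. (x', y + s *\<^sub>R v)) s" by (intro continuous_intros)
      ultimately show "isCont (\<lambda>s. G (x', y + s *\<^sub>R v)) s"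
        by (intro isCont_o2[where f = "\<lambda>s. (x', y + s *\<^sub>R v)" and g = G and a = s])
    qed
    then obtain s where s: "- t \<le> s" "s \<le> t" "G (x', y + s *\<^sub>R v) = 0"
      using IVT[of "\<lambda>s. G (x', y + s *\<^sub>R v)" "- t" 0 t] lo up t(1) by auto
    have "(x', y + s *\<^sub>R v) \<in> ball (x, y) \<epsilon>" using inb[OF s(1,2)] e(2) by auto
    then show "\<exists>y'. (x', y') \<in> ball (x, y) \<epsilon> \<and> G (x', y') = 0" using s(3) by blast
  qed
qed

text \<open>A piece has radius \<open>s * R\<close>, so its error \<open>K * (s * R)\<^sup>2\<close>
  becomes \<open>K * R\<^sup>2 * s\<close> after rescaling by \<open>1 / s\<close>. Each piece
  contributes a factor s and there are at most \<open>1 / s\<close> pieces. The model set F0 is an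
  iterate in one application and E in the other.\<close>

lemma similar_pieces_control:
  assumes control: "\<forall>F xQ d. compact F \<longrightarrow> 0 < d \<longrightarrow> d \<le> d0 \<longrightarrow> F \<subseteq> cball xQ d \<longrightarrow>
     (\<exists>S\<in>sets lebesgue. {y. \<exists>x\<in>F. (x, y) \<in> W \<and> G (x, y) = 0} \<subseteq> S \<and>
        emeasure lebesgue S \<le> ennreal C * Fav (nbhd (K * d\<^sup>2) F))"
    and F0: "compact F0" "F0 \<subseteq> cball 0 R" and Z: "finite Z" "real (card Z) * s \<le> 1"
    and s: "0 < s" "0 < R" "s * R \<le> d0" and F: "F = (\<Union>z\<in>Z. (\<lambda>x. s *\<^sub>R x + z) ` F0)" and "0 \<le> C"
  shows "\<exists>S\<in>sets lebesgue. {y. \<exists>x\<in>F. (x, y) \<in> W \<and> G (x, y) = 0} \<subseteq> S \<and>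
        emeasure lebesgue S \<le> ennreal C * Fav (nbhd (K * R\<^sup>2 * s) F0)"
proof -
  define P where "P z = (\<lambda>x. s *\<^sub>R x + z) ` F0" for z
  let ?N = "nbhd (K * R\<^sup>2 * s) F0"
  have cP: "compact (P z)" for z
    unfolding P_def by (intro compact_continuous_image continuous_intros F0)
  have "P z \<subseteq> cball z (s * R)" for z
    unfolding P_def using F0(2) s by (auto simp: dist_norm)
  then have "\<exists>S. S \<in> sets lebesgue \<and> {y. \<exists>x\<in>P z. (x, y) \<in> W \<and> G (x, y) = 0} \<subseteq> S \<and>
        emeasure lebesgue S \<le> ennreal C * Fav (nbhd (K * (s * R)\<^sup>2) (P z))" for z
    using control cP s by (meson mult_pos_pos)
  then have "\<exists>S. \<forall>z. S z \<in> sets lebesgue \<and> {y. \<exists>x\<in>P z. (x, y) \<in> W \<and> G (x, y) = 0} \<subseteq> S z \<and>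
        emeasure lebesgue (S z) \<le> ennreal C * Fav (nbhd (K * (s * R)\<^sup>2) (P z))"
    by (intro choice allI)
  then obtain S where S: "\<And>z. S z \<in> sets lebesgue"
      "\<And>z. {y. \<exists>x\<in>P z. (x, y) \<in> W \<and> G (x, y) = 0} \<subseteq> S z"
      "\<And>z. emeasure lebesgue (S z) \<le> ennreal C * Fav (nbhd (K * (s * R)\<^sup>2) (P z))"
    by blast
  have FavP: "Fav (nbhd (K * (s * R)\<^sup>2) (P z)) = ennreal s * Fav ?N" for z
  proof -
    have "K * (s * R)\<^sup>2 = s * (K * R\<^sup>2 * s)" by (simp add: power2_eq_square)
    then have "nbhd (K * (s * R)\<^sup>2) (P z) = (\<lambda>x. s *\<^sub>R x + z) ` ?N"
      unfolding P_def using nbhd_affine[OF s(1)] by metis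
    then show ?thesis using Fav_affine[OF less_imp_le[OF s(1)] compact_nbhd[OF F0(1)]] by simp
  qed
  have "emeasure lebesgue (\<Union>z\<in>Z. S z) \<le> (\<Sum>z\<in>Z. emeasure lebesgue (S z))"
    by (intro emeasure_subadditive_finite) (use S Z in auto)
  also have "\<dots> \<le> (\<Sum>z\<in>Z. ennreal C * (ennreal s * Fav ?N))"
    by (intro sum_mono) (use S(3) FavP in simp)
  also have "\<dots> = ennreal (real (card Z) * s) * (ennreal C * Fav ?N)"
    using s by (simp add: ennreal_mult ennreal_of_nat_eq_real_of_nat mult_ac)
  also have "\<dots> \<le> 1 * (ennreal C * Fav ?N)"
    using Z(2) by (intro mult_right_mono) (simp_all add: ennreal_le_1)
  finally have "emeasure lebesgue (\<Union>z\<in>Z. S z) \<le> ennreal C * Fav ?N" by simp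
  moreover have "{y. \<exists>x\<in>F. (x, y) \<in> W \<and> G (x, y) = 0} \<subseteq> (\<Union>z\<in>Z. S z)"
    unfolding F using S(2) unfolding P_def by blast
  ultimately show ?thesis using S(1) Z(1) by (intro bexI[of _ "\<Union>z\<in>Z. S z"]) auto
qed

section \<open>Position of the iterates and of the attractor\<close>

lemma iterate_uniformly_bounded:
  assumes "2 \<le> L"
  shows "\<exists>R>0. \<forall>n. iterate L b n \<subseteq> cball 0 R"
proof -
  define \<beta> where "\<beta> = (\<Sum>i\<in>{1..L}. norm (b i))"
  have \<beta>: "norm (b i) \<le> \<beta>" if "i \<in> {1..L}" for i
    unfolding \<beta>_def using that by (intro member_le_sum) auto
  have \<beta>0: "0 \<le> \<beta>" unfolding \<beta>_def by (intro sum_nonneg) simp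
  \<comment> \<open>The summand 2 accommodates the unit square;
    \<open>R / 2 + \<beta> \<le> R\<close> makes the ball invariant, as the maps contract by at
    least 1/2.\<close>
  define R where "R = 2 + 2 * \<beta>"
  have "iterate L b n \<subseteq> cball 0 R" for n
  proof (induction n)
    case 0
    have "norm x \<le> R" if "x \<in> cbox 0 (1 :: real^2)" for x
    proof -
      have "\<bar>x $ 1\<bar> \<le> 1" "\<bar>x $ 2\<bar> \<le> 1" using that by (auto simp: mem_box_cart)
      then have "norm x \<le> 2" using norm_le_l1_cart[of x] by (simp add: sum_2)
      then show ?thesis using \<beta>0 by (simp add: R_def)
    qed
    then show ?case by auto
  next
    case (Suc n)
    have "norm (sim L b i x) \<le> R" if "i \<in> {1..L}" "x \<in> iterate L b n" for i x
    proof -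
      have x: "norm x \<le> R" using Suc that(2) by auto
      have tri: "norm (sim L b i x) \<le> norm ((1 / real L) *\<^sub>R x) + norm (b i)"
        unfolding sim_def by (rule norm_triangle_ineq)
      have half: "norm ((1 / real L) *\<^sub>R x) \<le> R / 2"
        using frac_le[OF _ x, of 2 "real L"] assms \<beta>0 by (simp add: R_def)
      have "norm (sim L b i x) \<le> R / 2 + \<beta>"
        by (rule order_trans[OF tri add_mono[OF half \<beta>[OF that(1)]]])
      moreover have "R / 2 + \<beta> \<le> R" using \<beta>0 by (simp add: R_def field_simps)
      ultimately show ?thesis by (rule order_trans)
    qed
    then show ?case by auto
  qed
  then show ?thesis using \<beta>0 by (intro exI[of _ R]) (simp add: R_def)
qed

lemma real_card_shifts: "0 < L \<Longrightarrow> real (card (shifts L b m)) * (1 / real L) ^ m \<le> 1"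
  using card_shifts[of L b m] by (simp add: power_one_over field_simps)

text \<open>The origin is a corner of the unit square, so every level-m translation is itself a
  point of the m-th iterate. With \<open>k = 1\<close> this compares consecutive iterates.\<close>

lemma iterate_add_subset_nbhd:
  assumes "iterate L b k \<subseteq> cball 0 R"
  shows "iterate L b (m + k) \<subseteq> nbhd (R * (1 / real L) ^ m) (iterate L b m)"
proof
  let ?s = "(1 / real L) ^ m"
  fix x assume "x \<in> iterate L b (m + k)"
  then obtain z y where z: "z \<in> shifts L b m" "y \<in> iterate L b k" "x = ?s *\<^sub>R y + z"
    unfolding iterate_add by blast
  have "(0 :: real^2) \<in> iterate L b 0" by (simp add: mem_box_cart)
  then have "?s *\<^sub>R 0 + z \<in> iterate L b (m + 0)"
    unfolding iterate_add using z(1) by (intro UN_I[of z] imageI)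
  then have "z \<in> iterate L b m" by simp
  moreover have "dist z x \<le> R * ?s"
  proof -
    have "dist z x = ?s * norm y" by (simp add: z(3) dist_norm)
    also have "\<dots> \<le> ?s * R" using assms z(2) by (intro mult_left_mono) auto
    finally show ?thesis by (simp add: mult.commute)
  qed
  ultimately show "x \<in> nbhd (R * ?s) (iterate L b m)" unfolding mem_nbhd by (intro bexI[of _ z])
qed

text \<open>The level-n translations lie in the n-th iterate and come within \<open>R * L^-n\<close>
  of every point of E; this stands in for the inclusion of E in the iterates.\<close>

lemma attractor_near_iterate:
  assumes E: "self_similar_1set L b E" and "x \<in> E" "0 < \<delta>"
  obtains n x' where "x' \<in> iterate L b n" "dist x' x < \<delta>"
proof -
  obtain R where R: "0 < R" "\<And>x. x \<in> E \<Longrightarrow> norm x \<le> R"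
    using compact_imp_bounded[OF compact_E[OF E]] unfolding bounded_pos by meson
  obtain n where n: "(1 / real L) ^ n < \<delta> / R"
    using real_arch_pow_inv[of "\<delta> / R" "1 / real L"] R(1) \<open>0 < \<delta>\<close> L_ge[OF E] by auto
  obtain z y where z: "z \<in> shifts L b n" "y \<in> E" "x = (1 / real L) ^ n *\<^sub>R y + z"
    using attractor_point[OF E \<open>x \<in> E\<close>, of n] by meson
  have "(0 :: real^2) \<in> iterate L b 0" by (simp add: mem_box_cart)
  then have "(1 / real L) ^ n *\<^sub>R 0 + z \<in> iterate L b (n + 0)"
    unfolding iterate_add using z(1) by (intro UN_I[of z] imageI)
  then have "z \<in> iterate L b n" by simp
  moreover have "dist z x < \<delta>"
  proof -
    have "dist z x = (1 / real L) ^ n * norm y" by (simp add: z(3) dist_norm)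
    also have "\<dots> \<le> (1 / real L) ^ n * R" by (intro mult_left_mono R z) simp
    also have "\<dots> < \<delta>" using n R(1) by (simp add: pos_less_divide_eq)
    finally show ?thesis .
  qed
  ultimately show ?thesis by (rule that)
qed

theorem theorem6p1:
  fixes U V :: "((real^2) \<times> (real^2)) set"
    and G :: "(real^2) \<times> (real^2) \<Rightarrow> real"
    and C0 :: real
    and L :: nat and b :: "nat \<Rightarrow> real^2" and E :: "(real^2) set"
  assumes "open U" and "bounded U"
    and "C2_on U G"
    and "bounded (G ` U)"
    and "\<forall>i\<in>{1..4}. bounded (partial i G ` U)"
    and "\<forall>i\<in>{1..4}. \<forall>j\<in>{1..4}. bounded (partial j (partial i G) ` U)"
    and "1 \<le> C0"
    and "\<forall>z\<in>U. 1 / C0 \<le> norm (grad_y G z)"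
    and "\<forall>z\<in>U. 1 / C0 \<le> \<bar>det (curvature_matrix G z)\<bar> \<and> \<bar>det (curvature_matrix G z)\<bar> \<le> C0"
    and "self_similar_1set L b E"
    and "compact V" and "V \<subseteq> U"
    and "\<forall>n. {(x, y). (x, y) \<in> U \<and> x \<in> iterate L b n \<and> G (x, y) = 0} \<subseteq> V"
  shows "(\<forall>n. curve_union U G (iterate L b n) \<in> sets lebesgue) \<and>
         (\<exists>C::real. 0 \<le> C \<and> (\<forall>n.
            emeasure lebesgue (curve_union U G (iterate L b n))
              \<le> ennreal C * Fav (iterate L b (n div 2)))) \<and>
         curve_union U G E \<in> sets lebesgue \<and>
         emeasure lebesgue (curve_union U G E) = 0 \<and> Fav E = 0"
proof -
  have E: "self_similar_1set L b E" by (rule assms(10))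
  have L3: "3 \<le> L" by (rule L_ge[OF E])
  have L0: "0 < L" "2 \<le> L" using L3 by auto
  note C2 = C2_onD[OF assms(3,1)]
  have zeros: "(x, y) \<in> V" if "x \<in> iterate L b n" "(x, y) \<in> U" "G (x, y) = 0" for n x y
    using assms(13)[rule_format, of n] that by blast
  have "0 < 1 / C0" using assms(7) by simp
  have det: "det (curvature_matrix G z) \<noteq> 0" if "z \<in> U" for z
    using assms(9) that \<open>0 < 1 / C0\<close> by force
  have grad: "grad_y G z \<noteq> 0" if "z \<in> U" for z
    using assms(8) that \<open>0 < 1 / C0\<close> by force
  \<comment> \<open>The hypothesis speaks of zeros over the iterates. A zero over E outside V would
    persist over a nearby point of some iterate and still avoid V.\<close>
  have zeros_E: "(x, y) \<in> V" if xy: "x \<in> E" "(x, y) \<in> U" "G (x, y) = 0" for x y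
  proof (rule ccontr)
    assume "(x, y) \<notin> V"
    moreover have "open (- V \<inter> U)"
      using compact_imp_closed[OF assms(11)] assms(1) by (intro open_Int) auto
    ultimately obtain \<epsilon> where \<epsilon>: "0 < \<epsilon>" "ball (x, y) \<epsilon> \<subseteq> - V \<inter> U"
      using xy(2) unfolding open_contains_ball by blast
    obtain \<delta> where \<delta>: "0 < \<delta>" "\<And>x'. dist x' x < \<delta> \<Longrightarrow> \<exists>y'. (x', y') \<in> ball (x, y) \<epsilon> \<and> G (x', y') = 0"
      using nearby_zero[OF assms(1) xy(2) C2(1) xy(3) grad[OF xy(2)] \<epsilon>(1)] by metis
    obtain n x' where x': "x' \<in> iterate L b n" "dist x' x < \<delta>"
      by (rule attractor_near_iterate[OF E xy(1) \<delta>(1)])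
    obtain y' where "(x', y') \<in> ball (x, y) \<epsilon>" "G (x', y') = 0" using \<delta>(2)[OF x'(2)] by blast
    then show False using zeros[OF x'(1)] \<epsilon>(2) by blast
  qed
  have slice: "curve_union U G F = {y. \<exists>x\<in>F. (x, y) \<in> V \<and> G (x, y) = 0}"
    if "\<And>x y. x \<in> F \<Longrightarrow> (x, y) \<in> U \<Longrightarrow> G (x, y) = 0 \<Longrightarrow> (x, y) \<in> V" for F
    using that assms(12) unfolding curve_union_def level_curve_def by blast
  have slice_n: "curve_union U G (iterate L b n) = {y. \<exists>x\<in>iterate L b n. (x, y) \<in> V \<and> G (x, y) = 0}" for n
    by (rule slice) (rule zeros)
  have slice_E: "curve_union U G E = {y. \<exists>x\<in>E. (x, y) \<in> V \<and> G (x, y) = 0}"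
    by (rule slice) (rule zeros_E)
  have cG: "continuous_on V G"
    using differentiable_imp_continuous_on[OF C2(1)] assms(12) by (rule continuous_on_subset)
  have cn: "compact (curve_union U G (iterate L b n))" for n
    unfolding slice_n by (intro compact_zero_slice compact_iterate assms(11) cG)
  have cE: "compact (curve_union U G E)"
    unfolding slice_E by (intro compact_zero_slice compact_E[OF E] assms(11) cG)
  have ctl: "favard_controlled G V"
    by (rule favard_control[OF assms(1,3,6) det assms(11,12)])
  obtain d0 C K where d0: "0 < d0" and C: "0 \<le> C" and K: "0 \<le> K"
    and control: "\<forall>F xQ d. compact F \<longrightarrow> 0 < d \<longrightarrow> d \<le> d0 \<longrightarrow> F \<subseteq> cball xQ d \<longrightarrow>
     (\<exists>S\<in>sets lebesgue. {y. \<exists>x\<in>F. (x, y) \<in> V \<and> G (x, y) = 0} \<subseteq> S \<and>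
        emeasure lebesgue S \<le> ennreal C * Fav (nbhd (K * d\<^sup>2) F))"
    using ctl by (rule favard_controlledE)
  define s where "s m = (1 / real L) ^ m" for m
  have s0: "0 < s m" for m unfolding s_def using L0 by simp
  have s_small: "\<exists>m0. \<forall>m\<ge>m0. s m < \<epsilon>" if pos: "0 < \<epsilon>" for \<epsilon>
  proof -
    obtain m0 where m0: "s m0 < \<epsilon>"
      using real_arch_pow_inv[OF pos, of "1 / real L"] L3 unfolding s_def by auto
    have "s m \<le> s m0" if "m0 \<le> m" for m
      unfolding s_def using that L3 by (intro power_decreasing) auto
    then show ?thesis using m0 by (meson le_less_trans)
  qed

  have "emeasure lebesgue (curve_union U G E) = 0"
  proof -
    obtain R where R: "0 < R" "\<And>x. x \<in> E \<Longrightarrow> norm x \<le> R"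
      using compact_imp_bounded[OF compact_E[OF E]] unfolding bounded_pos by meson
    have ER: "E \<subseteq> cball 0 R" using R(2) by auto
    have "emeasure lebesgue (curve_union U G E) \<le> ennreal (C * \<epsilon>)" if \<epsilon>: "0 < \<epsilon>" for \<epsilon>
    proof -
      obtain r where r: "0 < r" "Fav (nbhd r E) \<le> ennreal \<epsilon>"
        by (rule Fav_nbhd_small[OF compact_E[OF E] Fav_self_similar_eq_0[OF E] \<epsilon>])
      \<comment> \<open>The first bound makes the pieces small enough for the local control, the
        second puts the error below r. Adding 1 keeps the denominator positive when
        \<open>K = 0\<close>.\<close>
      have "0 < min (d0 / R) (r / (K * R\<^sup>2 + 1))"
        using d0 R(1) r(1) K by (simp add: add_nonneg_pos)
      then obtain m where m: "s m < min (d0 / R) (r / (K * R\<^sup>2 + 1))" using s_small by blast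
      have "s m * R \<le> d0" using m R(1) by (simp add: pos_less_divide_eq less_imp_le)
      have "s m * (K * R\<^sup>2 + 1) \<le> r"
        using m K by (simp add: pos_less_divide_eq add_nonneg_pos less_imp_le)
      then have Kr: "K * R\<^sup>2 * s m \<le> r" using s0[of m] by (simp add: algebra_simps)
      have "\<exists>S\<in>sets lebesgue. {y. \<exists>x\<in>E. (x, y) \<in> V \<and> G (x, y) = 0} \<subseteq> S \<and>
          emeasure lebesgue S \<le> ennreal C * Fav (nbhd (K * R\<^sup>2 * s m) E)"
        by (rule similar_pieces_control[OF control compact_E[OF E] ER finite_shifts[of L b m] _ s0 R(1) \<open>s m * R \<le> d0\<close> _ C])
          (use real_card_shifts[OF L0(1)] E_decomposition[OF E] in \<open>simp_all only: s_def\<close>)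
      then obtain S where S: "S \<in> sets lebesgue" "curve_union U G E \<subseteq> S"
          "emeasure lebesgue S \<le> ennreal C * Fav (nbhd (K * R\<^sup>2 * s m) E)"
        unfolding slice_E by blast
      have "emeasure lebesgue (curve_union U G E) \<le> emeasure lebesgue S" by (rule emeasure_mono[OF S(2,1)])
      also have "\<dots> \<le> ennreal C * Fav (nbhd (K * R\<^sup>2 * s m) E)" by (rule S(3))
      also have "\<dots> \<le> ennreal C * Fav (nbhd r E)"
        by (intro mult_left_mono Fav_mono nbhd_mono Kr compact_nbhd compact_E[OF E]) auto
      also have "\<dots> \<le> ennreal C * ennreal \<epsilon>" by (intro mult_left_mono r(2)) simp
      finally show ?thesis using C \<epsilon> by (simp add: ennreal_mult)
    qed
    note le = this
    have eps: "emeasure lebesgue (curve_union U G E) \<le> 0 + ennreal e" if "0 < e" for e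
    proof -
      have "emeasure lebesgue (curve_union U G E) \<le> ennreal (C * (e / (C + 1)))"
        using C that by (intro le) simp
      also have "\<dots> \<le> ennreal e" using C that by (intro ennreal_leI) (simp add: field_simps)
      finally show ?thesis by simp
    qed
    have "emeasure lebesgue (curve_union U G E) \<le> 0" by (rule ennreal_le_epsilon) (rule eps)
    then show ?thesis by simp
  qed

  moreover have "\<exists>C'\<ge>0. \<forall>n. emeasure lebesgue (curve_union U G (iterate L b n)) \<le> ennreal C' * Fav (iterate L b (n div 2))"
  proof -
    obtain R where R: "0 < R" "\<And>n. iterate L b n \<subseteq> cball 0 R"
      using iterate_uniformly_bounded[OF L0(2)] by blast
    \<comment> \<open>In units of \<open>s m\<close>, the linearisation error contributes
      \<open>K * R\<^sup>2\<close>, and the distance from the k-th to the m-th iterate contributes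
      R.\<close>
    define N where "N = nat \<lceil>K * R\<^sup>2 + R\<rceil>"
    have N: "K * R\<^sup>2 + R \<le> real N" unfolding N_def by linarith
    define C1 where "C1 = C * (2 * real N + 1)"
    have C1: "0 \<le> C1" using C by (simp add: C1_def)
    let ?X = "\<lambda>n. emeasure lebesgue (curve_union U G (iterate L b n))"
    obtain m0 where m0: "\<And>m. m0 \<le> m \<Longrightarrow> s m < d0 / R" using s_small[of "d0 / R"] d0 R(1) by auto
    have large: "?X n \<le> ennreal C1 * Fav (iterate L b (n div 2))" if n: "m0 \<le> n div 2" for n
    proof -
      define m where "m = n div 2"
      define k where "k = n - m"
      \<comment> \<open>For odd n one generation is left over, hence the second alternative.\<close>
      have mk: "n = m + k" "k = m \<or> k = m + 1" by (auto simp: k_def m_def)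
      have sR: "s m * R \<le> d0"
        using m0[of m] n R(1) by (simp add: m_def pos_less_divide_eq less_imp_le)
      have "\<exists>S\<in>sets lebesgue. {y. \<exists>x\<in>iterate L b n. (x, y) \<in> V \<and> G (x, y) = 0} \<subseteq> S \<and>
          emeasure lebesgue S \<le> ennreal C * Fav (nbhd (K * R\<^sup>2 * s m) (iterate L b k))"
        by (rule similar_pieces_control[OF control compact_iterate R(2) finite_shifts[of L b m] _ s0 R(1) sR _ C])
          (use real_card_shifts[OF L0(1)] iterate_add[of L b m k] mk(1) in \<open>simp_all only: s_def\<close>)
      then obtain S where S: "S \<in> sets lebesgue" "curve_union U G (iterate L b n) \<subseteq> S"
          "emeasure lebesgue S \<le> ennreal C * Fav (nbhd (K * R\<^sup>2 * s m) (iterate L b k))"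
        unfolding slice_n by blast
      have "iterate L b k \<subseteq> nbhd (R * s m) (iterate L b m)"
      proof (cases "k = m")
        case True
        then show ?thesis using R(1) s0[of m] by (simp add: subset_nbhd)
      next
        case False
        then have "k = m + 1" using mk(2) by simp
        then show ?thesis unfolding s_def using iterate_add_subset_nbhd[OF R(2)[of 1], of m] by simp
      qed
      then have "nbhd (K * R\<^sup>2 * s m) (iterate L b k) \<subseteq> nbhd (K * R\<^sup>2 * s m) (nbhd (R * s m) (iterate L b m))"
        by (intro nbhd_mono) auto
      also have "\<dots> \<subseteq> nbhd (K * R\<^sup>2 * s m + R * s m) (iterate L b m)" by (rule nbhd_nbhd)
      also have "\<dots> \<subseteq> nbhd (real N * s m) (iterate L b m)"
        using mult_right_mono[OF N less_imp_le[OF s0[of m]]]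
        by (intro nbhd_mono) (auto simp: distrib_right)
      finally have sub: "nbhd (K * R\<^sup>2 * s m) (iterate L b k) \<subseteq> nbhd (real N * s m) (iterate L b m)" .
      have "?X n \<le> emeasure lebesgue S" by (rule emeasure_mono[OF S(2,1)])
      also have "\<dots> \<le> ennreal C * Fav (nbhd (K * R\<^sup>2 * s m) (iterate L b k))" by (rule S(3))
      also have "\<dots> \<le> ennreal C * Fav (nbhd (real N * s m) (iterate L b m))"
        by (intro mult_left_mono Fav_mono sub compact_nbhd compact_iterate) auto
      also have "\<dots> \<le> ennreal C * (ennreal (2 * real N + 1) * Fav (iterate L b m))"
        unfolding s_def by (intro mult_left_mono Fav_nbhd_iterate L0) simp
      also have "\<dots> = ennreal C1 * Fav (iterate L b (n div 2))"
        unfolding C1_def m_def using C by (simp add: ennreal_mult mult.assoc)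
      finally show ?thesis .
    qed
    have "\<exists>c\<ge>0. ?X n \<le> ennreal c * Fav (iterate L b (n div 2))" for n
    proof (rule ennreal_multiple_bound)
      show "?X n < \<infinity>" using lmeasurable_compact[OF cn[of n]] unfolding fmeasurable_def by blast
      show "0 < Fav (iterate L b (n div 2))" by (rule Fav_iterate_pos[OF L0(1)])
    qed
    then obtain c where c: "\<And>n. 0 \<le> c n" "\<And>n. ?X n \<le> ennreal (c n) * Fav (iterate L b (n div 2))"
      by metis
    \<comment> \<open>The sum runs over exactly those n with \<open>n div 2 < m0\<close>, which the
      estimate at small scales does not reach.\<close>
    define C' where "C' = C1 + (\<Sum>n<2 * m0. c n)"
    have sum0: "0 \<le> (\<Sum>n<2 * m0. c n)" by (intro sum_nonneg c)
    have "?X n \<le> ennreal C' * Fav (iterate L b (n div 2))" for n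
    proof (cases "m0 \<le> n div 2")
      case True
      have "ennreal C1 * Fav (iterate L b (n div 2)) \<le> ennreal C' * Fav (iterate L b (n div 2))"
        using sum0 by (intro mult_right_mono ennreal_leI) (simp_all add: C'_def)
      then show ?thesis using large[OF True] by (rule order_trans[rotated])
    next
      case False
      then have "c n \<le> (\<Sum>n<2 * m0. c n)" by (intro member_le_sum c) auto
      then have "c n \<le> C'" using C1 by (simp add: C'_def)
      then have "ennreal (c n) * Fav (iterate L b (n div 2)) \<le> ennreal C' * Fav (iterate L b (n div 2))"
        by (intro mult_right_mono ennreal_leI) simp_all
      then show ?thesis using c(2)[of n] by (rule order_trans[rotated])
    qed
    then show ?thesis using C1 sum0 by (intro exI[of _ C']) (simp add: C'_def)
  qed

  ultimately show ?thesis
    using fmeasurableD[OF lmeasurable_compact[OF cn]] fmeasurableD[OF lmeasurable_compact[OF cE]]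
      Fav_self_similar_eq_0[OF E] by simp
qed

end
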